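(* Let $\phi\in\Phi^2\setminus\{0\}$ and let $K\subset\mathbb{R}^2$ be a centrally symmetric planar convex body. Then $K$ is determined by the knowledge of $\phi$ and $g_{K,\phi}$, up to translations, within the class of all planar convex bodies; that is, if $H$ is a planar convex body with $g_{H,\phi}=g_{K,\phi}$, then $H$ is a translate of $K$.
   Context: $\mathcal{K}^2$ is the set of all compact convex subsets of $\mathbb{R}^2$ (including $\emptyset$). A planar convex body is an element of $\mathcal{K}^2$ with nonempty interior. $\Phi^2$ is the set of all functionals $\phi:\mathcal{K}^2\to\mathbb{R}$ such that: $\phi(\emptyset)=0$ and $\phi(K\cup H)=\phi(K)+\phi(H)-\phi(K\cap H)$ whenever $K,H,K\cup H\in\mathcal{K}^2$ (valuation); $\phi(K+x)=\phi(K)$ for all $K\in\mathcal{K}^2$, $x\in\mathbb{R}^2$ (translation invariant); $\phi(K)\le\phi(H)$ whenever $K\subset H$, $K,H\in\mathcal{K}^2$ (monotone); $\phi(-K)=\phi(K)$ for all $K\in\mathcal{K}^2$ (even); and $\phi(\{o\})=0$, where $o$ is the origin. For a planar convex body $K$, the $\phi$-covariogram is the function $g_{K,\phi}:\mathbb{R}^2\to\mathbb{R}$, $g_{K,\phi}(x)=\phi(K\cap(K+x))$. A set is centrally symmetric if it coincides with its reflection at some point. *)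

theory Defs
  imports "HOL-Analysis.Analysis"
begin

definition compact_convex_sets :: "(real ^ 2) set set" where
  "compact_convex_sets = {K. compact K \<and> convex K}"

definition planar_convex_body :: "(real ^ 2) set \<Rightarrow> bool" where
  "planar_convex_body K \<longleftrightarrow> K \<in> compact_convex_sets \<and> interior K \<noteq> {}"

definition valuation :: "((real ^ 2) set \<Rightarrow> real) \<Rightarrow> bool" where
  "valuation \<phi> \<longleftrightarrow> \<phi> {} = 0 \<and>
    (\<forall>K\<in>compact_convex_sets. \<forall>H\<in>compact_convex_sets.
      K \<union> H \<in> compact_convex_sets \<longrightarrow> \<phi> (K \<union> H) = \<phi> K + \<phi> H - \<phi> (K \<inter> H))"

definition translation_invariant :: "((real ^ 2) set \<Rightarrow> real) \<Rightarrow> bool" where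
  "translation_invariant \<phi> \<longleftrightarrow>
    (\<forall>K\<in>compact_convex_sets. \<forall>x. \<phi> ((+) x ` K) = \<phi> K)"

definition monotone_functional :: "((real ^ 2) set \<Rightarrow> real) \<Rightarrow> bool" where
  "monotone_functional \<phi> \<longleftrightarrow> mono_on compact_convex_sets \<phi>"

definition even_functional :: "((real ^ 2) set \<Rightarrow> real) \<Rightarrow> bool" where
  "even_functional \<phi> \<longleftrightarrow> (\<forall>K\<in>compact_convex_sets. \<phi> (uminus ` K) = \<phi> K)"

text \<open>Functionals on the compact convex sets are represented by total functions on all sets;
  their values outside \<^const>\<open>compact_convex_sets\<close> are irrelevant. Accordingly, the zero
  functional is any function that vanishes on \<^const>\<open>compact_convex_sets\<close>.\<close>

definition Phi2 :: "((real ^ 2) set \<Rightarrow> real) set" where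
  "Phi2 = {\<phi>. valuation \<phi> \<and> translation_invariant \<phi> \<and> monotone_functional \<phi> \<and>
    even_functional \<phi> \<and> \<phi> {0} = 0}"

definition zero_functional :: "((real ^ 2) set \<Rightarrow> real) \<Rightarrow> bool" where
  "zero_functional \<phi> \<longleftrightarrow> (\<forall>K\<in>compact_convex_sets. \<phi> K = 0)"

definition covariogram :: "((real ^ 2) set \<Rightarrow> real) \<Rightarrow> (real ^ 2) set \<Rightarrow> real ^ 2 \<Rightarrow> real" where
  "covariogram \<phi> K x = \<phi> (K \<inter> (+) x ` K)"

text \<open>The reflection at the point \<open>c\<close> is the map \<open>x \<mapsto> 2 c - x\<close>.\<close>

definition centrally_symmetric :: "(real ^ 2) set \<Rightarrow> bool" where
  "centrally_symmetric K \<longleftrightarrow> (\<exists>c. (\<lambda>x. 2 *\<^sub>R c - x) ` K = K)"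

end

theory Submission
  imports Defs
begin

text \<open>
  Translate \<open>K\<close> so that \<open>K = - K\<close>. As \<open>\<phi>\<close> is positive on bodies with interior, the support of the
  covariogram is the difference body, so \<open>K = (H - H) / 2\<close>.

  Adding a segment changes \<open>\<phi>\<close> by \<open>\<phi> (A + [-v, v]) = \<phi> A + F v + c w(A, v)\<close>, where \<open>w\<close> is a width and \<open>c\<close> a
  constant, so \<open>\<phi>\<close> is known on zonogons and, by monotonicity, on all centrally symmetric bodies. A chord of
  maximal length cuts \<open>H\<close> into two halves; by evenness \<open>\<phi> H\<close> is the mean of the values of \<open>\<phi>\<close> on the two symmetric
  bodies obtained by reflecting the halves, and the Minkowski mean of these two bodies is \<open>K\<close>. Therefore
  \<open>\<phi> K - \<phi> H\<close> is proportional to \<open>area K - area H\<close>, with factor \<open>c\<close>.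

  If \<open>c \<noteq> 0\<close>, then \<open>\<phi> H = \<phi> K\<close> shows that the areas agree. If \<open>c = 0\<close>, then \<open>\<phi>\<close> does not change under
  symmetrization, and the symmetrization of \<open>H \<inter> (H + x)\<close> is contained in a translate of \<open>K \<inter> (K + x)\<close>; as the
  values of \<open>\<phi>\<close> agree, both have the same width in a direction in which \<open>\<phi>\<close> is strictly monotone. For \<open>x\<close> perpendicular
  to that direction these widths are the measures of the sets of heights where chords have at least a given length,
  and integrating them gives the area. So the areas agree in both cases.

  Conversely, equality of the areas forces equality of these widths in every direction. For extreme
  points \<open>q, q'\<close> of \<open>K\<close> this places a translate of the parallelogram with vertices \<open>\<plusminus>q, \<plusminus>q'\<close> inside \<open>H\<close>. If \<open>q\<close> has maximal
  norm, its center is unique and hence common to all \<open>q'\<close>, so \<open>H\<close> contains a translate of \<open>K\<close>, which must be all of \<open>H\<close>.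
\<close>

section \<open>Functionals along segment summands\<close>

text \<open>The determinant of the pair. For \<open>v \<noteq> 0\<close> it is, up to scaling, the
  coordinate of \<open>y\<close> transverse to \<open>v\<close>, so projecting along
  \<open>v\<close> amounts to taking the determinant with \<open>v\<close>.\<close>

definition wedge :: "real ^ 2 \<Rightarrow> real ^ 2 \<Rightarrow> real" where
  "wedge y v = y $ 1 * v $ 2 - y $ 2 * v $ 1"

definition seg :: "real ^ 2 \<Rightarrow> (real ^ 2) set" where
  "seg v = (\<lambda>a. a *\<^sub>R v) ` {-1..1}"

definition perp :: "real ^ 2 \<Rightarrow> real ^ 2" where
  "perp v = vector [- (v $ 2), v $ 1]"

definition width :: "(real ^ 2) set \<Rightarrow> real ^ 2 \<Rightarrow> real" where
  "width A v = (SUP a\<in>A. wedge a v) - (INF a\<in>A. wedge a v)"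

lemma wedge_simps [simp]:
  "wedge (x + y) v = wedge x v + wedge y v" "wedge (x - y) v = wedge x v - wedge y v"
  "wedge (- x) v = - wedge x v" "wedge (r *\<^sub>R x) v = r * wedge x v" "wedge 0 v = 0"
  "wedge v (x + y) = wedge v x + wedge v y" "wedge v (x - y) = wedge v x - wedge v y"
  "wedge v (- x) = - wedge v x" "wedge v (r *\<^sub>R x) = r * wedge v x" "wedge v 0 = 0"
  "wedge v v = 0"
  by (simp_all add: wedge_def algebra_simps)

lemma wedge_commute: "wedge y v = - wedge v y"
  by (simp add: wedge_def)

lemma perp_simps [simp]: "perp v $ 1 = - (v $ 2)" "perp v $ 2 = v $ 1"
  by (simp_all add: perp_def)

lemma wedge_perp: "wedge v (perp v) = v \<bullet> v"
  by (simp add: wedge_def inner_vec_def UNIV_2)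

lemma wedge_perp_left: "wedge (perp v) v = - (v \<bullet> v)"
  using wedge_perp[of v] wedge_commute[of v "perp v"] by simp

lemma wedge_eq_0_iff:
  assumes v: "v \<noteq> 0"
  shows "wedge y v = 0 \<longleftrightarrow> (\<exists>t. y = t *\<^sub>R v)"
proof
  assume w: "wedge y v = 0"
  have eq: "y $ 1 * v $ 2 = y $ 2 * v $ 1" using w by (simp add: wedge_def)
  have "v \<bullet> v = v $ 1 * v $ 1 + v $ 2 * v $ 2" "y \<bullet> v = y $ 1 * v $ 1 + y $ 2 * v $ 2"
    by (simp_all add: inner_vec_def UNIV_2)
  then have "(v \<bullet> v) * y $ 1 = (y \<bullet> v) * v $ 1" "(v \<bullet> v) * y $ 2 = (y \<bullet> v) * v $ 2"
    using eq by algebra+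
  then have "y = ((y \<bullet> v) / (v \<bullet> v)) *\<^sub>R v"
    using v by (simp add: vec_eq_iff forall_2 eq_divide_eq mult.commute)
  then show "\<exists>t. y = t *\<^sub>R v" by blast
next
  assume "\<exists>t. y = t *\<^sub>R v"
  then show "wedge y v = 0" by auto
qed

lemma continuous_on_wedge [continuous_intros]:
  "continuous_on S f \<Longrightarrow> continuous_on S g \<Longrightarrow> continuous_on S (\<lambda>x. wedge (f x) (g x))"
  unfolding wedge_def by (intro continuous_intros)

lemma mem_seg: "y \<in> seg v \<longleftrightarrow> (\<exists>a. \<bar>a\<bar> \<le> 1 \<and> y = a *\<^sub>R v)"
  unfolding seg_def image_iff Bex_def atLeastAtMost_iff abs_le_iff by (metis minus_le_iff)

lemma compact_seg [simp]: "compact (seg v)"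
  unfolding seg_def by (intro compact_continuous_image continuous_intros) auto

lemma convex_seg [simp]: "convex (seg v)"
  unfolding seg_def by (intro convex_linear_image) (auto intro: bounded_linear.linear bounded_linear_scaleR_left)

lemma zero_in_seg [simp]: "0 \<in> seg v"
  unfolding mem_seg by (rule exI[of _ 0]) simp

lemma seg_nonempty [simp]: "seg v \<noteq> {}"
  using zero_in_seg by blast

lemma seg_0 [simp]: "seg 0 = {0}"
  using zero_in_seg[of 0] by (auto simp: mem_seg)

lemma plus_singleton_0 [simp]: "A + {0} = A" for A :: "'a::monoid_add set"
  by (auto simp: set_plus_def)

lemma compact_set_plus [simp]: "compact A \<Longrightarrow> compact B \<Longrightarrow> compact (A + B)" 
  for A B :: "'a::real_normed_vector set"
proof -
  assume "compact A" "compact B"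
  moreover have "A + B = {x + y |x y. x \<in> A \<and> y \<in> B}" by (auto simp: set_plus_def)
  ultimately show ?thesis by (simp add: compact_sums)
qed

lemma set_plus_empty [simp]: "A + {} = {}"
  by (auto simp: set_plus_def)

lemma set_plus_eq_empty [simp]: "A + B = {} \<longleftrightarrow> A = {} \<or> B = {}"
  by (auto simp: set_plus_def)

lemma mem_plus_seg:
  assumes "0 \<le> s"
  shows "y \<in> A + seg (s *\<^sub>R v) \<longleftrightarrow> (\<exists>a\<in>A. \<exists>\<alpha>. \<bar>\<alpha>\<bar> \<le> s \<and> y = a + \<alpha> *\<^sub>R v)"
proof
  assume "y \<in> A + seg (s *\<^sub>R v)"
  then obtain a b where "a \<in> A" "\<bar>b\<bar> \<le> 1" "y = a + b *\<^sub>R s *\<^sub>R v"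
    by (auto simp: set_plus_def mem_seg)
  then show "\<exists>a\<in>A. \<exists>\<alpha>. \<bar>\<alpha>\<bar> \<le> s \<and> y = a + \<alpha> *\<^sub>R v"
    using assms by (intro bexI[of _ a] exI[of _ "b * s"]) (auto simp: abs_mult mult_left_le_one_le)
next
  assume "\<exists>a\<in>A. \<exists>\<alpha>. \<bar>\<alpha>\<bar> \<le> s \<and> y = a + \<alpha> *\<^sub>R v"
  then obtain a \<alpha> where a: "a \<in> A" "\<bar>\<alpha>\<bar> \<le> s" "y = a + \<alpha> *\<^sub>R v" by blast
  show "y \<in> A + seg (s *\<^sub>R v)"
  proof (cases "s = 0")
    case True then show ?thesis using a by (auto simp: set_plus_def)
  next
    case False
    then have "\<bar>\<alpha> / s\<bar> \<le> 1 \<and> \<alpha> *\<^sub>R v = (\<alpha> / s) *\<^sub>R s *\<^sub>R v"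
      using a assms by (auto simp: abs_divide)
    then have "\<alpha> *\<^sub>R v \<in> seg (s *\<^sub>R v)" unfolding mem_seg by blast
    then show ?thesis using a by (auto simp: set_plus_def)
  qed
qed

lemma mem_translate: "y \<in> (+) x ` S \<longleftrightarrow> y - x \<in> S" for x y :: "'a::ab_group_add"
  by (auto simp: image_iff algebra_simps) (metis add.commute diff_add_cancel)

lemma mem_translate_plus_seg:
  assumes "0 \<le> s"
  shows "y \<in> (+) (r *\<^sub>R v) ` (A + seg (s *\<^sub>R v)) \<longleftrightarrow>
    (\<exists>a\<in>A. \<exists>\<alpha>. r - s \<le> \<alpha> \<and> \<alpha> \<le> r + s \<and> y = a + \<alpha> *\<^sub>R v)" (is "?L \<longleftrightarrow> ?R")
proof
  assume ?L
  then have "\<exists>a\<in>A. \<exists>\<alpha>. \<bar>\<alpha>\<bar> \<le> s \<and> y - r *\<^sub>R v = a + \<alpha> *\<^sub>R v"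
    unfolding mem_translate mem_plus_seg[OF assms] .
  then obtain a \<alpha> where "a \<in> A" "\<bar>\<alpha>\<bar> \<le> s" "y - r *\<^sub>R v = a + \<alpha> *\<^sub>R v" by blast
  then show ?R by (intro bexI[of _ a] exI[of _ "\<alpha> + r"]) (auto simp: algebra_simps)
next
  assume ?R
  then obtain a \<alpha> where "a\<in>A" "r - s \<le> \<alpha>" "\<alpha> \<le> r + s" "y = a + \<alpha> *\<^sub>R v" by blast
  then show ?L unfolding mem_translate mem_plus_seg[OF assms]
    by (intro bexI[of _ a] exI[of _ "\<alpha> - r"]) (auto simp: algebra_simps)
qed

lemma seg_minus [simp]: "seg (- v) = seg v"
proof -
  have "seg (- v) \<subseteq> seg v" for v
  proof
    fix y assume "y \<in> seg (- v)"
    then obtain a where "\<bar>a\<bar> \<le> 1" "y = a *\<^sub>R (- v)" unfolding mem_seg by blast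
    then show "y \<in> seg v" unfolding mem_seg by (intro exI[of _ "- a"]) simp
  qed
  from this[of v] this[of "- v"] show ?thesis by auto
qed

text \<open>Cauchy's functional equation on the half-line: nonnegativity makes \<open>g\<close>
  monotone, so \<open>g (n * s)\<close> is trapped between consecutive multiples of
  \<open>g 1\<close>, and the error, multiplied by any \<open>n\<close>, stays at most
  \<open>g 1\<close>.\<close>

lemma additive_nonneg_imp_linear:
  fixes g :: "real \<Rightarrow> real"
  assumes add: "\<And>s t. 0 \<le> s \<Longrightarrow> 0 \<le> t \<Longrightarrow> g (s + t) = g s + g t"
    and nonneg: "\<And>s. 0 \<le> s \<Longrightarrow> 0 \<le> g s" and s: "0 \<le> s"
  shows "g s = s * g 1"
proof -
  have mult: "g (real n * t) = real n * g t" if "0 \<le> t" for n t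
  proof (induction n)
    case 0 show ?case using add[of 0 0] by simp
  next
    case (Suc n) then show ?case using add[of "real n * t" t] that by (simp add: algebra_simps)
  qed
  have mono: "g a \<le> g b" if "0 \<le> a" "a \<le> b" for a b
    using add[of a "b - a"] nonneg[of "b - a"] that by simp
  have g1: "0 \<le> g 1" using nonneg by simp
  have bound: "real n * \<bar>g s - s * g 1\<bar> \<le> g 1" for n
  proof -
    define m where "m = nat \<lfloor>real n * s\<rfloor>"
    have m: "real m \<le> real n * s" "real n * s \<le> real (Suc m)"
      using s by (auto simp: m_def) linarith+
    have "real m * g 1 \<le> g (real n * s)" using mono[OF _ m(1)] mult[of 1 m] by simp
    moreover have "g (real n * s) \<le> real (Suc m) * g 1"
      using mono[OF _ m(2)] mult[of 1 "Suc m"] s by simp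
    moreover have "real m * g 1 \<le> real n * s * g 1" "real n * s * g 1 \<le> real (Suc m) * g 1"
      using m g1 by (auto intro: mult_right_mono)
    ultimately have "\<bar>real n * g s - real n * s * g 1\<bar> \<le> g 1"
      using mult[OF s, of n] by (auto simp: algebra_simps abs_le_iff)
    moreover have "\<bar>real n * g s - real n * s * g 1\<bar> = real n * \<bar>g s - s * g 1\<bar>"
      using abs_mult[of "real n" "g s - s * g 1"] by (simp add: algebra_simps)
    ultimately show ?thesis by simp
  qed
  show ?thesis
  proof (rule ccontr)
    assume "g s \<noteq> s * g 1"
    then have "0 < \<bar>g s - s * g 1\<bar>" by simp
    then obtain n where "g 1 < real n * \<bar>g s - s * g 1\<bar>" using reals_Archimedean3 by blast
    with bound[of n] show False by simp
  qed
qed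

section \<open>Growth of a functional under segment summands\<close>

locale Phi2_functional =
  fixes \<phi> :: "(real ^ 2) set \<Rightarrow> real"
  assumes Phi2: "\<phi> \<in> Phi2"
begin

lemma empty [simp]: "\<phi> {} = 0" and singleton_0 [simp]: "\<phi> {0} = 0"
  using Phi2 by (auto simp: Phi2_def valuation_def)

lemma union: "compact A \<Longrightarrow> convex A \<Longrightarrow> compact B \<Longrightarrow> convex B \<Longrightarrow> convex (A \<union> B) \<Longrightarrow>
    \<phi> (A \<union> B) = \<phi> A + \<phi> B - \<phi> (A \<inter> B)"
  using Phi2 by (auto simp: Phi2_def valuation_def compact_convex_sets_def compact_Un)

lemma translate: "compact A \<Longrightarrow> convex A \<Longrightarrow> \<phi> ((+) x ` A) = \<phi> A"
  using Phi2 by (auto simp: Phi2_def translation_invariant_def compact_convex_sets_def)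

lemma mono: "compact A \<Longrightarrow> convex A \<Longrightarrow> compact B \<Longrightarrow> convex B \<Longrightarrow> A \<subseteq> B \<Longrightarrow> \<phi> A \<le> \<phi> B"
  using Phi2 by (auto simp: Phi2_def monotone_functional_def compact_convex_sets_def mono_on_def)

lemma even: "compact A \<Longrightarrow> convex A \<Longrightarrow> \<phi> (uminus ` A) = \<phi> A"
  using Phi2 by (auto simp: Phi2_def even_functional_def compact_convex_sets_def)

lemma nonneg: "compact A \<Longrightarrow> convex A \<Longrightarrow> 0 \<le> \<phi> A"
  using mono[of "{}" A] by simp

definition D :: "real ^ 2 \<Rightarrow> (real ^ 2) set \<Rightarrow> real" where
  "D v A = \<phi> (A + seg v) - \<phi> A"

definition F :: "real ^ 2 \<Rightarrow> real" where
  "F v = \<phi> (seg v)"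

text \<open>\<open>A + (s + t)[-v, v]\<close> is the union of translates of \<open>A + s[-v, v]\<close> and \<open>A + t[-v, v]\<close> that meet in a
  translate of \<open>A\<close>. Hence \<open>\<phi>\<close> is affine along \<open>s \<mapsto> A + s[-v, v]\<close>, with slope \<open>D v A\<close>.\<close>

lemma plus_seg_additive:
  assumes A: "compact A" "convex A" and "0 \<le> s" "0 \<le> t"
  shows "\<phi> (A + seg ((s + t) *\<^sub>R v)) = \<phi> (A + seg (s *\<^sub>R v)) + \<phi> (A + seg (t *\<^sub>R v)) - \<phi> A"
proof -
  \<comment> \<open>The shifts make the coefficients of \<open>v\<close> range over
    \<open>[-t - s, s - t]\<close> in \<open>?S\<close> and over \<open>[s - t, s + t]\<close> in
    \<open>?T\<close>: together they fill \<open>[-(s + t), s + t]\<close> and share only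
    \<open>s - t\<close>.\<close>
  let ?S = "(+) (- t *\<^sub>R v) ` (A + seg (s *\<^sub>R v))" and ?T = "(+) (s *\<^sub>R v) ` (A + seg (t *\<^sub>R v))"
  note mem_S = mem_translate_plus_seg[OF \<open>0 \<le> s\<close>, where r = "- t" and A = A and v = v]
  note mem_T = mem_translate_plus_seg[OF \<open>0 \<le> t\<close>, where r = s and A = A and v = v]
  have st: "0 \<le> s + t" using assms by simp
  have Un: "?S \<union> ?T = A + seg ((s + t) *\<^sub>R v)"
  proof (rule set_eqI)
    fix y
    show "y \<in> ?S \<union> ?T \<longleftrightarrow> y \<in> A + seg ((s + t) *\<^sub>R v)" (is "?l \<longleftrightarrow> ?r")
    proof
      assume ?l
      then consider a \<alpha> where "a \<in> A" "- t - s \<le> \<alpha>" "\<alpha> \<le> - t + s" "y = a + \<alpha> *\<^sub>R v"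
        | a \<alpha> where "a \<in> A" "s - t \<le> \<alpha>" "\<alpha> \<le> s + t" "y = a + \<alpha> *\<^sub>R v"
        unfolding Un_iff mem_S mem_T by blast
      then show ?r
      proof cases
        case 1
        then have "\<bar>\<alpha>\<bar> \<le> s + t" using assms by (simp add: abs_le_iff)
        then show ?thesis using 1 unfolding mem_plus_seg[OF st] by blast
      next
        case 2
        then have "\<bar>\<alpha>\<bar> \<le> s + t" using assms by (simp add: abs_le_iff)
        then show ?thesis using 2 unfolding mem_plus_seg[OF st] by blast
      qed
    next
      assume ?r
      then obtain a \<alpha> where a: "a \<in> A" "\<bar>\<alpha>\<bar> \<le> s + t" "y = a + \<alpha> *\<^sub>R v"
        unfolding mem_plus_seg[OF st] by blast
      show ?l
      proof (cases "\<alpha> \<le> - t + s")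
        case True
        moreover have "- t - s \<le> \<alpha>" using a(2) by linarith
        ultimately show ?thesis using a unfolding Un_iff mem_S by blast
      next
        case False
        then have "s - t \<le> \<alpha>" "\<alpha> \<le> s + t" using a(2) by linarith+
        then show ?thesis using a unfolding Un_iff mem_T by blast
      qed
    qed
  qed
  have Int: "?S \<inter> ?T = (+) ((s - t) *\<^sub>R v) ` A"
  proof (rule set_eqI)
    fix y
    have "y \<in> (+) ((s - t) *\<^sub>R v) ` A"
      if "a \<in> A" "\<alpha> \<le> s - t" "y = a + \<alpha> *\<^sub>R v" "b \<in> A" "s - t \<le> \<beta>" "y = b + \<beta> *\<^sub>R v" for a \<alpha> b \<beta>
    proof -
      have "y - (s - t) *\<^sub>R v \<in> A"
      proof (cases "\<alpha> = \<beta>")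
        case True then show ?thesis using that by simp
      next
        case False
        \<comment> \<open>\<open>y\<close> is reached from \<open>A\<close> with a coefficient on
          either side of \<open>s - t\<close>; \<open>\<mu>\<close> is the position of
          \<open>s - t\<close> between \<open>\<alpha>\<close> and \<open>\<beta>\<close>, so
          convexity of \<open>A\<close> gives the coefficient \<open>s - t\<close> itself.\<close>
        define \<mu> where "\<mu> = (s - t - \<alpha>) / (\<beta> - \<alpha>)"
        have \<mu>: "0 \<le> \<mu>" "\<mu> \<le> 1" using that False by (auto simp: \<mu>_def field_simps)
        have eq: "\<mu> * (\<beta> - \<alpha>) = s - t - \<alpha>" using False by (simp add: \<mu>_def)
        have "a = y - \<alpha> *\<^sub>R v" "b = y - \<beta> *\<^sub>R v" using that by (simp_all add: algebra_simps)
        then have "(1 - \<mu>) *\<^sub>R a + \<mu> *\<^sub>R b = (1 - \<mu>) *\<^sub>R (y - \<alpha> *\<^sub>R v) + \<mu> *\<^sub>R (y - \<beta> *\<^sub>R v)"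
          by simp
        also have "\<dots> = y - (\<alpha> + \<mu> * (\<beta> - \<alpha>)) *\<^sub>R v" by (simp add: algebra_simps)
        also have "\<dots> = y - (s - t) *\<^sub>R v" by (simp add: eq)
        finally show ?thesis using convexD[OF A(2) \<open>a \<in> A\<close> \<open>b \<in> A\<close>, of "1 - \<mu>" \<mu>] \<mu> by simp
      qed
      then show ?thesis by (intro image_eqI[of _ _ "y - (s - t) *\<^sub>R v"]) auto
    qed
    note sub = this
    show "y \<in> ?S \<inter> ?T \<longleftrightarrow> y \<in> (+) ((s - t) *\<^sub>R v) ` A" (is "?l \<longleftrightarrow> ?r")
    proof
      assume ?l
      then obtain a \<alpha> b \<beta> where "a \<in> A" "\<alpha> \<le> - t + s" "y = a + \<alpha> *\<^sub>R v"
        "b \<in> A" "s - t \<le> \<beta>" "y = b + \<beta> *\<^sub>R v"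
        unfolding Int_iff mem_S mem_T by blast
      then show ?r by (intro sub[of a \<alpha> b \<beta>]) auto
    next
      assume ?r
      then have "y - (s - t) *\<^sub>R v \<in> A" by (simp only: mem_translate)
      moreover have "- t - s \<le> s - t" "s - t \<le> - t + s" "s - t \<le> s + t" using assms by auto
      moreover have "y = y - (s - t) *\<^sub>R v + (s - t) *\<^sub>R v" by simp
      ultimately show ?l unfolding Int_iff mem_S mem_T by blast
    qed
  qed
  have "\<phi> (?S \<union> ?T) = \<phi> ?S + \<phi> ?T - \<phi> (?S \<inter> ?T)"
    by (rule union) (use A in \<open>auto simp only: Un intro!: convex_translation convex_set_plus compact_translation
      compact_set_plus convex_seg compact_seg\<close>)
  moreover have "\<phi> ?S = \<phi> (A + seg (s *\<^sub>R v))" "\<phi> ?T = \<phi> (A + seg (t *\<^sub>R v))"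
    using A by (auto simp only: intro!: translate compact_set_plus convex_set_plus compact_seg convex_seg)
  moreover have "\<phi> ((+) ((s - t) *\<^sub>R v) ` A) = \<phi> A" using A by (rule translate)
  ultimately show ?thesis unfolding Un Int by linarith
qed

lemma plus_seg_subset: "A \<subseteq> A + seg v"
  using zero_in_seg[of v] by (force simp: set_plus_def)

lemma D_scale:
  assumes A: "compact A" "convex A" and "0 \<le> s"
  shows "D (s *\<^sub>R v) A = s * D v A"
proof -
  define g where "g s = D (s *\<^sub>R v) A" for s
  have "g s = s * g 1"
  proof (rule additive_nonneg_imp_linear)
    show "g (s + t) = g s + g t" if "0 \<le> s" "0 \<le> t" for s t
      using plus_seg_additive[OF A that] by (simp add: g_def D_def)
    show "0 \<le> g s" for s
      using A mono[OF A _ _ plus_seg_subset] by (simp add: g_def D_def convex_set_plus)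
  qed fact
  then show ?thesis by (simp add: g_def)
qed

lemma F_scale: "F (s *\<^sub>R v) = \<bar>s\<bar> * F v"
proof -
  have *: "F (s *\<^sub>R v) = s * F v" if "0 \<le> s" for s
    using D_scale[of "{0}" s v] that by (simp add: D_def F_def)
  show ?thesis
  proof (cases "0 \<le> s")
    case False
    then have "F (- s *\<^sub>R v) = - s * F v" by (intro *) simp
    then show ?thesis using False by (simp add: F_def)
  qed (simp add: *)
qed

lemma F_nonneg: "0 \<le> F v"
  by (simp add: F_def nonneg)

text \<open>Bounded multiples of \<open>v\<close> do not affect the slope, since it is the growth rate of
  \<open>\<phi> (A + s[-v, v])\<close> as \<open>s \<rightarrow> \<infinity>\<close>. So \<open>D v A\<close> depends only on the projection of \<open>A\<close> along \<open>v\<close>.\<close>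

lemma D_le_if_subset:
  assumes A: "compact A" "convex A" and B: "compact B" "convex B" and "0 \<le> m"
    and sub: "A \<subseteq> (+) x ` (B + seg (m *\<^sub>R v))"
  shows "D v A \<le> D v B"
proof (rule ccontr)
  assume "\<not> D v A \<le> D v B"
  then have pos: "0 < D v A - D v B" by simp
  \<comment> \<open>Compare \<open>A + s[-v, v]\<close> with a translate of
    \<open>B + (m + s)[-v, v]\<close>: both values are affine in \<open>s\<close>, so a larger slope
    on the left would eventually violate monotonicity.\<close>
  have le: "s * (D v A - D v B) \<le> \<phi> B + m * D v B - \<phi> A" if s: "0 \<le> s" for s
  proof -
    have "A + seg (s *\<^sub>R v) \<subseteq> (+) x ` (B + seg ((m + s) *\<^sub>R v))"
    proof
      fix y assume "y \<in> A + seg (s *\<^sub>R v)"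
      then obtain a \<alpha> where a: "a \<in> A" "\<bar>\<alpha>\<bar> \<le> s" "y = a + \<alpha> *\<^sub>R v"
        unfolding mem_plus_seg[OF s] by blast
      then obtain z where z: "z \<in> B + seg (m *\<^sub>R v)" "a = x + z" using sub by blast
      from z(1) obtain b \<beta> where b: "b \<in> B" "\<bar>\<beta>\<bar> \<le> m" "a = x + (b + \<beta> *\<^sub>R v)"
        unfolding mem_plus_seg[OF \<open>0 \<le> m\<close>] z(2) by blast
      have "b + (\<beta> + \<alpha>) *\<^sub>R v \<in> B + seg ((m + s) *\<^sub>R v)"
        using a b s \<open>0 \<le> m\<close> by (subst mem_plus_seg) (auto intro!: bexI[of _ b] exI[of _ "\<beta> + \<alpha>"])
      then show "y \<in> (+) x ` (B + seg ((m + s) *\<^sub>R v))"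
        using a b by (intro image_eqI[of _ _ "b + (\<beta> + \<alpha>) *\<^sub>R v"]) (auto simp: algebra_simps)
    qed
    then have "\<phi> (A + seg (s *\<^sub>R v)) \<le> \<phi> ((+) x ` (B + seg ((m + s) *\<^sub>R v)))"
      using A B by (intro mono) (auto simp: convex_set_plus convex_translation compact_translation)
    then have "\<phi> A + D (s *\<^sub>R v) A \<le> \<phi> B + D ((m + s) *\<^sub>R v) B"
      using B by (simp add: translate convex_set_plus D_def)
    moreover have "D ((m + s) *\<^sub>R v) B = (m + s) * D v B" by (rule D_scale[OF B]) (use s \<open>0 \<le> m\<close> in simp)
    ultimately show ?thesis using D_scale[OF A s, of v] by (simp add: algebra_simps)
  qed
  obtain n where "\<phi> B + m * D v B - \<phi> A < real n * (D v A - D v B)"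
    using reals_Archimedean3[OF pos] by blast
  with le[of "real n"] show False by simp
qed

text \<open>Points of equal transverse coordinate differ by a multiple of \<open>v\<close>, which is
  bounded on bounded sets; so the inclusion required by \<open>D_le_if_subset\<close> holds after a
  transverse shift by \<open>k\<close>.\<close>

lemma D_le_if_wedge_range:
  assumes A: "compact A" "convex A" and B: "compact B" "convex B" and v: "v \<noteq> 0"
    and range: "\<And>a. a \<in> A \<Longrightarrow> \<exists>b\<in>B. wedge a v = wedge b v + k"
  shows "D v A \<le> D v B"
proof -
  define x where "x = (- k / (v \<bullet> v)) *\<^sub>R perp v"
  have x: "wedge x v = k"
    using v wedge_perp_left[of v] by (simp add: x_def)
  obtain M1 M2 where M: "\<And>a. a \<in> A \<Longrightarrow> norm a \<le> M1" "\<And>b. b \<in> B \<Longrightarrow> norm b \<le> M2"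
    using A B by (metis bounded_iff compact_imp_bounded)
  define m where "m = \<bar>(M1 + M2 + norm x) / norm v\<bar>"
  have "A \<subseteq> (+) x ` (B + seg (m *\<^sub>R v))"
  proof
    fix a assume a: "a \<in> A"
    then obtain b where b: "b \<in> B" "wedge a v = wedge b v + k" using range by blast
    then have "wedge (a - b - x) v = 0" by (simp add: x)
    then obtain t where t: "a - b - x = t *\<^sub>R v" using wedge_eq_0_iff[OF v] by blast
    have "\<bar>t\<bar> * norm v = norm (a - b - x)" by (simp add: t)
    also have "\<dots> \<le> norm a + norm b + norm x"
      by (smt (verit) norm_triangle_ineq4)
    also have "\<dots> \<le> M1 + M2 + norm x" using M a b by (simp add: add_mono)
    finally have "\<bar>t\<bar> \<le> (M1 + M2 + norm x) / norm v" using v by (simp add: field_simps)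
    then have "\<bar>t\<bar> \<le> m" unfolding m_def by linarith
    moreover have "a = x + (b + t *\<^sub>R v)" using t by (simp add: algebra_simps)
    ultimately show "a \<in> (+) x ` (B + seg (m *\<^sub>R v))"
      using b by (intro image_eqI[of _ _ "b + t *\<^sub>R v"]) (auto simp: mem_plus_seg m_def)
  qed
  then show ?thesis by (intro D_le_if_subset[OF A B]) (auto simp: m_def)
qed

end

lemma width_range:
  assumes A: "compact A" "convex A" "A \<noteq> {}"
  shows "(\<lambda>a. wedge a v) ` A = {(INF a\<in>A. wedge a v)..(SUP a\<in>A. wedge a v)}"
proof -
  have c: "compact ((\<lambda>a. wedge a v) ` A)"
    using A by (intro compact_continuous_image continuous_intros) auto
  have "connected ((\<lambda>a. wedge a v) ` A)"
    using A by (intro connected_continuous_image continuous_intros convex_connected) auto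
  then show ?thesis
    using connected_compact_interval_1[of "(\<lambda>a. wedge a v) ` A"] c A
    by (metis (no_types, lifting) cInf_atLeastAtMost cSup_atLeastAtMost atLeastatMost_empty_iff2
        image_is_empty linorder_not_less)
qed

lemma width_nonneg:
  assumes A: "compact A" "convex A" "A \<noteq> {}"
  shows "0 \<le> width A v"
  using width_range[OF A, of v] A(3) unfolding width_def
  by (metis atLeastatMost_empty_iff2 diff_ge_0_iff_ge image_is_empty)

lemma width_seg: "width (seg y) v = 2 * \<bar>wedge y v\<bar>"
proof -
  have "(\<lambda>a. wedge a v) ` seg y = {- \<bar>wedge y v\<bar>..\<bar>wedge y v\<bar>}"
  proof (rule set_eqI, rule iffI)
    fix t assume "t \<in> (\<lambda>a. wedge a v) ` seg y"
    then obtain a where "\<bar>a\<bar> \<le> 1" "t = a * wedge y v" by (auto simp: mem_seg)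
    then have "\<bar>t\<bar> \<le> \<bar>wedge y v\<bar>" by (simp add: abs_mult mult_left_le_one_le)
    then show "t \<in> {- \<bar>wedge y v\<bar>..\<bar>wedge y v\<bar>}" by (auto simp: abs_le_iff)
  next
    fix t assume t: "t \<in> {- \<bar>wedge y v\<bar>..\<bar>wedge y v\<bar>}"
    show "t \<in> (\<lambda>a. wedge a v) ` seg y"
    proof (cases "wedge y v = 0")
      case True then show ?thesis using t by (auto intro!: image_eqI[of _ _ 0])
    next
      case False
      then have "\<bar>t / wedge y v\<bar> \<le> 1" using t by (auto simp: abs_divide)
      then have "(t / wedge y v) *\<^sub>R y \<in> seg y" unfolding mem_seg by blast
      then show ?thesis using False by (intro image_eqI[of _ _ "(t / wedge y v) *\<^sub>R y"]) auto
    qed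
  qed
  then show ?thesis
    unfolding width_def using width_range[of "seg y" v] by (simp add: cInf_atLeastAtMost cSup_atLeastAtMost)
qed

section \<open>The formula for adding a segment\<close>

context Phi2_functional
begin

text \<open>The mixed second difference of \<open>\<phi>\<close> on the standard square. By
  \<open>D_seg\<close> every other pair of independent vectors gives the same constant after
  division by the absolute determinant.\<close>

definition coef :: real where
  "coef = D (axis 2 1) (seg (axis 1 1)) - F (axis 2 1)"

lemma D_eq_if_width_eq:
  assumes A: "compact A" "convex A" "A \<noteq> {}" and B: "compact B" "convex B" "B \<noteq> {}"
    and "v \<noteq> 0" and w: "width A v = width B v"
  shows "D v A = D v B"
proof -
  have "D v A \<le> D v B"
    if A: "compact A" "convex A" "A \<noteq> {}" and B: "compact B" "convex B" "B \<noteq> {}"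
    and w: "width A v = width B v" for A B
  proof (rule D_le_if_wedge_range[where k = "(INF a\<in>A. wedge a v) - (INF b\<in>B. wedge b v)"])
    fix a assume "a \<in> A"
    then have "wedge a v \<in> {(INF a\<in>A. wedge a v)..(SUP a\<in>A. wedge a v)}"
      using width_range[OF A, of v] by blast
    then have "wedge a v - ((INF a\<in>A. wedge a v) - (INF b\<in>B. wedge b v)) \<in>
        {(INF b\<in>B. wedge b v)..(SUP b\<in>B. wedge b v)}"
      using w unfolding width_def atLeastAtMost_iff by linarith
    then have "wedge a v - ((INF a\<in>A. wedge a v) - (INF b\<in>B. wedge b v)) \<in> (\<lambda>b. wedge b v) ` B"
      unfolding width_range[OF B, symmetric] .
    then obtain b where "b \<in> B" "wedge a v - ((INF a\<in>A. wedge a v) - (INF b\<in>B. wedge b v)) = wedge b v"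
      by (rule imageE)
    then show "\<exists>b\<in>B. wedge a v = wedge b v + ((INF a\<in>A. wedge a v) - (INF b\<in>B. wedge b v))"
      by (intro bexI[of _ b]) linarith
  qed fact+
  from this[OF A B w] this[OF B A w[symmetric]] show ?thesis by simp
qed

text \<open>The mixed term \<open>b y v\<close> is symmetric, homogeneous in each vector, and
  depends on \<open>y\<close> only through \<open>\<bar>wedge y v\<bar>\<close>. So it is
  \<open>\<bar>wedge y v\<bar> * B v\<close>, and symmetry makes \<open>B\<close> agree on
  independent vectors; parallel vectors are linked through a third one.\<close>

lemma D_seg: "D v (seg y) = F v + coef * \<bar>wedge y v\<bar>"
proof -
  define b where "b y v = D v (seg y) - F v" for y v
  have sym: "b y v = b v y" for y v
    by (simp add: b_def D_def F_def add.commute)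
  have scale: "b y (s *\<^sub>R v) = s * b y v" if "0 \<le> s" for s y v
    using that by (simp add: b_def D_scale F_scale algebra_simps)
  have scale': "b (s *\<^sub>R y) v = s * b y v" if "0 \<le> s" for s y v
    using scale[OF that] sym by metis
  have width: "b y v = b z v" if "\<bar>wedge y v\<bar> = \<bar>wedge z v\<bar>" "v \<noteq> 0" for y z v
    unfolding b_def using that by (subst D_eq_if_width_eq[of "seg y" "seg z"]) (auto simp: width_seg)
  define B where "B v = b (perp v) v / (v \<bullet> v)" for v
  have abs_perp: "\<bar>wedge (perp v) v\<bar> = v \<bullet> v" for v
    by (simp add: wedge_perp_left)
  have bB: "b y v = \<bar>wedge y v\<bar> * B v" if "v \<noteq> 0" for y v
  proof -
    have "b y v = b ((\<bar>wedge y v\<bar> / (v \<bullet> v)) *\<^sub>R perp v) v"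
      using that abs_perp[of v] by (intro width) (auto simp: abs_mult)
    then show ?thesis by (simp add: scale' B_def)
  qed
  have B_indep: "B v = B y" if "wedge y v \<noteq> 0" for y v
  proof -
    have "v \<noteq> 0" "y \<noteq> 0" using that by auto
    then show ?thesis using bB[of v y] bB[of y v] sym[of y v] that wedge_commute[of y v] by simp
  qed
  define e1 e2 :: "real ^ 2" where "e1 = axis 1 1" and "e2 = axis 2 1"
  have e: "wedge e1 e2 = 1" by (simp add: e1_def e2_def wedge_def axis_def)
  then have "e2 \<noteq> 0" by auto
  then have "coef = B e2" using bB[of e2 e1] e by (simp add: b_def coef_def flip: e1_def e2_def)
  have "B v = coef" if "v \<noteq> 0" for v
  proof (cases "wedge v e2 = 0")
    case False then show ?thesis using B_indep[of v e2] \<open>coef = B e2\<close> by simp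
  next
    case True
    then obtain t where t: "v = t *\<^sub>R e2" using wedge_eq_0_iff[OF \<open>e2 \<noteq> 0\<close>] by blast
    then have "wedge e1 v \<noteq> 0" using e that by auto
    then have "B v = B e1" by (rule B_indep)
    also have "\<dots> = B e2" using B_indep[of e1 e2] e by simp
    finally show ?thesis using \<open>coef = B e2\<close> by simp
  qed
  then have "b y v = coef * \<bar>wedge y v\<bar>" if "v \<noteq> 0" using bB[OF that] that by simp
  moreover have "D 0 (seg y) = 0" "F 0 = 0" by (simp_all add: D_def F_def)
  ultimately show ?thesis by (cases "v = 0") (auto simp: b_def)
qed

text \<open>The increment depends on \<open>A\<close> only through its width, so \<open>A\<close>
  may be replaced by a segment perpendicular to \<open>v\<close> of the same width.\<close>

theorem plus_seg:
  assumes A: "compact A" "convex A" "A \<noteq> {}"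
  shows "\<phi> (A + seg v) = \<phi> A + F v + coef * (width A v / 2)"
proof (cases "v = 0")
  case True
  then show ?thesis using A by (simp add: F_def width_def)
next
  case False
  define y where "y = (width A v / 2 / (v \<bullet> v)) *\<^sub>R perp v"
  have "\<bar>wedge y v\<bar> = width A v / 2"
    using False wedge_perp_left[of v] width_nonneg[OF A]
    by (simp add: y_def abs_mult)
  moreover from this have "D v A = D v (seg y)"
    using False A by (intro D_eq_if_width_eq) (auto simp: width_seg)
  ultimately have "D v A = F v + coef * (width A v / 2)" by (simp add: D_seg)
  then show ?thesis unfolding D_def by linarith
qed

end

section \<open>Zonogons\<close>

primrec zono :: "(real ^ 2) list \<Rightarrow> (real ^ 2) set" where
  "zono [] = {0}"
| "zono (v # vs) = zono vs + seg v"

text \<open>Half the width of a zonogon along \<open>v\<close> is the sum of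
  \<open>\<bar>wedge w v\<bar>\<close> over its generators \<open>w\<close>. So this adds the
  absolute determinants of all pairs of generators, a quarter of the area of the zonogon, whatever
  the functional.\<close>

primrec mixed :: "(real ^ 2) list \<Rightarrow> real" where
  "mixed [] = 0"
| "mixed (v # vs) = mixed vs + width (zono vs) v / 2"

lemma compact_zono [simp]: "compact (zono vs)" and convex_zono [simp]: "convex (zono vs)"
  and zono_nonempty [simp]: "zono vs \<noteq> {}"
  by (induction vs) (auto simp: convex_set_plus)

lemma zono_append: "zono (vs @ ws) = zono vs + zono ws"
  by (induction vs) (auto simp: algebra_simps)

lemma scaleR_image_set_plus: "(*\<^sub>R) r ` (A + B) = (*\<^sub>R) r ` A + (*\<^sub>R) r ` B"
  for A B :: "'a::real_vector set"
  unfolding set_plus_image image_image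
  by (auto simp: image_iff scaleR_add_right split: prod.splits) (metis scaleR_add_right)+

lemma seg_scaleR: "seg (r *\<^sub>R v) = (*\<^sub>R) r ` seg v"
  unfolding seg_def image_image by (simp add: mult.commute)

lemma zono_scaleR: "zono (map ((*\<^sub>R) r) vs) = (*\<^sub>R) r ` zono vs"
  by (induction vs) (auto simp: scaleR_image_set_plus seg_scaleR)

lemma width_scaleR:
  assumes A: "compact A" "convex A" "A \<noteq> {}" and r: "0 \<le> r"
  shows "width ((*\<^sub>R) r ` A) (r *\<^sub>R v) = r\<^sup>2 * width A v"
proof -
  define l u where "l = (INF a\<in>A. wedge a v)" and "u = (SUP a\<in>A. wedge a v)"
  have range: "(\<lambda>a. wedge a v) ` A = {l..u}" unfolding l_def u_def by (rule width_range[OF A])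
  have "l \<le> u" using range A(3) by (metis atLeastatMost_empty_iff2 image_is_empty)
  have "(\<lambda>a. wedge a (r *\<^sub>R v)) ` (*\<^sub>R) r ` A = (\<lambda>t. r\<^sup>2 * t) ` (\<lambda>a. wedge a v) ` A"
    unfolding image_image by (simp add: power2_eq_square mult.assoc)
  also have "\<dots> = {r\<^sup>2 * l..r\<^sup>2 * u}"
    unfolding range using r \<open>l \<le> u\<close> by (cases "r = 0") (auto simp: image_mult_atLeastAtMost_if)
  finally have eq: "(\<lambda>a. wedge a (r *\<^sub>R v)) ` (*\<^sub>R) r ` A = {r\<^sup>2 * l..r\<^sup>2 * u}" .
  have "r\<^sup>2 * l \<le> r\<^sup>2 * u" using \<open>l \<le> u\<close> by (simp add: mult_left_mono)
  then show ?thesis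
    unfolding width_def eq range using \<open>l \<le> u\<close> by (simp add: algebra_simps)
qed

lemma mixed_scaleR: "0 \<le> r \<Longrightarrow> mixed (map ((*\<^sub>R) r) vs) = r\<^sup>2 * mixed vs"
  by (induction vs) (simp_all add: zono_scaleR width_scaleR algebra_simps)

text \<open>Multiplicative approximation from outside, instead of Hausdorff distance: monotonicity
  and the scaling of \<open>\<phi>\<close> on zonogons then suffice to pass to the limit.\<close>

definition zonoid :: "(real ^ 2) set \<Rightarrow> bool" where
  "zonoid L \<longleftrightarrow> (\<forall>\<epsilon>>0. \<exists>vs. L \<subseteq> zono vs \<and> zono vs \<subseteq> (*\<^sub>R) (1 + \<epsilon>) ` L)"

lemma zonoid_seg: "zonoid (seg v)"
proof -
  have "seg v \<subseteq> (*\<^sub>R) (1 + \<epsilon>) ` seg v" if "0 < \<epsilon>" for \<epsilon>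
  proof
    fix y assume "y \<in> seg v"
    then obtain a where a: "\<bar>a\<bar> \<le> 1" "y = a *\<^sub>R v" by (auto simp: mem_seg)
    have "\<bar>a / (1 + \<epsilon>)\<bar> \<le> 1" using a that by (auto simp: abs_divide)
    then have "(a / (1 + \<epsilon>)) *\<^sub>R v \<in> seg v" unfolding mem_seg by blast
    moreover have "y = (1 + \<epsilon>) *\<^sub>R (a / (1 + \<epsilon>)) *\<^sub>R v" using a that by simp
    ultimately show "y \<in> (*\<^sub>R) (1 + \<epsilon>) ` seg v" by blast
  qed
  then show ?thesis unfolding zonoid_def by (intro allI impI exI[of _ "[v]"]) simp
qed

context Phi2_functional
begin

lemma zono: "\<phi> (zono vs) = sum_list (map F vs) + coef * mixed vs"
proof (induction vs)
  case (Cons v vs)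
  then show ?case using plus_seg[of "zono vs" v] by (simp add: algebra_simps)
qed simp

text \<open>On zonogons \<open>\<phi>\<close> is a nonnegative part of degree one plus a part of
  degree two, and \<open>r \<le> r\<^sup>2\<close>.\<close>

lemma zono_scaleR_le:
  assumes "1 \<le> r"
  shows "\<phi> ((*\<^sub>R) r ` zono vs) \<le> r\<^sup>2 * \<phi> (zono vs)"
proof -
  have sum: "sum_list (map F (map ((*\<^sub>R) r) vs)) = r * sum_list (map F vs)"
    using assms by (induction vs) (simp_all add: F_scale algebra_simps)
  have "0 \<le> sum_list (map F vs)" by (intro sum_list_nonneg) (auto simp: F_nonneg)
  moreover have "r \<le> r\<^sup>2" using assms by (simp add: power2_eq_square)
  ultimately have "r * sum_list (map F vs) \<le> r\<^sup>2 * sum_list (map F vs)" by (rule mult_right_mono[rotated])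
  moreover have "\<phi> ((*\<^sub>R) r ` zono vs) = r * sum_list (map F vs) + coef * (r\<^sup>2 * mixed vs)"
    using zono[of "map ((*\<^sub>R) r) vs"] assms sum by (simp add: zono_scaleR mixed_scaleR)
  ultimately show ?thesis by (simp add: zono algebra_simps)
qed

lemma zono_sandwich:
  assumes L: "compact L" "convex L" and "0 < \<epsilon>" and sub: "zono vs \<subseteq> (*\<^sub>R) (1 + \<epsilon>) ` L"
  shows "\<phi> (zono vs) \<le> (1 + \<epsilon>)\<^sup>2 * \<phi> L"
proof -
  let ?r = "1 + \<epsilon>"
  define ws where "ws = map ((*\<^sub>R) (1 / ?r)) vs"
  have eq: "(*\<^sub>R) ?r ` zono ws = zono vs"
    using \<open>0 < \<epsilon>\<close> by (simp add: ws_def zono_scaleR image_image)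
  have "zono ws \<subseteq> L"
  proof
    fix y assume "y \<in> zono ws"
    then have "?r *\<^sub>R y \<in> (*\<^sub>R) ?r ` L" using eq sub by blast
    then show "y \<in> L" using \<open>0 < \<epsilon>\<close> by auto
  qed
  then have "\<phi> (zono ws) \<le> \<phi> L" using L by (intro mono) auto
  have "\<phi> (zono vs) \<le> ?r\<^sup>2 * \<phi> (zono ws)"
    using zono_scaleR_le[of ?r ws] \<open>0 < \<epsilon>\<close> eq by simp
  also have "\<dots> \<le> ?r\<^sup>2 * \<phi> L" using \<open>\<phi> (zono ws) \<le> \<phi> L\<close> by (intro mult_left_mono) auto
  finally show ?thesis .
qed

lemma zono_tendsto:
  assumes L: "compact L" "convex L"
    and "\<And>n. L \<subseteq> zono (vs n)" "\<And>n. zono (vs n) \<subseteq> (*\<^sub>R) (1 + 1 / real (Suc n)) ` L"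
  shows "(\<lambda>n. \<phi> (zono (vs n))) \<longlonglongrightarrow> \<phi> L"
proof (rule tendsto_sandwich)
  show "\<forall>\<^sub>F n in sequentially. \<phi> L \<le> \<phi> (zono (vs n))"
    using assms by (intro always_eventually allI mono) auto
  show "\<forall>\<^sub>F n in sequentially. \<phi> (zono (vs n)) \<le> (1 + 1 / real (Suc n))\<^sup>2 * \<phi> L"
    using assms by (intro always_eventually allI zono_sandwich) auto
  have "(\<lambda>n. (1 + 1 / real (Suc n))\<^sup>2 * \<phi> L) \<longlonglongrightarrow> (1 + 0)\<^sup>2 * \<phi> L"
    by (intro tendsto_intros LIMSEQ_Suc[OF lim_1_over_n])
  then show "(\<lambda>n. (1 + 1 / real (Suc n))\<^sup>2 * \<phi> L) \<longlonglongrightarrow> \<phi> L" by simp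
qed (rule tendsto_const)

end

section \<open>Minkowski means and their defect\<close>

definition mean :: "(real ^ 2) set \<Rightarrow> (real ^ 2) set \<Rightarrow> (real ^ 2) set" where
  "mean A B = (*\<^sub>R) (1 / 2) ` (A + B)"

lemma compact_mean: "compact A \<Longrightarrow> compact B \<Longrightarrow> compact (mean A B)"
  and convex_mean: "convex A \<Longrightarrow> convex B \<Longrightarrow> convex (mean A B)"
  by (simp_all add: mean_def compact_scaling convex_scaling convex_set_plus)

text \<open>The one-homogeneous parts of both functionals are Minkowski additive and drop out; what remains
  on zonogons is the coefficient times a quantity that does not depend on the functional.\<close>

lemma mean_defect_proportional:
  assumes "Phi2_functional \<phi>" "Phi2_functional \<psi>"
    and L: "compact L" "convex L" "zonoid L" and M: "compact M" "convex M" "zonoid M"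
  shows "Phi2_functional.coef \<psi> * (\<phi> (mean L M) - (\<phi> L + \<phi> M) / 2) =
    Phi2_functional.coef \<phi> * (\<psi> (mean L M) - (\<psi> L + \<psi> M) / 2)"
proof -
  interpret \<phi>: Phi2_functional \<phi> by fact
  interpret \<psi>: Phi2_functional \<psi> by fact
  have "\<exists>vs. L \<subseteq> zono vs \<and> zono vs \<subseteq> (*\<^sub>R) (1 + 1 / real (Suc n)) ` L" for n
    using L(3) by (simp add: zonoid_def)
  then obtain vs where vs: "\<And>n. L \<subseteq> zono (vs n)" "\<And>n. zono (vs n) \<subseteq> (*\<^sub>R) (1 + 1 / real (Suc n)) ` L"
    by metis
  have "\<exists>vs. M \<subseteq> zono vs \<and> zono vs \<subseteq> (*\<^sub>R) (1 + 1 / real (Suc n)) ` M" for n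
    using M(3) by (simp add: zonoid_def)
  then obtain ws where ws: "\<And>n. M \<subseteq> zono (ws n)" "\<And>n. zono (ws n) \<subseteq> (*\<^sub>R) (1 + 1 / real (Suc n)) ` M"
    by metis
  define us where "us n = map ((*\<^sub>R) (1 / 2)) (vs n @ ws n)" for n
  have us_eq: "zono (us n) = mean (zono (vs n)) (zono (ws n))" for n
    by (simp add: us_def mean_def zono_scaleR zono_append flip: map_append)
  have us1: "mean L M \<subseteq> zono (us n)" for n
    unfolding us_eq mean_def by (intro image_mono set_plus_mono2 vs ws)
  have us2: "zono (us n) \<subseteq> (*\<^sub>R) (1 + 1 / real (Suc n)) ` mean L M" for n
  proof -
    have "zono (us n) \<subseteq> mean ((*\<^sub>R) (1 + 1 / real (Suc n)) ` L) ((*\<^sub>R) (1 + 1 / real (Suc n)) ` M)"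
      unfolding us_eq mean_def by (intro image_mono set_plus_mono2 vs ws)
    also have "\<dots> = (*\<^sub>R) (1 + 1 / real (Suc n)) ` mean L M"
      by (simp add: mean_def scaleR_image_set_plus image_image mult.commute)
    finally show ?thesis .
  qed
  define E where "E n = mixed (us n) - (mixed (vs n) + mixed (ws n)) / 2" for n
  have *: "\<theta> (zono (us n)) - (\<theta> (zono (vs n)) + \<theta> (zono (ws n))) / 2 = Phi2_functional.coef \<theta> * E n"
    if "Phi2_functional \<theta>" for \<theta> n
  proof -
    interpret \<theta>: Phi2_functional \<theta> by fact
    have "sum_list (map \<theta>.F (map ((*\<^sub>R) (1 / 2)) xs)) = sum_list (map \<theta>.F xs) / 2" for xs
      by (induction xs) (simp_all add: \<theta>.F_scale)
    then show ?thesis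
      by (simp add: \<theta>.zono us_def E_def field_simps del: map_map map_append) (simp add: algebra_simps)
  qed
  note mean = compact_mean[OF L(1) M(1)] convex_mean[OF L(2) M(2)]
  have lim1: "(\<lambda>n. \<psi>.coef * (\<phi> (zono (us n)) - (\<phi> (zono (vs n)) + \<phi> (zono (ws n))) / 2))
      \<longlonglongrightarrow> \<psi>.coef * (\<phi> (mean L M) - (\<phi> L + \<phi> M) / 2)"
    by (intro tendsto_intros \<phi>.zono_tendsto mean L M us1 us2 vs ws) simp
  have lim2: "(\<lambda>n. \<phi>.coef * (\<psi> (zono (us n)) - (\<psi> (zono (vs n)) + \<psi> (zono (ws n))) / 2))
      \<longlonglongrightarrow> \<phi>.coef * (\<psi> (mean L M) - (\<psi> L + \<psi> M) / 2)"
    by (intro tendsto_intros \<psi>.zono_tendsto mean L M us1 us2 vs ws) simp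
  have "(\<lambda>n. \<psi>.coef * (\<phi> (zono (us n)) - (\<phi> (zono (vs n)) + \<phi> (zono (ws n))) / 2)) =
      (\<lambda>n. \<phi>.coef * (\<psi> (zono (us n)) - (\<psi> (zono (vs n)) + \<psi> (zono (ws n))) / 2))"
    by (simp add: * assms mult.left_commute)
  from LIMSEQ_unique[OF lim1[unfolded this] lim2] show ?thesis .
qed

section \<open>Approximation of symmetric bodies by zonogons\<close>

text \<open>Applied to the restriction \<open>k\<close> of a support function to the line \<open>{(1, s)}\<close>. Evenness of the support
  function makes the outer slopes of the piecewise linear interpolant opposite, so that it has no linear
  term and is the support function of a zonogon.\<close>

lemma convex_interpolation:
  fixes k :: "real \<Rightarrow> real"
  assumes conv: "convex_on UNIV k" and lip: "\<And>s t. k s \<le> k t + m * \<bar>s - t\<bar>"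
    and even: "\<And>s t. m * \<bar>s - t\<bar> \<le> k s + k t" and \<delta>: "0 < \<delta>"
  obtains C and d :: "nat \<Rightarrow> real" and a :: "nat \<Rightarrow> real" and n where
    "0 \<le> C" "\<And>i. i \<le> n \<Longrightarrow> 0 \<le> d i" "(\<Sum>i\<le>n. d i) = m"
    "\<And>s. k s \<le> C + (\<Sum>i\<le>n. d i * \<bar>s - a i\<bar>)"
    "\<And>s. \<bar>s\<bar> \<le> T \<Longrightarrow> C + (\<Sum>i\<le>n. d i * \<bar>s - a i\<bar>) \<le> k s + 2 * m * \<delta>"
    "\<And>s. T < \<bar>s\<bar> \<Longrightarrow> C + (\<Sum>i\<le>n. d i * \<bar>s - a i\<bar>) \<le> max (k s + 2 * m * \<delta>) (k 0 + m * \<bar>s\<bar>)"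
proof -
  have m: "0 \<le> m" using lip[of 0 1] lip[of 1 0] by simp
  define N where "N = Suc (nat \<lceil>T / \<delta>\<rceil>)"
  have "T / \<delta> \<le> real N" unfolding N_def by linarith
  then have N: "T \<le> real N * \<delta>" using \<delta> by (simp add: field_simps)
  define n where "n = 2 * N"
  \<comment> \<open>Equally spaced nodes, symmetric about \<open>0\<close>, from
    \<open>- N * \<delta>\<close> to \<open>N * \<delta>\<close>, which cover
    \<open>[-T, T]\<close>.\<close>
  define a where "a i = (real i - real N) * \<delta>" for i :: nat
  have a_step: "a (Suc i) = a i + \<delta>" for i by (simp add: a_def algebra_simps)
  have a_mono: "a i \<le> a j" if "i \<le> j" for i j using that \<delta> by (simp add: a_def)
  have a0: "a 0 = - (real N * \<delta>)" and an: "a n = real N * \<delta>" by (simp_all add: a_def n_def)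
  \<comment> \<open>The slope of the interpolant to the left of node \<open>i\<close>, with index
    \<open>n + 1\<close> standing for the piece beyond the last node; the two unbounded pieces get
    \<open>- m\<close> and \<open>m\<close>, the extreme slopes permitted by the Lipschitz
    bound.\<close>
  define \<sigma> where "\<sigma> i = (if i = 0 then - m else if i \<le> n then (k (a i) - k (a (i - 1))) / \<delta> else m)" for i
  define e where "e i = \<sigma> (Suc i) - \<sigma> i" for i
  define G where "G j s = k (a 0) - m * (s - a 0) + (\<Sum>i<j. e i * max 0 (s - a i))" for j s
  have abs_\<sigma>: "\<bar>\<sigma> i\<bar> \<le> m" for i
  proof (cases "i = 0 \<or> n < i")
    case False
    then have "a i = a (i - 1) + \<delta>" using a_step[of "i - 1"] by simp
    then have "\<bar>k (a i) - k (a (i - 1))\<bar> \<le> m * \<delta>"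
      using lip[of "a i" "a (i - 1)"] lip[of "a (i - 1)" "a i"] \<delta> by (simp add: abs_le_iff)
    then have "\<bar>k (a i) - k (a (i - 1))\<bar> / \<delta> \<le> m" using \<delta> by (simp add: field_simps)
    then show ?thesis using False \<delta> by (simp add: \<sigma>_def abs_divide)
  qed (use m in \<open>auto simp: \<sigma>_def\<close>)
  have e_nonneg: "0 \<le> e i" if "i \<le> n" for i
  proof (cases "i = 0 \<or> i = n")
    case True
    then show ?thesis using abs_\<sigma>[of "Suc 0"] abs_\<sigma>[of n] by (auto simp: e_def \<sigma>_def abs_le_iff)
  next
    case False
    then have i: "0 < i" "i < n" using that by auto
    define x where "x = a (i - 1)"
    have x: "a i = x + \<delta>" "a (Suc i) = x + 2 * \<delta>" using a_step[of "i - 1"] a_step[of i] i by (simp_all add: x_def)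
    have "k ((1 - 1/2) *\<^sub>R x + (1/2) *\<^sub>R (x + 2 * \<delta>)) \<le> (1 - 1/2) * k x + (1/2) * k (x + 2 * \<delta>)"
      by (rule convex_onD[OF conv]) auto
    moreover have "(1 - 1/2) *\<^sub>R x + (1/2) *\<^sub>R (x + 2 * \<delta>) = x + \<delta>" by (simp add: field_simps)
    ultimately have "2 * k (x + \<delta>) \<le> k x + k (x + 2 * \<delta>)" by simp
    then have "(k (x + \<delta>) - k x) / \<delta> \<le> (k (x + 2 * \<delta>) - k (x + \<delta>)) / \<delta>"
      using \<delta> by (intro divide_right_mono) auto
    moreover have "\<sigma> i = (k (x + \<delta>) - k x) / \<delta>" "\<sigma> (Suc i) = (k (x + 2 * \<delta>) - k (x + \<delta>)) / \<delta>"
      using i unfolding \<sigma>_def by (simp_all add: x x_def[symmetric] del: One_nat_def)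
    ultimately show ?thesis by (simp add: e_def)
  qed
  have G: "G j s = k (a j) + \<sigma> j * (s - a j)" if "j \<le> n" "a j \<le> s" for j s
    using that
  proof (induction j)
    case 0 then show ?case by (simp add: G_def \<sigma>_def)
  next
    case (Suc j)
    have "a j \<le> s" using Suc.prems a_mono[of j "Suc j"] by simp
    then have "G (Suc j) s = k (a j) + \<sigma> j * (s - a j) + e j * (s - a j)"
      using Suc by (simp add: G_def)
    also have "\<dots> = k (a j) + \<sigma> (Suc j) * \<delta> + \<sigma> (Suc j) * (s - a (Suc j))"
      by (simp add: e_def a_step algebra_simps)
    also have "\<sigma> (Suc j) * \<delta> = k (a (Suc j)) - k (a j)"
      using Suc.prems \<delta> by (simp add: \<sigma>_def)
    finally show ?case by simp
  qed
  have G_Suc: "G (Suc j) s = k (a j) + \<sigma> (Suc j) * (s - a j)" if "j \<le> n" "a j \<le> s" for j s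
    using G[OF that] that by (simp add: G_def e_def algebra_simps)
  have G_last: "G (Suc n) s = G j s" if "j \<le> Suc n" "s \<le> a j" for j s
  proof -
    have "(\<Sum>i<Suc n. e i * max 0 (s - a i)) = (\<Sum>i<j. e i * max 0 (s - a i))"
    proof (rule sum.mono_neutral_right)
      show "\<forall>i\<in>{..<Suc n} - {..<j}. e i * max 0 (s - a i) = 0"
      proof
        fix i assume "i \<in> {..<Suc n} - {..<j}"
        then have "a j \<le> a i" by (intro a_mono) auto
        then show "e i * max 0 (s - a i) = 0" using that by simp
      qed
    qed (use that in auto)
    then show ?thesis by (simp add: G_def)
  qed
  have left: "G (Suc n) s = k (a 0) + m * (a 0 - s)" if "s \<le> a 0" for s
    using G_last[of 0 s] that by (simp add: G_def algebra_simps)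
  have right: "G (Suc n) s = k (a n) + m * (s - a n)" if "a n \<le> s" for s
    using G_Suc[of n s] that by (simp add: \<sigma>_def)
  have middle: "\<exists>j<n. a j \<le> s \<and> s \<le> a (Suc j)" if "a 0 < s" "s < a n" for s
  proof -
    define j where "j = nat \<lfloor>(s - a 0) / \<delta>\<rfloor>"
    have pos: "0 \<le> (s - a 0) / \<delta>" using that \<delta> by simp
    have j: "real j \<le> (s - a 0) / \<delta>" "(s - a 0) / \<delta> \<le> real j + 1"
      using pos unfolding j_def by linarith+
    have aj: "a j = a 0 + real j * \<delta>" "a (Suc j) = a 0 + (real j + 1) * \<delta>"
      by (simp_all add: a_def algebra_simps)
    have le: "a j \<le> s" "s \<le> a (Suc j)" using j \<delta> unfolding aj by (simp_all add: field_simps)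
    have "j < n"
    proof (rule ccontr)
      assume "\<not> j < n"
      then have "a n \<le> a j" by (intro a_mono) simp
      then show False using le that by simp
    qed
    then show ?thesis using le by blast
  qed
  \<comment> \<open>Between nodes the chord lies above the convex function; beyond them
    \<open>k\<close> cannot grow faster than slope \<open>m\<close>.\<close>
  have ge: "k s \<le> G (Suc n) s" for s
  proof -
    consider "s \<le> a 0" | "a n \<le> s" | j where "j < n" "a j \<le> s" "s \<le> a (Suc j)"
      using middle[of s] by (meson linorder_not_less)
    then show ?thesis
    proof cases
      case 1 then show ?thesis using left[of s] lip[of s "a 0"] by simp
    next
      case 2 then show ?thesis using right[of s] lip[of s "a n"] by simp
    next
      case 3
      define \<mu> where "\<mu> = (s - a j) / \<delta>"
      have \<mu>: "0 \<le> \<mu>" "\<mu> \<le> 1" using 3 \<delta> by (auto simp: \<mu>_def a_step field_simps)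
      have \<mu>\<delta>: "\<mu> * \<delta> = s - a j" using \<delta> by (simp add: \<mu>_def)
      have "k ((1 - \<mu>) *\<^sub>R a j + \<mu> *\<^sub>R a (Suc j)) \<le> (1 - \<mu>) * k (a j) + \<mu> * k (a (Suc j))"
        using \<mu> by (intro convex_onD[OF conv]) auto
      moreover have "(1 - \<mu>) *\<^sub>R a j + \<mu> *\<^sub>R a (Suc j) = s"
        using \<mu>\<delta> by (simp add: a_step algebra_simps)
      moreover have "(1 - \<mu>) * k (a j) + \<mu> * k (a (Suc j)) = k (a j) + \<sigma> (Suc j) * (s - a j)"
        using 3(1) \<delta> by (simp add: \<sigma>_def \<mu>_def) (simp add: field_simps)
      moreover have "G (Suc n) s = k (a j) + \<sigma> (Suc j) * (s - a j)"
        using 3 G_last[of "Suc j" s] G_Suc[of j s] by simp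
      ultimately show ?thesis by simp
    qed
  qed
  have le_mid: "G (Suc n) s \<le> k s + 2 * m * \<delta>" if "a 0 < s" "s < a n" for s
  proof -
    obtain j where j: "j < n" "a j \<le> s" "s \<le> a (Suc j)" using middle \<open>a 0 < s\<close> \<open>s < a n\<close> by blast
    have "G (Suc n) s = k (a j) + \<sigma> (Suc j) * (s - a j)"
      using j G_last[of "Suc j" s] G_Suc[of j s] by simp
    moreover have "\<sigma> (Suc j) * (s - a j) \<le> m * (s - a j)"
      using j abs_\<sigma>[of "Suc j"] by (intro mult_right_mono) (auto simp: abs_le_iff)
    moreover have "k (a j) \<le> k s + m * (s - a j)" using lip[of "a j" s] j by simp
    moreover have "m * (s - a j) \<le> m * \<delta>" using j a_step[of j] m by (intro mult_left_mono) auto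
    ultimately show ?thesis by simp
  qed
  have sum_e: "(\<Sum>i\<le>n. e i) = 2 * m"
  proof -
    have "(\<Sum>i<Suc n. \<sigma> (Suc i) - \<sigma> i) = \<sigma> (Suc n) - \<sigma> 0" by (rule sum_lessThan_telescope)
    then show ?thesis by (simp add: e_def \<sigma>_def lessThan_Suc_atMost)
  qed
  \<comment> \<open>Since \<open>max 0 x = (x + \<bar>x\<bar>) / 2\<close>, halved slope jumps
    become the weights of absolute values; the linear parts add up to \<open>m * s\<close>, which
    cancels the initial slope \<open>- m\<close>.\<close>
  define d where "d i = e i / 2" for i
  have sum_d: "(\<Sum>i\<le>n. d i) = m" using sum_e by (simp add: d_def flip: sum_divide_distrib)
  define C where "C = k (a 0) + m * a 0 - (\<Sum>i\<le>n. d i * a i)"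
  have K: "G (Suc n) s = C + (\<Sum>i\<le>n. d i * \<bar>s - a i\<bar>)" for s
  proof -
    have "(\<Sum>i<Suc n. e i * max 0 (s - a i)) = (\<Sum>i\<le>n. d i * s - d i * a i + d i * \<bar>s - a i\<bar>)"
      unfolding lessThan_Suc_atMost by (intro sum.cong) (auto simp: d_def max_def field_simps)
    also have "\<dots> = m * s - (\<Sum>i\<le>n. d i * a i) + (\<Sum>i\<le>n. d i * \<bar>s - a i\<bar>)"
      by (simp add: sum.distrib sum_subtractf sum_d flip: sum_distrib_right)
    finally show ?thesis by (simp add: G_def C_def algebra_simps)
  qed
  \<comment> \<open>The distances from any node to the two outer nodes add up to
    \<open>a n - a 0\<close>, so \<open>2 * C\<close> is
    \<open>k (a 0) + k (a n) - m * (a n - a 0)\<close>, nonnegative by \<open>even\<close>.\<close>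
  have "0 \<le> C"
  proof -
    have "a 0 \<le> a n" by (rule a_mono) simp
    have "k (a 0) + k (a n) = G (Suc n) (a 0) + G (Suc n) (a n)" by (simp add: left right)
    also have "\<dots> = 2 * C + (\<Sum>i\<le>n. d i * \<bar>a 0 - a i\<bar> + d i * \<bar>a n - a i\<bar>)"
      by (simp add: K sum.distrib)
    also have "(\<Sum>i\<le>n. d i * \<bar>a 0 - a i\<bar> + d i * \<bar>a n - a i\<bar>) = (\<Sum>i\<le>n. d i * (a n - a 0))"
    proof (rule sum.cong)
      fix i assume "i \<in> {..n}"
      then have "a 0 \<le> a i" "a i \<le> a n" by (auto intro: a_mono)
      then show "d i * \<bar>a 0 - a i\<bar> + d i * \<bar>a n - a i\<bar> = d i * (a n - a 0)"
        by (simp add: algebra_simps)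
    qed simp
    also have "\<dots> = m * (a n - a 0)" by (simp add: sum_d flip: sum_distrib_right)
    finally show ?thesis using even[of "a n" "a 0"] \<open>a 0 \<le> a n\<close> by simp
  qed
  have far: "G (Suc n) s \<le> k 0 + m * \<bar>s\<bar>" if "s \<le> a 0 \<or> a n \<le> s" for s
  proof -
    have "0 \<le> real N * \<delta>" using \<delta> by simp
    then show ?thesis
      using that left[of s] right[of s] lip[of "a 0" 0] lip[of "a n" 0]
      by (auto simp: a0 an algebra_simps)
  qed
  have "0 < real N * \<delta>" using \<delta> by (simp add: N_def)
  show ?thesis
  proof (rule that[of C n d a])
    show "0 \<le> d i" if "i \<le> n" for i using e_nonneg[OF that] by (simp add: d_def)
    show "C + (\<Sum>i\<le>n. d i * \<bar>s - a i\<bar>) \<le> k s + 2 * m * \<delta>" if "\<bar>s\<bar> \<le> T" for s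
    proof (cases "a 0 < s \<and> s < a n")
      case True then show ?thesis using le_mid[of s] K[of s] by simp
    next
      case False
      then have "s = a 0 \<or> s = a n" using that N by (auto simp: a0 an abs_le_iff)
      then have "G (Suc n) s = k s" using left[of s] right[of s] by auto
      then show ?thesis using K[of s] m \<delta> by simp
    qed
    show "C + (\<Sum>i\<le>n. d i * \<bar>s - a i\<bar>) \<le> max (k s + 2 * m * \<delta>) (k 0 + m * \<bar>s\<bar>)" for s
      using le_mid[of s] far[of s] K[of s] by (cases "a 0 < s \<and> s < a n") auto
  qed (use \<open>0 \<le> C\<close> sum_d ge K in auto)
qed

lemma inner_zono_le: "y \<in> zono vs \<Longrightarrow> u \<bullet> y \<le> (\<Sum>v\<leftarrow>vs. \<bar>u \<bullet> v\<bar>)"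
proof (induction vs arbitrary: y)
  case (Cons v vs)
  then obtain z w where "z \<in> zono vs" "w \<in> seg v" "y = z + w" by (auto elim: set_plus_elim)
  moreover from this obtain a where "\<bar>a\<bar> \<le> 1" "w = a *\<^sub>R v" by (auto simp: mem_seg)
  moreover have "u \<bullet> w \<le> \<bar>u \<bullet> v\<bar>"
  proof -
    have "u \<bullet> w \<le> \<bar>a\<bar> * \<bar>u \<bullet> v\<bar>" using \<open>w = a *\<^sub>R v\<close> abs_ge_self[of "u \<bullet> w"] by (simp add: abs_mult)
    also have "\<dots> \<le> \<bar>u \<bullet> v\<bar>" using \<open>\<bar>a\<bar> \<le> 1\<close> by (simp add: mult_left_le_one_le)
    finally show ?thesis .
  qed
  ultimately show ?case using Cons.IH[of z] by (simp add: inner_add_right)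
qed simp

lemma inner_zono_attained: "\<exists>y\<in>zono vs. u \<bullet> y = (\<Sum>v\<leftarrow>vs. \<bar>u \<bullet> v\<bar>)"
proof (induction vs)
  case (Cons v vs)
  then obtain y where y: "y \<in> zono vs" "u \<bullet> y = (\<Sum>v\<leftarrow>vs. \<bar>u \<bullet> v\<bar>)" by blast
  have "\<bar>sgn (u \<bullet> v)\<bar> \<le> 1" by (simp add: sgn_real_def)
  then have "sgn (u \<bullet> v) *\<^sub>R v \<in> seg v" unfolding mem_seg by blast
  then have "y + sgn (u \<bullet> v) *\<^sub>R v \<in> zono (v # vs)" using y by (auto intro: set_plus_intro)
  moreover have "u \<bullet> (y + sgn (u \<bullet> v) *\<^sub>R v) = (\<Sum>v\<leftarrow>v # vs. \<bar>u \<bullet> v\<bar>)"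
    using y by (simp add: inner_add_right abs_sgn mult.commute)
  ultimately show ?case by blast
qed simp

lemma subset_if_support_le:
  fixes A B :: "'a::euclidean_space set"
  assumes "closed B" "convex B" and le: "\<And>u a. a \<in> A \<Longrightarrow> \<exists>b\<in>B. u \<bullet> a \<le> u \<bullet> b"
  shows "A \<subseteq> B"
proof
  fix a assume a: "a \<in> A"
  show "a \<in> B"
  proof (rule ccontr)
    assume "a \<notin> B"
    then obtain u t where ut: "u \<bullet> a < t" "\<And>x. x \<in> B \<Longrightarrow> t < u \<bullet> x"
      using separating_hyperplane_closed_point[OF assms(2,1)] by blast
    obtain b where b: "b \<in> B" "(- u) \<bullet> a \<le> (- u) \<bullet> b" using le[OF a] by blast
    then show False using ut(1) ut(2)[OF b(1)] by simp
  qed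
qed

text \<open>By homogeneity the support function \<open>h\<close> is given by its values at
  \<open>(1, s)\<close> and \<open>(0, 1)\<close>. It is interpolated along the line of the points
  \<open>(1, s)\<close>, and each term of the interpolant is the restriction of the support function
  of a segment. The inner ball bounds \<open>h\<close> from below, which turns additive errors into
  relative ones.\<close>

lemma zonoid_symmetric:
  assumes L: "compact L" "convex L" and sym: "uminus ` L = L" and int: "0 \<in> interior L"
  shows "zonoid L"
  unfolding zonoid_def
proof (intro allI impI)
  fix \<epsilon> :: real assume \<epsilon>: "0 < \<epsilon>"
  obtain r where r: "0 < r" "cball 0 r \<subseteq> L" using int by (auto simp: mem_interior_cball)
  then have ne: "L \<noteq> {}" by force
  define h where "h u = (SUP y\<in>L. u \<bullet> y)" for u
  have attained: "\<exists>y\<in>L. u \<bullet> y = h u \<and> (\<forall>z\<in>L. u \<bullet> z \<le> u \<bullet> y)" for u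
  proof -
    have "continuous_on L (\<lambda>y. u \<bullet> y)" by (intro continuous_intros)
    then obtain y where y: "y \<in> L" "\<forall>z\<in>L. u \<bullet> z \<le> u \<bullet> y"
      using continuous_attains_sup[OF L(1) ne] by blast
    then have "h u = u \<bullet> y" unfolding h_def by (intro cSup_eq_maximum) auto
    then show ?thesis using y by auto
  qed
  have h_ge: "u \<bullet> y \<le> h u" if "y \<in> L" for u y using attained[of u] that by auto
  have h_add: "h (u + w) \<le> h u + h w" for u w
    using attained[of "u + w"] h_ge[of _ u] h_ge[of _ w] by (force simp: inner_add_left)
  have h_minus: "h (- u) = h u" for u
  proof -
    have "h (- u) \<le> h u" for u
    proof -
      obtain y where y: "y \<in> L" "(- u) \<bullet> y = h (- u)" using attained[of "- u"] by blast
      then have "- y \<in> L" using sym by blast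
      then show ?thesis using h_ge[of "- y" u] y by simp
    qed
    from this[of u] this[of "- u"] show ?thesis by simp
  qed
  have h_scale: "h (t *\<^sub>R u) = \<bar>t\<bar> * h u" for t u
  proof -
    have pos: "h (t *\<^sub>R u) \<le> t * h u" if "0 \<le> t" for t u
    proof -
      obtain y where y: "y \<in> L" "(t *\<^sub>R u) \<bullet> y = h (t *\<^sub>R u)" using attained[of "t *\<^sub>R u"] by blast
      then show ?thesis using mult_left_mono[OF h_ge[OF y(1), of u] that] by simp
    qed
    have eq: "h (t *\<^sub>R u) = t * h u" if "0 < t" for t u
      using pos[of t u] pos[of "1 / t" "t *\<^sub>R u"] that by (simp add: field_simps)
    have "h 0 = 0" using attained[of 0] by auto
    then show ?thesis using eq[of t u] eq[of "- t" u] h_minus[of "t *\<^sub>R u"]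
      by (cases t "0 :: real" rule: linorder_cases) auto
  qed
  have h_norm: "r * norm u \<le> h u" for u
  proof (cases "u = 0")
    case True then show ?thesis using h_scale[of 0 0] by simp
  next
    case False
    have "(r / norm u) *\<^sub>R u \<in> L" using r False by auto
    then have "u \<bullet> ((r / norm u) *\<^sub>R u) \<le> h u" by (rule h_ge)
    then show ?thesis using False by (simp add: power2_norm_eq_inner[symmetric] power2_eq_square)
  qed
  define U where "U s = (axis 1 1 + s *\<^sub>R axis 2 1 :: real ^ 2)" for s
  define k where "k s = h (U s)" for s
  define m where "m = h (axis 2 1)"
  have U_simps: "U s $ 1 = 1" "U s $ 2 = s" for s by (simp_all add: U_def axis_def)
  have k_norm: "r \<le> k s" "r * \<bar>s\<bar> \<le> k s" for s
  proof -
    have "1 \<le> norm (U s)" "\<bar>s\<bar> \<le> norm (U s)"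
      using component_le_norm_cart[of "U s" 1] component_le_norm_cart[of "U s" 2] by (simp_all add: U_simps)
    then have "r * 1 \<le> r * norm (U s)" "r * \<bar>s\<bar> \<le> r * norm (U s)" using r by (auto intro!: mult_left_mono)
    then show "r \<le> k s" "r * \<bar>s\<bar> \<le> k s" using h_norm[of "U s"] by (auto simp: k_def)
  qed
  have m: "0 \<le> m" using h_norm[of "axis 2 1"] r
    by (smt (verit) m_def mult_nonneg_nonneg norm_ge_zero)
  have lip: "k s \<le> k t + m * \<bar>s - t\<bar>" for s t
  proof -
    have "U s = U t + (s - t) *\<^sub>R axis 2 1" by (simp add: U_def algebra_simps)
    then show ?thesis using h_add[of "U t" "(s - t) *\<^sub>R axis 2 1"] by (simp add: k_def m_def h_scale mult.commute)
  qed
  have even: "m * \<bar>s - t\<bar> \<le> k s + k t" for s t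
  proof -
    have "(s - t) *\<^sub>R axis 2 1 = U s + (- U t)" by (simp add: U_def algebra_simps)
    then have "h ((s - t) *\<^sub>R axis 2 1) \<le> h (U s) + h (- U t)" using h_add[of "U s" "- U t"] by simp
    then show ?thesis by (simp add: k_def m_def h_scale h_minus mult.commute)
  qed
  have conv: "convex_on UNIV k"
  proof (rule convex_onI)
    fix t x y :: real assume t: "0 < t" "t < 1"
    have "U ((1 - t) *\<^sub>R x + t *\<^sub>R y) = (1 - t) *\<^sub>R U x + t *\<^sub>R U y"
      by (simp add: U_def algebra_simps)
    then show "k ((1 - t) *\<^sub>R x + t *\<^sub>R y) \<le> (1 - t) * k x + t * k y"
      using h_add[of "(1 - t) *\<^sub>R U x" "t *\<^sub>R U y"] t by (simp add: k_def h_scale)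
  qed simp
  \<comment> \<open>Makes the interpolation error \<open>2 * m * \<delta>\<close> at most
    \<open>\<epsilon> * r\<close>, hence at most \<open>\<epsilon> * k s\<close>; the
    \<open>+ 1\<close> keeps the denominator positive knowing only \<open>0 \<le> m\<close>.\<close>
  define \<delta> where "\<delta> = \<epsilon> * r / (2 * m + 1)"
  have \<delta>: "0 < \<delta>" using \<epsilon> r m by (simp add: \<delta>_def)
  have "(2 * m + 1) * \<delta> = \<epsilon> * r" using m by (simp add: \<delta>_def)
  then have m\<delta>: "2 * m * \<delta> \<le> \<epsilon> * r" using \<delta> by (simp add: algebra_simps)
  \<comment> \<open>Beyond \<open>T\<close> the lower bound
    \<open>r * \<bar>s\<bar> \<le> k s\<close> gives \<open>2 * k 0 \<le> \<epsilon> * k s\<close>,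
    which absorbs the coarser estimate available there.\<close>
  define T where "T = 2 * k 0 / (\<epsilon> * r)"
  show "\<exists>vs. L \<subseteq> zono vs \<and> zono vs \<subseteq> (*\<^sub>R) (1 + \<epsilon>) ` L"
  proof (rule convex_interpolation[OF conv lip even \<delta>, of T])
    fix C :: real and d a :: "nat \<Rightarrow> real" and n
    assume C: "0 \<le> C" and d: "\<And>i. i \<le> n \<Longrightarrow> 0 \<le> d i" and sum_d: "(\<Sum>i\<le>n. d i) = m"
      and lower: "\<And>s. k s \<le> C + (\<Sum>i\<le>n. d i * \<bar>s - a i\<bar>)"
      and near: "\<And>s. \<bar>s\<bar> \<le> T \<Longrightarrow> C + (\<Sum>i\<le>n. d i * \<bar>s - a i\<bar>) \<le> k s + 2 * m * \<delta>"
      and far: "\<And>s. T < \<bar>s\<bar> \<Longrightarrow> C + (\<Sum>i\<le>n. d i * \<bar>s - a i\<bar>) \<le> max (k s + 2 * m * \<delta>) (k 0 + m * \<bar>s\<bar>)"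
    have upper: "C + (\<Sum>i\<le>n. d i * \<bar>s - a i\<bar>) \<le> (1 + \<epsilon>) * k s" for s
    proof -
      have "\<epsilon> * r \<le> \<epsilon> * k s" using k_norm(1)[of s] \<epsilon> by simp
      then have 1: "k s + 2 * m * \<delta> \<le> (1 + \<epsilon>) * k s" using m\<delta> by (simp add: algebra_simps)
      show ?thesis
      proof (cases "\<bar>s\<bar> \<le> T")
        case True then show ?thesis using near[of s] 1 by simp
      next
        case False
        then have "2 * k 0 \<le> \<epsilon> * (r * \<bar>s\<bar>)" using \<epsilon> r by (simp add: T_def field_simps)
        also have "\<dots> \<le> \<epsilon> * k s" using \<epsilon> k_norm(2)[of s] by simp
        finally have "2 * k 0 \<le> \<epsilon> * k s" .
        then have "k 0 + m * \<bar>s\<bar> \<le> (1 + \<epsilon>) * k s" using even[of s 0] by (simp add: algebra_simps)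
        then show ?thesis using far[of s] 1 False by simp
      qed
    qed
    \<comment> \<open>These segments have support functions \<open>C * \<bar>u $ 1\<bar>\<close> and
      \<open>d i * \<bar>u $ 2 - a i * u $ 1\<bar>\<close>; at \<open>u = (1, s)\<close> they add up
      to the interpolant.\<close>
    define vs :: "(real ^ 2) list" where "vs = C *\<^sub>R axis 1 1 # map (\<lambda>i. d i *\<^sub>R (axis 2 1 - a i *\<^sub>R axis 1 1)) [0..<Suc n]"
    define H where "H u = (\<Sum>v\<leftarrow>vs. \<bar>u \<bullet> v\<bar>)" for u
    have H_eq: "H u = C * \<bar>u $ 1\<bar> + (\<Sum>i\<le>n. d i * \<bar>u $ 2 - a i * u $ 1\<bar>)" for u
    proof -
      have "(\<Sum>i\<leftarrow>[0..<Suc n]. \<bar>u \<bullet> (d i *\<^sub>R (axis 2 1 - a i *\<^sub>R axis 1 1))\<bar>) =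
          (\<Sum>i\<in>{0..<Suc n}. \<bar>u \<bullet> (d i *\<^sub>R (axis 2 1 - a i *\<^sub>R axis 1 1))\<bar>)"
        by (rule interv_sum_list_conv_sum_set_nat[unfolded set_upt])
      also have "\<dots> = (\<Sum>i\<le>n. d i * \<bar>u $ 2 - a i * u $ 1\<bar>)"
        using d by (intro sum.cong)
          (auto simp: inner_diff_right inner_axis abs_mult abs_of_nonneg atLeast0LessThan lessThan_Suc_atMost)
      finally show ?thesis
        using C by (simp add: H_def vs_def comp_def inner_axis abs_mult del: upt_Suc)
    qed
    have H_bounds: "h u \<le> H u \<and> H u \<le> (1 + \<epsilon>) * h u" for u
    proof (cases "u $ 1 = 0")
      \<comment> \<open>Vertical directions are not multiples of any \<open>(1, s)\<close>; there
        the total weight \<open>m\<close> makes both support functions equal.\<close>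
      case True
      then have u: "u = (u $ 2) *\<^sub>R axis 2 1" by (simp add: vec_eq_iff forall_2 axis_def)
      have "H u = m * \<bar>u $ 2\<bar>" using True by (simp add: H_eq sum_d flip: sum_distrib_right)
      moreover have "h u = m * \<bar>u $ 2\<bar>" by (subst u) (simp add: h_scale m_def)
      ultimately show ?thesis using \<epsilon> m by (simp add: algebra_simps)
    next
      case False
      define s where "s = u $ 2 / u $ 1"
      have u2: "u $ 2 = s * u $ 1" using False by (simp add: s_def)
      then have u: "u = (u $ 1) *\<^sub>R U s" by (simp add: vec_eq_iff forall_2 U_simps)
      have "h u = \<bar>u $ 1\<bar> * k s" by (subst u) (simp add: h_scale k_def)
      moreover have "H u = \<bar>u $ 1\<bar> * (C + (\<Sum>i\<le>n. d i * \<bar>s - a i\<bar>))"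
      proof -
        have "\<bar>u $ 2 - a i * u $ 1\<bar> = \<bar>u $ 1\<bar> * \<bar>s - a i\<bar>" for i
          unfolding u2 by (simp add: algebra_simps flip: abs_mult)
        then show ?thesis by (simp add: H_eq sum_distrib_left algebra_simps)
      qed
      ultimately show ?thesis
        using mult_left_mono[OF lower[of s], of "\<bar>u $ 1\<bar>"] mult_left_mono[OF upper[of s], of "\<bar>u $ 1\<bar>"]
        by (simp add: algebra_simps)
    qed
    have "L \<subseteq> zono vs"
    proof (rule subset_if_support_le)
      fix u a assume "a \<in> L"
      then have "u \<bullet> a \<le> H u" using h_ge[of a u] H_bounds[of u] by simp
      moreover obtain b where "b \<in> zono vs" "u \<bullet> b = H u"
        unfolding H_def using inner_zono_attained[of vs u] by blast
      ultimately show "\<exists>b\<in>zono vs. u \<bullet> a \<le> u \<bullet> b" by (intro bexI[of _ b]) auto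
    qed (simp_all add: compact_imp_closed)
    moreover have "zono vs \<subseteq> (*\<^sub>R) (1 + \<epsilon>) ` L"
    proof (rule subset_if_support_le)
      fix u a assume "a \<in> zono vs"
      then have "u \<bullet> a \<le> H u" unfolding H_def by (rule inner_zono_le)
      then have "u \<bullet> a \<le> (1 + \<epsilon>) * h u" using H_bounds[of u] by simp
      moreover obtain y where "y \<in> L" "u \<bullet> y = h u" using attained[of u] by blast
      ultimately show "\<exists>b\<in>(*\<^sub>R) (1 + \<epsilon>) ` L. u \<bullet> a \<le> u \<bullet> b" by (intro bexI[of _ "(1 + \<epsilon>) *\<^sub>R y"]) auto
    qed (use L in \<open>auto simp: convex_scaling compact_scaling compact_imp_closed\<close>)
    ultimately show "\<exists>vs. L \<subseteq> zono vs \<and> zono vs \<subseteq> (*\<^sub>R) (1 + \<epsilon>) ` L" by blast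
  qed
qed

section \<open>Central symmetrization\<close>

text \<open>Half the difference body of \<open>A\<close>.\<close>

definition central :: "(real ^ 2) set \<Rightarrow> (real ^ 2) set" where
  "central A = mean A (uminus ` A)"

text \<open>The coordinate along \<open>p\<close>, normalized so that \<open>p\<close> itself has
  coordinate \<open>1\<close>; \<open>wedge p\<close> is the complementary coordinate, called height
  below.\<close>

definition kappa :: "real ^ 2 \<Rightarrow> real ^ 2 \<Rightarrow> real" where
  "kappa p y = (y \<bullet> p) / (p \<bullet> p)"

lemma kappa_simps [simp]:
  "kappa p (x + y) = kappa p x + kappa p y" "kappa p (x - y) = kappa p x - kappa p y"
  "kappa p (- x) = - kappa p x" "kappa p (r *\<^sub>R x) = r * kappa p x"
  "kappa (- p) x = - kappa p x" "p \<noteq> 0 \<Longrightarrow> kappa p p = 1" "kappa p 0 = 0"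
  by (simp_all add: kappa_def inner_add_left inner_diff_left add_divide_distrib diff_divide_distrib)

lemma continuous_on_kappa [continuous_intros]:
  "continuous_on S f \<Longrightarrow> continuous_on S (\<lambda>x. kappa p (f x))"
  unfolding kappa_def by (cases "p = 0") (auto intro!: continuous_intros)

lemma eq_if_kappa_wedge_eq:
  assumes "p \<noteq> 0" "kappa p y = kappa p z" "wedge p y = wedge p z"
  shows "y = z"
proof -
  have "wedge (y - z) p = 0" using assms wedge_commute[of y p] wedge_commute[of z p] by simp
  then obtain t where t: "y - z = t *\<^sub>R p" using wedge_eq_0_iff[OF assms(1)] by blast
  have "kappa p (y - z) = 0" using assms by simp
  then show ?thesis using t assms by simp
qed

text \<open>The part of a body on one side of a chord \<open>[-p, p]\<close> of maximal length. Its union with its own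
  reflection is again convex because the body lies in the strip \<open>\<bar>kappa p y\<bar> \<le> 1\<close>.\<close>

definition half_body :: "real ^ 2 \<Rightarrow> (real ^ 2) set \<Rightarrow> bool" where
  "half_body p X \<longleftrightarrow> compact X \<and> convex X \<and> p \<noteq> 0 \<and> p \<in> X \<and> - p \<in> X \<and>
    (\<forall>y\<in>X. 0 \<le> wedge p y \<and> \<bar>kappa p y\<bar> \<le> 1)"

lemma convex_mem_chord:
  assumes "convex X" "p \<in> X" "- p \<in> X" "a \<in> X" "0 \<le> \<mu>" "\<bar>\<tau>\<bar> \<le> 1 - \<mu>"
  shows "\<mu> *\<^sub>R a + \<tau> *\<^sub>R p \<in> X"
proof (cases "\<mu> = 1")
  case True then show ?thesis using assms by simp
next
  case False
  then have \<mu>: "\<mu> < 1" using assms by simp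
  define s where "s = (1 + \<tau> / (1 - \<mu>)) / 2"
  have s: "0 \<le> s" "s \<le> 1" using assms \<mu> by (auto simp: s_def field_simps)
  have "s *\<^sub>R p + (1 - s) *\<^sub>R (- p) = (\<tau> / (1 - \<mu>)) *\<^sub>R p"
    by (simp add: s_def flip: scaleR_left_diff_distrib)
  then have "(\<tau> / (1 - \<mu>)) *\<^sub>R p \<in> X"
    using convexD[OF assms(1,2,3), of s "1 - s"] s by simp
  then have "\<mu> *\<^sub>R a + (1 - \<mu>) *\<^sub>R (\<tau> / (1 - \<mu>)) *\<^sub>R p \<in> X"
    using convexD[OF assms(1,4) _ assms(5), of _ "1 - \<mu>"] \<mu> by (simp del: scaleR_scaleR)
  then show ?thesis using \<mu> by simp
qed

section \<open>Halves of a body on one side of a chord\<close>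

context
  fixes p :: "real ^ 2" and X :: "(real ^ 2) set"
  assumes X: "half_body p X"
begin

lemma half_body_simps: "compact X" "convex X" "p \<noteq> 0" "p \<in> X" "- p \<in> X"
  and half_body_bounds: "\<And>y. y \<in> X \<Longrightarrow> 0 \<le> wedge p y" "\<And>y. y \<in> X \<Longrightarrow> \<bar>kappa p y\<bar> \<le> 1"
  using X by (auto simp: half_body_def)

lemma half_body_seg: "\<bar>\<tau>\<bar> \<le> 1 \<Longrightarrow> \<tau> *\<^sub>R p \<in> X"
  using convex_mem_chord[of X p p 0 \<tau>] half_body_simps by simp

text \<open>Below any \<open>a\<close> the body contains the whole perpendicular down to the chord,
  because \<open>\<bar>kappa p a\<bar> \<le> 1\<close> puts its foot on the chord; \<open>x\<close>
  is the point of that perpendicular at the height of \<open>z\<close>.\<close>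

lemma half_body_lower:
  assumes a: "a \<in> X" and z: "0 \<le> wedge p z" "wedge p z \<le> wedge p a"
  shows "\<exists>x\<in>X. z = x + (kappa p z - kappa p a) *\<^sub>R p"
proof -
  define \<mu> where "\<mu> = (if wedge p a = 0 then 0 else wedge p z / wedge p a)"
  have \<mu>: "0 \<le> \<mu>" "\<mu> \<le> 1" "\<mu> * wedge p a = wedge p z" using z by (auto simp: \<mu>_def)
  define x where "x = \<mu> *\<^sub>R a + ((1 - \<mu>) * kappa p a) *\<^sub>R p"
  have "\<bar>(1 - \<mu>) * kappa p a\<bar> \<le> 1 - \<mu>"
    using \<mu> half_body_bounds(2)[OF a] by (simp add: abs_mult mult_left_le)
  then have "x \<in> X" unfolding x_def using \<mu> a half_body_simps by (intro convex_mem_chord) auto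
  moreover have "z = x + (kappa p z - kappa p a) *\<^sub>R p"
    using \<mu> half_body_simps by (intro eq_if_kappa_wedge_eq[of p]) (auto simp: x_def algebra_simps)
  ultimately show ?thesis by blast
qed

text \<open>Subtracting a multiple of \<open>b\<close> only lowers the height, so the result is
  \<open>\<mu>\<close> times \<open>a\<close> plus a multiple of \<open>p\<close>, with
  \<open>\<mu> \<le> u\<close>; that multiple is at most \<open>(u - \<mu>) + v = 1 - \<mu>\<close>
  in absolute value.\<close>

lemma half_body_mixed:
  assumes "a \<in> X" "b \<in> X" "0 \<le> u" "0 \<le> v" "u + v = 1" "0 \<le> wedge p (u *\<^sub>R a - v *\<^sub>R b)"
  shows "u *\<^sub>R a - v *\<^sub>R b \<in> X"
proof -
  define z where "z = u *\<^sub>R a - v *\<^sub>R b"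
  define \<mu> where "\<mu> = (if wedge p a = 0 then 0 else wedge p z / wedge p a)"
  have a: "0 \<le> wedge p a" "\<bar>kappa p a\<bar> \<le> 1" and b: "0 \<le> wedge p b" "\<bar>kappa p b\<bar> \<le> 1"
    using half_body_bounds assms by auto
  have z: "wedge p z = u * wedge p a - v * wedge p b" "0 \<le> wedge p z" using assms by (simp_all add: z_def)
  have vb: "0 \<le> v * wedge p b" using assms b by simp
  have \<mu>: "0 \<le> \<mu>" "\<mu> \<le> u" "\<mu> * wedge p a = wedge p z"
    using z a vb assms by (auto simp: \<mu>_def field_simps)
  have "z = \<mu> *\<^sub>R a + ((u - \<mu>) * kappa p a - v * kappa p b) *\<^sub>R p"
    using \<mu> half_body_simps by (intro eq_if_kappa_wedge_eq[of p]) (auto simp: algebra_simps z_def)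
  moreover have "\<bar>(u - \<mu>) * kappa p a - v * kappa p b\<bar> \<le> 1 - \<mu>"
  proof -
    have "\<bar>(u - \<mu>) * kappa p a\<bar> \<le> u - \<mu>" "\<bar>v * kappa p b\<bar> \<le> v"
      using a b \<mu> assms by (auto simp: abs_mult mult_left_le)
    then show ?thesis using assms(5) by linarith
  qed
  ultimately show ?thesis unfolding z_def[symmetric]
    using \<mu> assms half_body_simps convex_mem_chord[of X p a \<mu>] by simp
qed

lemma convex_half_body_Un: "convex (X \<union> uminus ` X)"
proof (rule convexI)
  have mixed: "u *\<^sub>R a - v *\<^sub>R b \<in> X \<union> uminus ` X"
    if "a \<in> X" "b \<in> X" "0 \<le> u" "0 \<le> v" "u + v = 1" for a b u v
  proof (cases "0 \<le> wedge p (u *\<^sub>R a - v *\<^sub>R b)")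
    case True then show ?thesis using half_body_mixed[OF that] by blast
  next
    case False
    then have "v *\<^sub>R b - u *\<^sub>R a \<in> X" using that by (intro half_body_mixed) auto
    then show ?thesis by (intro UnI2 image_eqI[of _ _ "v *\<^sub>R b - u *\<^sub>R a"]) auto
  qed
  fix x y and u v :: real
  assume "x \<in> X \<union> uminus ` X" "y \<in> X \<union> uminus ` X" and uv: "0 \<le> u" "0 \<le> v" "u + v = 1"
  then consider "x \<in> X" "y \<in> X" | b where "x \<in> X" "y = - b" "b \<in> X"
    | a where "x = - a" "a \<in> X" "y \<in> X" | a b where "x = - a" "y = - b" "a \<in> X" "b \<in> X" by blast
  then show "u *\<^sub>R x + v *\<^sub>R y \<in> X \<union> uminus ` X"
  proof cases
    case 1 then show ?thesis using uv half_body_simps by (auto intro: convexD)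
  next
    case 2 then show ?thesis using mixed[of x b u v] uv by simp
  next
    case 3 then show ?thesis using mixed[of y a v u] uv by (simp add: add.commute)
  next
    case 4
    then have "u *\<^sub>R a + v *\<^sub>R b \<in> X" using uv half_body_simps by (auto intro: convexD)
    then show ?thesis using 4 by (intro UnI2 image_eqI[of _ _ "u *\<^sub>R a + v *\<^sub>R b"]) auto
  qed
qed

lemma half_body_wedge_0:
  assumes "y \<in> X" "wedge p y = 0"
  shows "y \<in> seg p"
proof -
  have "y = kappa p y *\<^sub>R p"
    using assms half_body_simps by (intro eq_if_kappa_wedge_eq[of p]) auto
  then show ?thesis unfolding mem_seg using half_body_bounds(2)[OF assms(1)] by blast
qed

lemma seg_subset_half_body: "seg p \<subseteq> X"
  using half_body_seg by (auto simp: mem_seg)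

lemma half_body_Int: "X \<inter> uminus ` X = seg p"
proof
  show "X \<inter> uminus ` X \<subseteq> seg p"
  proof
    fix y assume "y \<in> X \<inter> uminus ` X"
    then have "y \<in> X" "- y \<in> X" by auto
    then show "y \<in> seg p"
      using half_body_bounds(1)[of y] half_body_bounds(1)[of "- y"] half_body_wedge_0[of y] by simp
  qed
  show "seg p \<subseteq> X \<inter> uminus ` X"
  proof
    fix y assume "y \<in> seg p"
    then obtain a where "\<bar>a\<bar> \<le> 1" "y = a *\<^sub>R p" by (auto simp: mem_seg)
    then show "y \<in> X \<inter> uminus ` X"
      using half_body_seg[of a] half_body_seg[of "- a"] by (auto intro!: image_eqI[of _ _ "- a *\<^sub>R p"])
  qed
qed

lemma compact_half_body_Un: "compact (X \<union> uminus ` X)"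
  using half_body_simps by (intro compact_Un compact_negations)

lemma zonoid_half_body_Un: "zonoid (X \<union> uminus ` X)"
proof (cases "\<forall>y\<in>X. wedge p y = 0")
  case True
  then have "X = seg p" using half_body_wedge_0 seg_subset_half_body by blast
  then have "X \<subseteq> uminus ` X" using half_body_Int by (metis inf.orderI)
  then have "uminus ` X \<subseteq> X" by force
  then have "X \<union> uminus ` X = X" by auto
  then show ?thesis using \<open>X = seg p\<close> zonoid_seg[of p] by simp
next
  case False
  then obtain a where a: "a \<in> X" "0 < wedge p a" using half_body_bounds(1) by force
  \<comment> \<open>Coordinates with respect to the basis \<open>a\<close>, \<open>p\<close>: the
    region \<open>\<bar>\<alpha> y\<bar> + \<bar>\<beta> y\<bar> < 1\<close> lies in the union,
    which makes \<open>0\<close> an interior point.\<close>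
  define \<beta> where "\<beta> y = wedge p y / wedge p a" for y
  define \<alpha> where "\<alpha> y = kappa p y - \<beta> y * kappa p a" for y
  have y_eq: "y = \<beta> y *\<^sub>R a + \<alpha> y *\<^sub>R p" for y
    using a half_body_simps by (intro eq_if_kappa_wedge_eq[of p]) (auto simp: \<alpha>_def \<beta>_def)
  have "0 \<in> interior (X \<union> uminus ` X)"
  proof (rule interiorI)
    have "continuous_on UNIV (\<lambda>y. \<bar>\<alpha> y\<bar> + \<bar>\<beta> y\<bar>)"
      unfolding \<alpha>_def \<beta>_def using a by (auto intro!: continuous_intros)
    then show "open {y. \<bar>\<alpha> y\<bar> + \<bar>\<beta> y\<bar> < 1}" by (rule open_Collect_less[OF _ continuous_on_const])
    show "0 \<in> {y. \<bar>\<alpha> y\<bar> + \<bar>\<beta> y\<bar> < 1}" by (simp add: \<alpha>_def \<beta>_def)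
    show "{y. \<bar>\<alpha> y\<bar> + \<bar>\<beta> y\<bar> < 1} \<subseteq> X \<union> uminus ` X"
    proof safe
      fix y assume y: "\<bar>\<alpha> y\<bar> + \<bar>\<beta> y\<bar> < 1" and not: "y \<notin> uminus ` X"
      show "y \<in> X"
      proof (cases "0 \<le> \<beta> y")
        case True
        have "\<beta> y *\<^sub>R a + \<alpha> y *\<^sub>R p \<in> X"
          using True y a half_body_simps by (intro convex_mem_chord) auto
        then show ?thesis using y_eq[of y] by simp
      next
        case False
        have "(- \<beta> y) *\<^sub>R a + (- \<alpha> y) *\<^sub>R p \<in> X"
          using False y a half_body_simps by (intro convex_mem_chord) auto
        moreover have "(- \<beta> y) *\<^sub>R a + (- \<alpha> y) *\<^sub>R p = - y" using y_eq[of y] by (metis minus_add_distrib scaleR_minus_left)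
        ultimately have "y \<in> uminus ` X" by (intro image_eqI[of _ _ "- y"]) auto
        then show ?thesis using not by simp
      qed
    qed
  qed
  moreover have "uminus ` (X \<union> uminus ` X) = X \<union> uminus ` X"
    by (auto simp: image_Un image_image)
  ultimately show ?thesis
    by (intro zonoid_symmetric compact_half_body_Un convex_half_body_Un)
qed

end

lemma (in Phi2_functional) half_body_Un:
  assumes X: "half_body p X"
  shows "\<phi> (X \<union> uminus ` X) = 2 * \<phi> X - \<phi> (seg p)"
  using union[of X "uminus ` X"] half_body_simps[OF X] convex_half_body_Un[OF X] half_body_Int[OF X]
  by (simp add: even compact_negations convex_negations)

text \<open>When \<open>X\<close> and \<open>Y\<close> are the halves of a body, the right side is
  its difference body. In each case one point is lowered towards the chord by
  \<open>half_body_lower\<close>; the remaining multiple of \<open>p\<close> lies on the chord and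
  so belongs to both halves.\<close>

lemma half_bodies_sum:
  assumes X: "half_body p X" and Y: "half_body (- p) Y"
  shows "(X \<union> uminus ` X) + (Y \<union> uminus ` Y) = (X \<union> Y) + uminus ` (X \<union> Y)" (is "?L = ?R")
proof -
  note X_simps = half_body_simps[OF X] half_body_bounds[OF X]
  note Y_simps = half_body_simps[OF Y, simplified] half_body_bounds[OF Y, simplified]
  have R_D: "\<exists>a\<in>X \<union> Y. \<exists>b\<in>X \<union> Y. z = a - b" if "z \<in> ?R" for z
    using that unfolding set_plus_def by force
  have R_diff: "a - b \<in> ?R" if "a \<in> X \<union> Y" "b \<in> X \<union> Y" for a b
    using set_plus_intro[OF that(1) imageI[OF that(2), of uminus]] by simp
  have R_minus: "- z \<in> ?R" if "z \<in> ?R" for z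
  proof -
    obtain a b where ab: "a \<in> X \<union> Y" "b \<in> X \<union> Y" "z = a - b" using R_D[OF \<open>z \<in> ?R\<close>] by blast
    then show ?thesis using R_diff[OF ab(2,1)] by simp
  qed
  have L_add: "a + b \<in> ?L" if "a \<in> X \<or> - a \<in> X" "b \<in> Y \<or> - b \<in> Y" for a b
    using that by (intro set_plus_intro) (metis UnCI image_eqI minus_minus)+
  have XY: "x + y \<in> ?R" if "x \<in> X" "y \<in> Y" for x y
  proof (cases "0 \<le> wedge p (x + y)")
    case True
    then obtain x' where "x' \<in> X" "x + y = x' + kappa p y *\<^sub>R p"
      using half_body_lower[OF X \<open>x \<in> X\<close>, of "x + y"] Y_simps(6)[OF \<open>y \<in> Y\<close>] by auto
    moreover have "(- kappa p y) *\<^sub>R p \<in> X" using Y_simps(7)[OF \<open>y \<in> Y\<close>] by (intro half_body_seg[OF X]) simp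
    ultimately show ?thesis using R_diff[of x' "(- kappa p y) *\<^sub>R p"] by simp
  next
    case False
    then obtain y' where "y' \<in> Y" "x + y = y' + kappa p x *\<^sub>R p"
      using half_body_lower[OF Y \<open>y \<in> Y\<close>, of "x + y"] X_simps(6)[OF \<open>x \<in> X\<close>] by auto
    moreover have "(- kappa p x) *\<^sub>R p \<in> X" using X_simps(7)[OF \<open>x \<in> X\<close>] by (intro half_body_seg[OF X]) simp
    ultimately show ?thesis using R_diff[of y' "(- kappa p x) *\<^sub>R p"] by simp
  qed
  have XX: "a - b \<in> ?L" if mem: "a \<in> X" "b \<in> X" for a b
  proof -
    have *: "\<exists>x\<in>X. \<exists>y\<in>Y. a - b = x + y" if ab: "a \<in> X" "b \<in> X" "wedge p b \<le> wedge p a" for a b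
    proof -
      obtain x where "x \<in> X" "a - b = x + (- kappa p b) *\<^sub>R p"
        using half_body_lower[OF X \<open>a \<in> X\<close>, of "a - b"] ab X_simps(6)[OF \<open>b \<in> X\<close>] by auto
      moreover have "kappa p b *\<^sub>R (- p) \<in> Y" using X_simps(7)[OF \<open>b \<in> X\<close>] by (intro half_body_seg[OF Y])
      ultimately show ?thesis by (intro bexI[of _ x] bexI[of _ "kappa p b *\<^sub>R (- p)"]) auto
    qed
    show ?thesis
    proof (cases "wedge p b \<le> wedge p a")
      case True then show ?thesis using *[OF mem] L_add by metis
    next
      case False
      then obtain x y where "x \<in> X" "y \<in> Y" "b - a = x + y" using *[OF mem(2,1)] by auto
      moreover from this have "a - b = - x + - y" by (metis minus_add_distrib minus_diff_eq)
      ultimately show ?thesis using L_add[of "- x" "- y"] by simp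
    qed
  qed
  have YY: "a - b \<in> ?L" if mem: "a \<in> Y" "b \<in> Y" for a b
  proof -
    have *: "\<exists>x\<in>X. \<exists>y\<in>Y. a - b = x + y" if ab: "a \<in> Y" "b \<in> Y" "wedge p a \<le> wedge p b" for a b
    proof -
      obtain y where "y \<in> Y" "a - b = y + (- kappa p b) *\<^sub>R p"
        using half_body_lower[OF Y \<open>a \<in> Y\<close>, of "a - b"] ab Y_simps(6)[OF \<open>b \<in> Y\<close>] by auto
      moreover have "(- kappa p b) *\<^sub>R p \<in> X" using Y_simps(7)[OF \<open>b \<in> Y\<close>] by (intro half_body_seg[OF X]) simp
      ultimately show ?thesis by (intro bexI[of _ "(- kappa p b) *\<^sub>R p"] bexI[of _ y]) auto
    qed
    show ?thesis
    proof (cases "wedge p a \<le> wedge p b")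
      case True then show ?thesis using *[OF mem] L_add by metis
    next
      case False
      then obtain x y where "x \<in> X" "y \<in> Y" "b - a = x + y" using *[OF mem(2,1)] by auto
      moreover from this have "a - b = - x + - y" by (metis minus_add_distrib minus_diff_eq)
      ultimately show ?thesis using L_add[of "- x" "- y"] by simp
    qed
  qed
  show ?thesis
  proof
    show "?L \<subseteq> ?R"
    proof
      fix z assume "z \<in> ?L"
      then obtain x y where z: "z = x + y" and "x \<in> X \<union> uminus ` X" "y \<in> Y \<union> uminus ` Y"
        by (rule set_plus_elim)
      then have x: "x \<in> X \<or> - x \<in> X" and y: "y \<in> Y \<or> - y \<in> Y" by auto
      from x y show "z \<in> ?R"
        using XY[of x y] R_minus[OF XY[of "- x" "- y"]] R_diff[of x "- y"] R_diff[of y "- x"]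
        by (auto simp: z add.commute)
    qed
    show "?R \<subseteq> ?L"
    proof
      fix z assume "z \<in> ?R"
      then obtain a b where z: "z = a - b" and ab: "a \<in> X \<or> a \<in> Y" "b \<in> X \<or> b \<in> Y"
        using R_D by blast
      from ab show "z \<in> ?L"
        using XX[of a b] YY[of a b] L_add[of a "- b"] L_add[of "- b" a] by (auto simp: z)
    qed
  qed
qed

section \<open>Cutting a body along a diameter\<close>

lemma central_defect_proportional_aux:
  assumes \<phi>: "Phi2_functional \<phi>" and \<psi>: "Phi2_functional \<psi>"
    and H: "compact H" "convex H" and p: "p \<noteq> 0" "p \<in> H" "- p \<in> H"
    and diam: "\<And>y z. y \<in> H \<Longrightarrow> z \<in> H \<Longrightarrow> norm (y - z) \<le> 2 * norm p"
  shows "Phi2_functional.coef \<psi> * (\<phi> (central H) - \<phi> H) =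
    Phi2_functional.coef \<phi> * (\<psi> (central H) - \<psi> H)"
proof -
  have kappa: "\<bar>kappa p y\<bar> \<le> 1" if "y \<in> H" for y
  proof -
    \<comment> \<open>Otherwise \<open>y\<close> would also be longer than \<open>p\<close>, and
      \<open>norm (y + p)\<close> would exceed the maximal distance.\<close>
    have *: "y \<bullet> p \<le> p \<bullet> p" if y: "norm (y + p) \<le> 2 * norm p" for y
    proof (rule ccontr)
      assume "\<not> y \<bullet> p \<le> p \<bullet> p"
      then have gt: "p \<bullet> p < y \<bullet> p" by simp
      then have "norm p * norm p < norm y * norm p"
        using norm_cauchy_schwarz[of y p] by (simp add: dot_square_norm power2_eq_square)
      then have "norm p < norm y" using p by simp
      then have "p \<bullet> p < y \<bullet> y" by (simp add: dot_square_norm power_strict_mono)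
      moreover have "(y + p) \<bullet> (y + p) \<le> 4 * (p \<bullet> p)"
        using power_mono[OF y, of 2] by (simp add: dot_square_norm power_mult_distrib)
      ultimately show False using gt by (simp add: inner_add_left inner_add_right inner_commute)
    qed
    have "norm (y + p) \<le> 2 * norm p" "norm (- y + p) \<le> 2 * norm p"
      using diam[OF that p(2)] diam[OF that p(3)] by (simp_all add: norm_minus_commute)
    then have "\<bar>y \<bullet> p\<bar> \<le> p \<bullet> p" using *[of y] *[of "- y"] by (simp add: abs_le_iff)
    then show ?thesis using p by (simp add: kappa_def abs_divide)
  qed
  define X Y where "X = H \<inter> {y. 0 \<le> wedge p y}" and "Y = H \<inter> {y. wedge p y \<le> 0}"
  have halfspace: "closed {y. 0 \<le> wedge p y}" "closed {y. wedge p y \<le> 0}"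
    by (intro closed_Collect_le continuous_intros)+
  have conv: "convex {y. 0 \<le> wedge p y}" "convex {y. wedge p y \<le> 0}"
    by (auto simp: convex_def mult_nonneg_nonpos add_nonpos_nonpos)
  have X: "half_body p X"
    using H p kappa halfspace conv by (auto simp: half_body_def X_def compact_Int_closed convex_Int)
  have Y: "half_body (- p) Y"
    using H p kappa halfspace conv by (auto simp: half_body_def Y_def compact_Int_closed convex_Int)
  have Un: "X \<union> Y = H" by (auto simp: X_def Y_def)
  have Int: "X \<inter> Y = seg p"
  proof
    show "X \<inter> Y \<subseteq> seg p" using half_body_wedge_0[OF X] by (auto simp: X_def Y_def)
    show "seg p \<subseteq> X \<inter> Y" using seg_subset_half_body[OF X] seg_subset_half_body[OF Y] by simp
  qed
  let ?L = "X \<union> uminus ` X" and ?M = "Y \<union> uminus ` Y"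
  have central: "central H = mean ?L ?M"
    using half_bodies_sum[OF X Y] by (simp add: central_def mean_def Un)
  \<comment> \<open>By evenness the two bodies have values
    \<open>2 * \<theta> X - \<theta> (seg p)\<close> and
    \<open>2 * \<theta> Y - \<theta> (seg p)\<close>; their mean is the right side of the valuation
    identity for \<open>H = X \<union> Y\<close>.\<close>
  have avg: "\<theta> H = (\<theta> ?L + \<theta> ?M) / 2" if "Phi2_functional \<theta>" for \<theta>
  proof -
    interpret \<theta>: Phi2_functional \<theta> by fact
    have "\<theta> (X \<union> Y) = \<theta> X + \<theta> Y - \<theta> (X \<inter> Y)"
      using half_body_simps[OF X] half_body_simps[OF Y] H by (intro \<theta>.union) (auto simp: Un)
    then show ?thesis
      unfolding Un Int using \<theta>.half_body_Un[OF X] \<theta>.half_body_Un[OF Y] by (simp add: field_simps)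
  qed
  show ?thesis
    unfolding central avg[OF \<phi>] avg[OF \<psi>]
    by (intro mean_defect_proportional \<phi> \<psi> compact_half_body_Un[OF X] compact_half_body_Un[OF Y]
        convex_half_body_Un[OF X] convex_half_body_Un[OF Y] zonoid_half_body_Un[OF X] zonoid_half_body_Un[OF Y])
qed

lemma central_translate: "central ((+) x ` A) = central A"
proof -
  have "(+) x ` A + uminus ` (+) x ` A = A + uminus ` A"
    unfolding set_plus_image by (force simp: image_iff)
  then show ?thesis by (simp add: central_def mean_def)
qed

text \<open>Used with \<open>\<psi>\<close> an area: a nonzero coefficient of \<open>\<phi>\<close>
  turns \<open>\<phi> (central H) = \<phi> H\<close> into equality of areas, and a zero coefficient
  makes \<open>\<phi>\<close> invariant under \<open>central\<close>. A diameter is first centered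
  at \<open>0\<close>; if it degenerates, the body is a singleton.\<close>

theorem central_defect_proportional:
  assumes \<phi>: "Phi2_functional \<phi>" and \<psi>: "Phi2_functional \<psi>"
    and H: "compact H" "convex H"
  shows "Phi2_functional.coef \<psi> * (\<phi> (central H) - \<phi> H) =
    Phi2_functional.coef \<phi> * (\<psi> (central H) - \<psi> H)"
proof (cases "H = {}")
  case True
  then have "central H = H" by (auto simp: central_def mean_def)
  then show ?thesis by simp
next
  case False
  then have "\<exists>x\<in>H. \<exists>y\<in>H. \<forall>u\<in>H. \<forall>v\<in>H. dist u v \<le> dist x y"
    by (rule compact_sup_maxdistance[OF H(1)])
  then obtain x y where xy: "x \<in> H" "y \<in> H"
    and max: "\<forall>u\<in>H. \<forall>v\<in>H. norm (u - v) \<le> norm (x - y)"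
    unfolding dist_norm by blast
  show ?thesis
  proof (cases "x = y")
    case True
    then have "H = {x}" using max xy by auto
    then have eq: "H = (+) x ` {0}" by simp
    have "central H = {0}" unfolding eq central_translate by (simp add: central_def mean_def)
    moreover have "\<phi> H = 0" "\<psi> H = 0"
      unfolding eq using Phi2_functional.translate[OF \<phi>, of "{0}" x] Phi2_functional.translate[OF \<psi>, of "{0}" x]
      by (simp_all add: Phi2_functional.singleton_0[OF \<phi>] Phi2_functional.singleton_0[OF \<psi>])
    ultimately show ?thesis
      by (simp add: Phi2_functional.singleton_0[OF \<phi>] Phi2_functional.singleton_0[OF \<psi>])
  next
    case False
    define p c where "p = (1 / 2) *\<^sub>R (x - y)" and "c = (1 / 2) *\<^sub>R (x + y)"
    define H' where "H' = (+) (- c) ` H"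
    have *: "z - c \<in> H'" if "z \<in> H" for z using that by (auto simp: H'_def image_iff)
    have "x - c = p" "y - c = - p" by (simp_all add: p_def c_def algebra_simps flip: scaleR_2 scaleR_add_left)
    then have mem: "p \<in> H'" "- p \<in> H'" using *[OF xy(1)] *[OF xy(2)] by simp_all
    have H': "compact H'" "convex H'"
      unfolding H'_def by (rule compact_translation[OF H(1)], rule convex_translation[OF H(2)])
    have p: "p \<noteq> 0" "2 * norm p = norm (x - y)" using False by (simp_all add: p_def)
    have "norm (a - b) \<le> 2 * norm p" if "a \<in> H'" "b \<in> H'" for a b
    proof -
      have "a + c \<in> H" "b + c \<in> H" using that by (auto simp: H'_def)
      then have "norm ((a + c) - (b + c)) \<le> norm (x - y)" using max by blast
      then show ?thesis by (simp add: p)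
    qed
    then have "Phi2_functional.coef \<psi> * (\<phi> (central H') - \<phi> H') =
        Phi2_functional.coef \<phi> * (\<psi> (central H') - \<psi> H')"
      by (rule central_defect_proportional_aux[OF \<phi> \<psi> H' p(1) mem])
    then show ?thesis
      using Phi2_functional.translate[OF \<phi> H] Phi2_functional.translate[OF \<psi> H]
      by (simp only: H'_def central_translate)
  qed
qed

section \<open>Area and chord lengths\<close>

definition coords :: "real ^ 2 \<Rightarrow> real ^ 2 \<Rightarrow> real \<times> real" where
  "coords e y = (kappa e y, wedge e y)"

text \<open>For \<open>e \<noteq> 0\<close> the map \<open>coords e\<close> has determinant
  \<open>1\<close>, so this is the usual area, in product coordinates adapted to slicing along
  \<open>e\<close>.\<close>

definition area :: "real ^ 2 \<Rightarrow> (real ^ 2) set \<Rightarrow> real" where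
  "area e A = measure lebesgue (coords e ` A)"

text \<open>The heights, measured perpendicularly to \<open>e\<close>, at which \<open>X\<close> has a chord of length at least
  \<open>s |e|\<close> parallel to \<open>e\<close>; equivalently, the projection of \<open>X \<inter> (X - s e)\<close> along \<open>e\<close>.\<close>

definition profile :: "(real ^ 2) set \<Rightarrow> real ^ 2 \<Rightarrow> real \<Rightarrow> real set" where
  "profile X e s = wedge e ` {y \<in> X. y + s *\<^sub>R e \<in> X}"

lemma linear_coords: "linear (coords e)"
  by (rule linearI) (simp_all add: coords_def)

lemma inj_coords: "e \<noteq> 0 \<Longrightarrow> inj_on (coords e) A"
  by (intro inj_onI) (auto simp: coords_def intro: eq_if_kappa_wedge_eq)

lemma continuous_on_coords: "continuous_on S (coords e)"
  unfolding coords_def by (intro continuous_intros)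

lemma compact_coords: "compact A \<Longrightarrow> compact (coords e ` A)"
  by (intro compact_continuous_image continuous_on_coords)

lemma convex_coords: "convex A \<Longrightarrow> convex (coords e ` A)"
  by (intro convex_linear_image linear_coords)

lemma Phi2_area:
  assumes e: "e \<noteq> 0"
  shows "area e \<in> Phi2"
proof -
  have meas: "coords e ` A \<in> lmeasurable" if "A \<in> compact_convex_sets" for A
    using that by (intro lmeasurable_compact compact_coords) (simp add: compact_convex_sets_def)
  have "valuation (area e)"
    unfolding valuation_def
  proof (intro conjI ballI impI)
    show "area e (A \<union> B) = area e A + area e B - area e (A \<inter> B)"
      if "A \<in> compact_convex_sets" "B \<in> compact_convex_sets" for A B
      using measure_Un3[OF meas[OF that(1)] meas[OF that(2)]] inj_coords[OF e]
      by (simp add: area_def image_Un inj_on_image_Int[of "coords e" UNIV])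
  qed (simp add: area_def)
  moreover have "translation_invariant (area e)"
    unfolding translation_invariant_def
  proof (intro ballI allI)
    fix A x
    have "coords e ` (+) x ` A = (+) (coords e x) ` coords e ` A"
      unfolding image_image by (simp add: linear_add[OF linear_coords])
    then show "area e ((+) x ` A) = area e A" by (simp add: area_def measure_translation)
  qed
  moreover have "monotone_functional (area e)"
    unfolding monotone_functional_def
  proof (rule mono_onI)
    fix A B :: "(real ^ 2) set"
    assume "A \<in> compact_convex_sets" "B \<in> compact_convex_sets" "A \<le> B"
    then show "area e A \<le> area e B"
      unfolding area_def using meas[of A] meas[of B] by (intro measure_mono_fmeasurable) (auto dest: fmeasurableD)
  qed
  moreover have "even_functional (area e)"
    unfolding even_functional_def
  proof
    fix A
    have "coords e ` uminus ` A = (\<lambda>y. (-1) *\<^sub>R y + 0) ` coords e ` A"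
      unfolding image_image by (simp add: linear_neg[OF linear_coords])
    then show "area e (uminus ` A) = area e A"
      unfolding area_def using measure_lebesgue_affine[of "-1" 0 "coords e ` A"] by simp
  qed
  moreover have "area e {0} = 0" by (simp add: area_def)
  ultimately show ?thesis by (simp add: Phi2_def)
qed

lemma (in Phi2_functional) parallelogram:
  "\<phi> (seg y + seg v) = F y + F v + coef * \<bar>wedge y v\<bar>"
  using plus_seg[of "seg y" v] by (simp add: width_seg F_def)

text \<open>Segments are null sets, so the one-homogeneous part vanishes; the square spanned by
  \<open>e\<close> and \<open>perp e\<close> has positive area, which the parallelogram formula
  attributes to the coefficient alone.\<close>

lemma coef_area:
  assumes e: "e \<noteq> 0"
  shows "Phi2_functional.coef (area e) \<noteq> 0"
proof -
  interpret area: Phi2_functional "area e" by unfold_locales (rule Phi2_area[OF e])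
  have F: "area.F v = 0" for v
  proof -
    have "coords e ` seg v \<subseteq> span {coords e v}"
      by (auto simp: seg_def linear_scale[OF linear_coords] span_singleton)
    then have "dim (coords e ` seg v) \<le> card {coords e v}"
      by (intro dim_le_card) auto
    then have "negligible (coords e ` seg v)" by (intro negligible_lowdim) simp
    then show ?thesis unfolding area.F_def area_def by (rule negligible_imp_measure0)
  qed
  define Q where "Q = seg e + seg (perp e)"
  define B :: "(real \<times> real) set" where "B = box (-1, - (e \<bullet> e)) (1, e \<bullet> e)"
  have "B \<subseteq> coords e ` Q"
  proof clarify
    fix x y assume "(x, y) \<in> B"
    then have xy: "\<bar>x\<bar> \<le> 1" "\<bar>y / (e \<bullet> e)\<bar> \<le> 1"
      using e by (auto simp: B_def mem_box Basis_prod_def abs_divide inner_gt_zero_iff)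
    then have "x *\<^sub>R e \<in> seg e" "(y / (e \<bullet> e)) *\<^sub>R perp e \<in> seg (perp e)" unfolding mem_seg by blast+
    then have "x *\<^sub>R e + (y / (e \<bullet> e)) *\<^sub>R perp e \<in> Q" unfolding Q_def by (rule set_plus_intro)
    moreover have "perp e \<bullet> e = 0" by (simp add: inner_vec_def UNIV_2)
    then have "coords e (x *\<^sub>R e + (y / (e \<bullet> e)) *\<^sub>R perp e) = (x, y)"
      using e by (simp add: coords_def wedge_perp) (simp add: kappa_def)
    ultimately show "(x, y) \<in> coords e ` Q" by (metis image_eqI)
  qed
  then have "B \<subseteq> interior (coords e ` Q)"
    by (intro interior_maximal) (auto simp: B_def)
  moreover have "(0, 0) \<in> B"
    using e by (simp add: B_def mem_box Basis_prod_def inner_gt_zero_iff)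
  ultimately have "interior (coords e ` Q) \<noteq> {}" by blast
  moreover have "convex (coords e ` Q)" by (intro convex_coords) (simp add: Q_def convex_set_plus)
  ultimately have "\<not> negligible (coords e ` Q)" by (simp add: negligible_convex_interior)
  moreover have "coords e ` Q \<in> lmeasurable"
    by (intro lmeasurable_compact compact_coords) (simp add: Q_def)
  ultimately have "area e Q \<noteq> 0" by (simp add: area_def negligible_iff_measure)
  then show ?thesis unfolding Q_def area.parallelogram F by auto
qed

section \<open>Cavalieri's principle for chord lengths\<close>

context
  fixes X :: "(real ^ 2) set" and e :: "real ^ 2"
  assumes X: "compact X" "convex X" and e: "e \<noteq> 0"
begin

lemma profile_interval: "compact (profile X e s)" "convex (profile X e s)"
proof -
  have eq: "{y \<in> X. y + s *\<^sub>R e \<in> X} = X \<inter> (+) (- s *\<^sub>R e) ` X"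
    by (rule set_eqI) (simp only: mem_Collect_eq Int_iff mem_translate, simp)
  have "compact {y \<in> X. y + s *\<^sub>R e \<in> X}"
    unfolding eq using X by (intro compact_Int compact_translation)
  then show "compact (profile X e s)"
    unfolding profile_def by (intro compact_continuous_image continuous_intros)
  have "convex {y \<in> X. y + s *\<^sub>R e \<in> X}"
    unfolding eq using X by (intro convex_Int convex_translation)
  moreover have "linear (wedge e)" by (rule linearI) simp_all
  ultimately show "convex (profile X e s)"
    unfolding profile_def by (rule convex_linear_image[rotated])
qed

text \<open>The region that arises when every chord of the body parallel to \<open>e\<close> is
  shifted, in adapted coordinates, so as to start at \<open>0\<close>. Its slices at fixed
  \<open>s\<close> are the profiles.\<close>

definition chords :: "(real \<times> real) set" where
  "chords = {(s, t). 0 \<le> s \<and> t \<in> profile X e s}"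

lemma compact_chords: "compact chords"
proof -
  define P where "P = (X \<times> X) \<inter> {z. wedge e (fst z) = wedge e (snd z)} \<inter> {z. kappa e (fst z) \<le> kappa e (snd z)}"
  have "closed {z :: (real ^ 2) \<times> (real ^ 2). wedge e (fst z) = wedge e (snd z)}"
    "closed {z. kappa e (fst z) \<le> kappa e (snd z)}"
    by (intro closed_Collect_eq closed_Collect_le continuous_intros)+
  then have "compact P" unfolding P_def using X by (intro compact_Int_closed compact_Times)
  moreover have "chords = (\<lambda>z. (kappa e (snd z) - kappa e (fst z), wedge e (fst z))) ` P"
  proof
    show "chords \<subseteq> (\<lambda>z. (kappa e (snd z) - kappa e (fst z), wedge e (fst z))) ` P"
    proof clarify
      fix s t assume "(s, t) \<in> chords"
      then obtain y where y: "0 \<le> s" "y \<in> X" "y + s *\<^sub>R e \<in> X" "t = wedge e y"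
        by (auto simp: chords_def profile_def)
      then have "(y, y + s *\<^sub>R e) \<in> P" using e by (simp add: P_def)
      then show "(s, t) \<in> (\<lambda>z. (kappa e (snd z) - kappa e (fst z), wedge e (fst z))) ` P"
        using y e by (intro image_eqI[of _ _ "(y, y + s *\<^sub>R e)"]) auto
    qed
    show "(\<lambda>z. (kappa e (snd z) - kappa e (fst z), wedge e (fst z))) ` P \<subseteq> chords"
    proof clarify
      fix y z assume "(y, z) \<in> P"
      then have P: "y \<in> X" "z \<in> X" "wedge e y = wedge e z" "kappa e y \<le> kappa e z" by (auto simp: P_def)
      have "y + (kappa e z - kappa e y) *\<^sub>R e = z"
        using P e by (intro eq_if_kappa_wedge_eq[of e]) auto
      then show "(kappa e (snd (y, z)) - kappa e (fst (y, z)), wedge e (fst (y, z))) \<in> chords"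
        using P unfolding chords_def profile_def by (auto intro!: image_eqI[of _ _ y])
    qed
  qed
  ultimately show ?thesis
    by (auto intro!: compact_continuous_image continuous_intros)
qed

text \<open>At each height \<open>t\<close> the body has a slice \<open>{l..r}\<close> and
  \<open>chords\<close> the slice \<open>{0..r - l}\<close>, or both are empty.\<close>

lemma emeasure_chords: "emeasure lborel chords = emeasure lborel (coords e ` X)"
proof -
  let ?C = "coords e ` X"
  have C: "compact ?C" "convex ?C" using X by (simp_all add: compact_coords convex_coords)
  have mem_C: "(k, t) \<in> ?C \<longleftrightarrow> (\<exists>y\<in>X. kappa e y = k \<and> wedge e y = t)" for k t
    by (auto simp: coords_def image_iff)
  have slice: "emeasure lborel ((\<lambda>s. (s, t)) -` chords) = emeasure lborel ((\<lambda>k. (k, t)) -` ?C)" for t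
  proof -
    let ?I = "(\<lambda>k. (k, t)) -` ?C"
    have "(\<lambda>k. (k, t)) -` C = fst ` (C \<inter> {z. snd z = t})" for C :: "(real \<times> real) set" by force
    then have fst: "?I = fst ` (?C \<inter> {z. snd z = t})" .
    have "closed {z :: real \<times> real. snd z = t}" by (intro closed_Collect_eq continuous_intros)
    then have "compact (?C \<inter> {z. snd z = t})" using C by (intro compact_Int_closed)
    then have "compact ?I" unfolding fst by (intro compact_continuous_image continuous_intros)
    moreover have "convex {z :: real \<times> real. snd z = t}" 
      by (auto simp: convex_def simp flip: distrib_right)
    then have "convex (fst ` (?C \<inter> {z. snd z = t}))"
      using convex_Int[OF C(2)] by (intro convex_linear_image[OF bounded_linear.linear[OF bounded_linear_fst]]) blast
    then have "connected ?I" unfolding fst by (rule convex_connected)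
    ultimately obtain l r where I: "?I = {l..r}" using connected_compact_interval_1 by metis
    show ?thesis
    proof (cases "l \<le> r")
      case False
      then have "?I = {}" using I by simp
      have "(\<lambda>s. (s, t)) -` chords = {}"
      proof (rule ccontr)
        assume "(\<lambda>s. (s, t)) -` chords \<noteq> {}"
        then obtain s y where "y \<in> X" "t = wedge e y" by (auto simp: chords_def profile_def)
        then have "kappa e y \<in> ?I" by (auto simp: mem_C)
        then show False using \<open>?I = {}\<close> by blast
      qed
      then show ?thesis using \<open>?I = {}\<close> by simp
    next
      case True
      have "(\<lambda>s. (s, t)) -` chords = {0..r - l}"
      proof
        show "(\<lambda>s. (s, t)) -` chords \<subseteq> {0..r - l}"
        proof
          fix s assume "s \<in> (\<lambda>s. (s, t)) -` chords"
          then obtain y where y: "0 \<le> s" "y \<in> X" "y + s *\<^sub>R e \<in> X" "t = wedge e y"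
            by (auto simp: chords_def profile_def)
          then have "kappa e y \<in> ?I" by (auto simp: mem_C)
          moreover have "kappa e (y + s *\<^sub>R e) \<in> ?I" using y unfolding vimage_def mem_Collect_eq mem_C
            by (intro bexI[of _ "y + s *\<^sub>R e"]) auto
          ultimately show "s \<in> {0..r - l}" unfolding I using y e by simp
        qed
        show "{0..r - l} \<subseteq> (\<lambda>s. (s, t)) -` chords"
        proof
          fix s assume s: "s \<in> {0..r - l}"
          then have "l \<in> ?I" "l + s \<in> ?I" unfolding I using True by auto
          then obtain y z where "y \<in> X" "kappa e y = l" "wedge e y = t"
            "z \<in> X" "kappa e z = l + s" "wedge e z = t" by (auto simp: mem_C)
          moreover from this have "z = y + s *\<^sub>R e" using e by (intro eq_if_kappa_wedge_eq[of e]) auto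
          ultimately show "s \<in> (\<lambda>s. (s, t)) -` chords"
            using s by (auto simp: chords_def profile_def)
        qed
      qed
      then show ?thesis using I True by simp
    qed
  qed
  have "chords \<in> sets (lborel \<Otimes>\<^sub>M lborel)" "?C \<in> sets (lborel \<Otimes>\<^sub>M lborel)"
    unfolding lborel_prod using compact_chords C by (auto intro: borel_compact)
  then show ?thesis
    unfolding lborel_prod[symmetric] by (simp add: lborel_pair.emeasure_pair_measure_alt2 slice)
qed

text \<open>The measure of \<open>chords\<close> is computed by slicing in the other direction, at
  constant chord length.\<close>

lemma layer_cake:
  "ennreal (area e X) = (\<integral>\<^sup>+ s. emeasure lborel (if 0 \<le> s then profile X e s else {}) \<partial>lborel)"
  and layer_cake_measurable:
  "(\<lambda>s. emeasure lborel (if 0 \<le> s then profile X e s else {})) \<in> borel_measurable lborel"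
proof -
  have sets: "chords \<in> sets (lborel \<Otimes>\<^sub>M lborel)"
    unfolding lborel_prod using compact_chords by (auto intro: borel_compact)
  have slice: "Pair s -` chords = (if 0 \<le> s then profile X e s else {})" for s
    by (auto simp: chords_def)
  have C: "compact (coords e ` X)" using X by (simp add: compact_coords)
  have "area e X = measure lborel (coords e ` X)"
    unfolding area_def using C by (intro measure_completion) (auto intro: borel_compact)
  then have "ennreal (area e X) = emeasure lborel (coords e ` X)"
    using emeasure_compact_finite[OF C] by (simp add: emeasure_eq_ennreal_measure)
  also have "\<dots> = emeasure (lborel \<Otimes>\<^sub>M lborel) chords"
    by (simp add: emeasure_chords lborel_prod)
  also have "\<dots> = (\<integral>\<^sup>+ s. emeasure lborel (if 0 \<le> s then profile X e s else {}) \<partial>lborel)"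
    using lborel.emeasure_pair_measure_alt[OF sets] by (simp add: slice)
  finally show "ennreal (area e X) = (\<integral>\<^sup>+ s. emeasure lborel (if 0 \<le> s then profile X e s else {}) \<partial>lborel)" .
  show "(\<lambda>s. emeasure lborel (if 0 \<le> s then profile X e s else {})) \<in> borel_measurable lborel"
    using lborel.measurable_emeasure_Pair[OF sets] by (simp add: slice)
qed

end

lemma area_eq_imp_profile_eq:
  assumes X: "compact X" "convex X" and Y: "compact Y" "convex Y" and e: "e \<noteq> 0"
    and le: "\<And>s. 0 \<le> s \<Longrightarrow> emeasure lborel (profile X e s) \<le> emeasure lborel (profile Y e s)"
    and eq: "area e X = area e Y"
  shows "AE s in lborel. 0 \<le> s \<longrightarrow> emeasure lborel (profile X e s) = emeasure lborel (profile Y e s)"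
proof -
  let ?f = "\<lambda>X s. emeasure lborel (if 0 \<le> s then profile X e s else {})"
  have "\<not> (\<integral>\<^sup>+ s. ?f X s \<partial>lborel) < (\<integral>\<^sup>+ s. ?f Y s \<partial>lborel)"
    using eq by (simp flip: layer_cake[OF X e] layer_cake[OF Y e])
  moreover have "(\<integral>\<^sup>+ s. ?f X s \<partial>lborel) \<noteq> \<infinity>" by (simp flip: layer_cake[OF X e])
  moreover have "AE s in lborel. ?f X s \<le> ?f Y s" using le by (intro AE_I2) auto
  ultimately have "AE s in lborel. ?f Y s \<le> ?f X s"
    using nn_integral_less[OF layer_cake_measurable[OF X e] layer_cake_measurable[OF Y e]] by blast
  then show ?thesis
  proof eventually_elim
    case (elim s)
    then show ?case using le[of s] by (auto intro: antisym)
  qed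
qed

lemma profile_eq_imp_area_eq:
  assumes X: "compact X" "convex X" and Y: "compact Y" "convex Y" and e: "e \<noteq> 0"
    and eq: "\<And>s. 0 < s \<Longrightarrow> s \<noteq> s\<^sub>0 \<Longrightarrow> emeasure lborel (profile X e s) = emeasure lborel (profile Y e s)"
  shows "area e X = area e Y"
proof -
  have "AE s in lborel. s \<noteq> 0 \<and> s \<noteq> s\<^sub>0"
    using AE_lborel_singleton[of 0] AE_lborel_singleton[of s\<^sub>0] by (rule AE_conjI)
  then have "ennreal (area e X) = ennreal (area e Y)"
    unfolding layer_cake[OF X e] layer_cake[OF Y e]
    by (intro nn_integral_cong_AE) (auto simp: eq)
  then show ?thesis by (simp add: area_def)
qed

section \<open>Information contained in the covariogram\<close>

lemma mem_central: "z \<in> central A \<longleftrightarrow> (\<exists>a\<in>A. \<exists>b\<in>A. z = (1 / 2) *\<^sub>R (a - b))"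
  unfolding central_def mean_def set_plus_def by (auto simp: image_iff)

lemma compact_central: "compact A \<Longrightarrow> compact (central A)"
  and convex_central: "convex A \<Longrightarrow> convex (central A)"
  by (simp_all add: central_def compact_mean convex_mean compact_negations convex_negations)

lemma central_symmetric_eq:
  assumes "convex A" "uminus ` A = A"
  shows "central A = A"
proof
  show "central A \<subseteq> A"
  proof
    fix z assume "z \<in> central A"
    then obtain a b where ab: "a \<in> A" "b \<in> A" "z = (1 / 2) *\<^sub>R (a - b)" by (auto simp: mem_central)
    then have "- b \<in> A" using assms by blast
    then have "(1 / 2) *\<^sub>R a + (1 / 2) *\<^sub>R (- b) \<in> A" using assms ab(1) by (intro convexD) auto
    then show "z \<in> A" by (simp add: ab(3) algebra_simps)
  qed
  show "A \<subseteq> central A"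
  proof
    fix a assume "a \<in> A"
    then have "- a \<in> A" using assms by blast
    have "a = (1 / 2) *\<^sub>R (a - (- a))" by (simp flip: scaleR_2)
    then show "a \<in> central A" unfolding mem_central using \<open>a \<in> A\<close> \<open>- a \<in> A\<close> by blast
  qed
qed

section \<open>Positivity and the support of the covariogram\<close>

context Phi2_functional
begin

text \<open>By monotonicity the vanishing on one square kills \<open>F\<close> on both axes, and
  then the coefficient; so \<open>\<phi>\<close> vanishes on all squares with these axes, and every
  compact set lies in one.\<close>

lemma square_0_imp_0:
  assumes s: "0 < s" and zero: "\<phi> (seg (s *\<^sub>R axis 1 1) + seg (s *\<^sub>R axis 2 1)) = 0"
    and B: "compact B" "convex B"
  shows "\<phi> B = 0"
proof -
  let ?u = "axis 1 1 :: real ^ 2" and ?v = "axis 2 1 :: real ^ 2"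
  have w: "wedge ?u ?v = 1" by (simp add: wedge_def axis_def)
  have "seg (s *\<^sub>R ?u) \<subseteq> seg (s *\<^sub>R ?u) + seg (s *\<^sub>R ?v)" by (rule plus_seg_subset)
  moreover have "seg (s *\<^sub>R ?v) \<subseteq> seg (s *\<^sub>R ?u) + seg (s *\<^sub>R ?v)"
    unfolding add.commute[of "seg (s *\<^sub>R ?u)"] by (rule plus_seg_subset)
  ultimately have "\<phi> (seg (s *\<^sub>R ?u)) \<le> 0" "\<phi> (seg (s *\<^sub>R ?v)) \<le> 0"
    unfolding zero[symmetric] by (intro mono convex_set_plus; simp)+
  then have "F (s *\<^sub>R ?u) \<le> 0" "F (s *\<^sub>R ?v) \<le> 0" by (simp_all add: F_def)
  then have "s * F ?u \<le> 0" "s * F ?v \<le> 0" using s by (simp_all add: F_scale)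
  then have F: "F ?u = 0" "F ?v = 0"
    using s F_nonneg[of ?u] F_nonneg[of ?v] by (auto simp: mult_le_0_iff)
  then have coef: "coef = 0" using zero s w by (simp add: parallelogram F_scale)
  obtain M where M: "\<And>b. b \<in> B \<Longrightarrow> norm b \<le> M" using B by (metis bounded_iff compact_imp_bounded)
  define m where "m = max M 1"
  have "B \<subseteq> seg (m *\<^sub>R ?u) + seg (m *\<^sub>R ?v)"
  proof
    fix b assume "b \<in> B"
    then have le: "\<bar>b $ i\<bar> \<le> m" for i using M[of b] component_le_norm_cart[of b i] by (auto simp: m_def)
    have m: "0 < m" by (simp add: m_def)
    have "\<bar>b $ 1 / m\<bar> \<le> 1" "\<bar>b $ 2 / m\<bar> \<le> 1" using le m by (auto simp: abs_divide)
    then have "(b $ 1 / m) *\<^sub>R m *\<^sub>R ?u \<in> seg (m *\<^sub>R ?u)" "(b $ 2 / m) *\<^sub>R m *\<^sub>R ?v \<in> seg (m *\<^sub>R ?v)"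
      unfolding mem_seg by blast+
    then have "(b $ 1 / m) *\<^sub>R m *\<^sub>R ?u + (b $ 2 / m) *\<^sub>R m *\<^sub>R ?v \<in> seg (m *\<^sub>R ?u) + seg (m *\<^sub>R ?v)"
      by (rule set_plus_intro)
    moreover have "(b $ 1 / m) *\<^sub>R m *\<^sub>R ?u + (b $ 2 / m) *\<^sub>R m *\<^sub>R ?v = b"
      using m by (simp add: vec_eq_iff forall_2 axis_def)
    ultimately show "b \<in> seg (m *\<^sub>R ?u) + seg (m *\<^sub>R ?v)" by simp
  qed
  then have "\<phi> B \<le> \<phi> (seg (m *\<^sub>R ?u) + seg (m *\<^sub>R ?v))"
    using B by (intro mono) (auto simp: convex_set_plus)
  also have "\<dots> = 0" by (simp add: parallelogram F_scale F coef)
  finally show ?thesis using nonneg[OF B] by simp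
qed

lemma pos_if_interior:
  assumes nonzero: "\<not> zero_functional \<phi>" and A: "compact A" "convex A" "interior A \<noteq> {}"
  shows "0 < \<phi> A"
proof (rule ccontr)
  assume "\<not> 0 < \<phi> A"
  then have "\<phi> A = 0" using nonneg[OF A(1,2)] by simp
  obtain x r where r: "0 < r" "cball x r \<subseteq> A" using A(3) by (meson ex_in_conv mem_interior_cball)
  let ?u = "(r / 2) *\<^sub>R axis 1 1 :: real ^ 2" and ?v = "(r / 2) *\<^sub>R axis 2 1 :: real ^ 2"
  have "(+) x ` (seg ?u + seg ?v) \<subseteq> A"
  proof
    fix y assume "y \<in> (+) x ` (seg ?u + seg ?v)"
    then obtain a b where ab: "\<bar>a\<bar> \<le> 1" "\<bar>b\<bar> \<le> 1" "y = x + (a *\<^sub>R ?u + b *\<^sub>R ?v)"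
      unfolding set_plus_def by (auto simp: mem_seg)
    have "dist x y = norm (y - x)" by (simp add: dist_norm norm_minus_commute)
    also have "\<dots> = norm (a *\<^sub>R ?u + b *\<^sub>R ?v)" by (simp add: ab(3))
    also have "\<dots> \<le> norm (a *\<^sub>R ?u) + norm (b *\<^sub>R ?v)" by (rule norm_triangle_ineq)
    also have "\<dots> = \<bar>a\<bar> * (r / 2) + \<bar>b\<bar> * (r / 2)" using r by (simp add: norm_axis_1 abs_mult)
    also have "\<dots> \<le> 1 * (r / 2) + 1 * (r / 2)" using ab r by (intro add_mono mult_right_mono) auto
    finally have "y \<in> cball x r" by (simp add: mem_cball)
    then show "y \<in> A" using r by blast
  qed
  then have "\<phi> ((+) x ` (seg ?u + seg ?v)) \<le> \<phi> A"
    using A by (intro mono convex_translation compact_translation) (auto simp: convex_set_plus)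
  then have "\<phi> (seg ?u + seg ?v) = 0"
    using translate[of "seg ?u + seg ?v" x] nonneg[of "seg ?u + seg ?v"] \<open>\<phi> A = 0\<close> by (simp add: convex_set_plus)
  then have "\<phi> B = 0" if "compact B" "convex B" for B
    using square_0_imp_0[of "r / 2" B] r that by simp
  then show False using nonzero by (auto simp: zero_functional_def compact_convex_sets_def)
qed

text \<open>If \<open>x\<close> is a slightly shrunken difference of points of \<open>K\<close>,
  then \<open>K \<inter> (K + x)\<close> has interior points and a positive value; so
  \<open>H \<inter> (H + x)\<close> is nonempty and \<open>x\<close> is a difference of points of
  \<open>H\<close>. As \<open>central H\<close> is closed, letting the shrinking tend to zero
  reaches all differences.\<close>

lemma covariogram_eq_imp_central_subset:
  assumes nonzero: "\<not> zero_functional \<phi>" and K: "compact K" "convex K" "interior K \<noteq> {}"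
    and H: "compact H" "convex H" and eq: "covariogram \<phi> H = covariogram \<phi> K"
  shows "central K \<subseteq> central H"
proof
  fix z assume "z \<in> central K"
  then obtain a b where ab: "a \<in> K" "b \<in> K" "z = (1 / 2) *\<^sub>R (a - b)" by (auto simp: mem_central)
  obtain c where c: "c \<in> interior K" using K by blast
  have "(1 - \<epsilon>) *\<^sub>R z \<in> central H" if \<epsilon>: "0 < \<epsilon>" "\<epsilon> \<le> 1" for \<epsilon>
  proof -
    define x where "x = (1 - \<epsilon>) *\<^sub>R (a - b)"
    define p where "p = a - \<epsilon> *\<^sub>R (a - c)"
    have p: "p \<in> interior K" "p - x \<in> interior K"
    proof -
      show "p \<in> interior K" unfolding p_def by (rule mem_interior_convex_shrink[OF K(2) c ab(1) \<epsilon>])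
      have "p - x = b - \<epsilon> *\<^sub>R (b - c)" by (simp add: p_def x_def algebra_simps)
      then show "p - x \<in> interior K" using mem_interior_convex_shrink[OF K(2) c ab(2) \<epsilon>] by simp
    qed
    have "p \<in> interior K \<inter> (+) x ` interior K" using p by (simp only: Int_iff mem_translate)
    moreover have "interior K \<inter> (+) x ` interior K \<subseteq> interior (K \<inter> (+) x ` K)"
      by (simp add: interior_translation)
    ultimately have "interior (K \<inter> (+) x ` K) \<noteq> {}" by blast
    then have "0 < \<phi> (K \<inter> (+) x ` K)"
      using K by (intro pos_if_interior nonzero compact_Int convex_Int compact_translation convex_translation)
    moreover have "\<phi> (H \<inter> (+) x ` H) = \<phi> (K \<inter> (+) x ` K)"
      using fun_cong[OF eq, of x] by (simp add: covariogram_def)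
    ultimately have "H \<inter> (+) x ` H \<noteq> {}" by auto
    then obtain y where "y \<in> H" "y - x \<in> H" unfolding ex_in_conv[symmetric] Int_iff mem_translate by blast
    moreover have "(1 - \<epsilon>) *\<^sub>R z = (1 / 2) *\<^sub>R (y - (y - x))" by (simp add: x_def ab(3))
    ultimately show ?thesis unfolding mem_central by blast
  qed
  then have mem: "(1 - 1 / real (Suc n)) *\<^sub>R z \<in> central H" for n by simp
  have lim: "(\<lambda>n. (1 - 1 / real (Suc n)) *\<^sub>R z) \<longlonglongrightarrow> (1 - 0) *\<^sub>R z"
    by (intro tendsto_intros LIMSEQ_Suc[OF lim_1_over_n])
  have "(1 - 0) *\<^sub>R z \<in> central H"
    by (rule closed_sequentially[OF compact_imp_closed[OF compact_central[OF H(1)]] _ lim]) (rule mem)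
  then show "z \<in> central H" by simp
qed

section \<open>The case of coefficient zero\<close>

lemma F_triangle:
  assumes "coef = 0"
  shows "F (a + b) \<le> F a + F b"
proof -
  \<comment> \<open>The segment is a diagonal of the parallelogram, whose value is
    \<open>F a + F b\<close> when the coefficient vanishes.\<close>
  have "seg (a + b) \<subseteq> seg a + seg b"
  proof
    fix y assume "y \<in> seg (a + b)"
    then obtain t where "\<bar>t\<bar> \<le> 1" "y = t *\<^sub>R a + t *\<^sub>R b" by (auto simp: mem_seg scaleR_add_right)
    then show "y \<in> seg a + seg b" by (auto simp: mem_seg intro!: set_plus_intro)
  qed
  then have "F (a + b) \<le> \<phi> (seg a + seg b)"
    unfolding F_def by (intro mono convex_set_plus) auto
  then show ?thesis by (simp add: parallelogram assms)
qed

text \<open>A direction in which the seminorm \<open>F\<close> is minimal among unit vectors is an extreme direction of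
  its unit ball.\<close>

lemma strict_direction:
  assumes coef: "coef = 0" and nonzero: "\<not> zero_functional \<phi>"
  obtains e where "e \<noteq> 0"
    "\<And>a b. wedge e a \<noteq> 0 \<Longrightarrow> wedge e (a + b) = 0 \<Longrightarrow> F (a + b) < F a + F b"
proof -
  let ?u = "axis 1 1 :: real ^ 2" and ?v = "axis 2 1 :: real ^ 2"
  have F_zero: False if "\<And>v. F v = 0"
  proof -
    have "\<phi> (seg (1 *\<^sub>R ?u) + seg (1 *\<^sub>R ?v)) = 0" by (simp add: parallelogram coef that)
    then have "\<phi> B = 0" if "compact B" "convex B" for B using square_0_imp_0[of 1 B] that by simp
    then show False using nonzero by (auto simp: zero_functional_def compact_convex_sets_def)
  qed
  define M where "M = F ?u + F ?v"
  have F_le: "F v \<le> M * norm v" for v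
  proof -
    have "v = (v $ 1) *\<^sub>R ?u + (v $ 2) *\<^sub>R ?v" by (simp add: vec_eq_iff forall_2 axis_def)
    then have "F v \<le> F ((v $ 1) *\<^sub>R ?u) + F ((v $ 2) *\<^sub>R ?v)" using F_triangle[OF coef] by metis
    also have "\<dots> = \<bar>v $ 1\<bar> * F ?u + \<bar>v $ 2\<bar> * F ?v" by (simp add: F_scale)
    also have "\<dots> \<le> norm v * F ?u + norm v * F ?v"
      by (intro add_mono mult_right_mono component_le_norm_cart F_nonneg)
    finally show ?thesis by (simp add: M_def algebra_simps)
  qed
  have "continuous_on (sphere 0 1) F"
  proof (rule continuous_on_subset[of UNIV])
    have "M-lipschitz_on UNIV F"
    proof (rule lipschitz_onI)
      fix x y
      have "F x \<le> F y + F (x - y)" using F_triangle[OF coef, of y "x - y"] by simp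
      moreover have "F y \<le> F x + F (x - y)"
        using F_triangle[OF coef, of x "y - x"] F_scale[of "- 1" "x - y"] by simp
      ultimately show "dist (F x) (F y) \<le> M * dist x y"
        using F_le[of "x - y"] by (simp add: dist_norm)
    qed (simp add: M_def F_nonneg)
    then show "continuous_on UNIV F" by (rule lipschitz_on_continuous_on)
  qed simp
  moreover have "sphere (0 :: real ^ 2) 1 \<noteq> {}" by simp
  ultimately obtain e where e: "e \<in> sphere 0 1" "\<And>v. v \<in> sphere 0 1 \<Longrightarrow> F e \<le> F v"
    using continuous_attains_inf[OF compact_sphere] by blast
  then have e_norm: "norm e = 1" by simp
  then have "e \<noteq> 0" by auto
  have F_ge: "F e * norm v \<le> F v" for v
  proof (cases "v = 0")
    case True then show ?thesis by (simp add: F_nonneg)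
  next
    case False
    then have "F e \<le> F ((1 / norm v) *\<^sub>R v)" by (intro e) simp
    then show ?thesis using False by (simp add: F_scale field_simps)
  qed
  show ?thesis
  proof (rule that[OF \<open>e \<noteq> 0\<close>])
    fix a b assume a: "wedge e a \<noteq> 0" and ab: "wedge e (a + b) = 0"
    have "wedge (a + b) e = 0" using ab wedge_commute[of "a + b" e] by simp
    then obtain t where t: "a + b = t *\<^sub>R e" using wedge_eq_0_iff[OF \<open>e \<noteq> 0\<close>] by blast
    have F_ab: "F (a + b) = F e * norm (a + b)" by (simp add: t F_scale e_norm mult.commute)
    show "F (a + b) < F a + F b"
    proof (cases "F e = 0")
      case False
      then have pos: "0 < F e" using F_nonneg[of e] by simp
      \<comment> \<open>Strictness comes from the Euclidean norm: equality would make
        \<open>a\<close> and \<open>b\<close> parallel with the same orientation, against their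
        opposite nonzero heights.\<close>
      have "norm (a + b) \<noteq> norm a + norm b"
      proof
        assume "norm (a + b) = norm a + norm b"
        then have "norm a *\<^sub>R b = norm b *\<^sub>R a" by (simp add: norm_triangle_eq)
        then have "wedge e (norm a *\<^sub>R b) = wedge e (norm b *\<^sub>R a)" by simp
        then have "norm a * wedge e b = norm b * wedge e a" by simp
        moreover have "wedge e b = - wedge e a" using ab by simp
        ultimately have "(norm a + norm b) * wedge e a = 0" by (simp add: algebra_simps)
        then have "norm a + norm b = 0" using a by simp
        then have "a = 0" using norm_ge_zero[of a] norm_ge_zero[of b] by (simp add: add_nonneg_eq_0_iff)
        then show False using a by simp
      qed
      then have "norm (a + b) < norm a + norm b" using norm_triangle_ineq[of a b] by simp
      then have "F (a + b) < F e * (norm a + norm b)" using pos by (simp add: F_ab)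
      also have "\<dots> \<le> F a + F b" using F_ge[of a] F_ge[of b] by (simp add: algebra_simps)
      finally show ?thesis .
    next
      case True
      \<comment> \<open>Here \<open>F (a + b) = 0\<close>, and \<open>F a = 0\<close> would make
        \<open>F\<close> vanish on the span of \<open>e\<close> and \<open>a\<close>, that is,
        everywhere.\<close>
      have "F a \<noteq> 0"
      proof
        assume "F a = 0"
        have "F v = 0" for v
        proof -
          define \<beta> where "\<beta> = wedge e v / wedge e a"
          have "v = (kappa e v - \<beta> * kappa e a) *\<^sub>R e + \<beta> *\<^sub>R a"
            using a \<open>e \<noteq> 0\<close> by (intro eq_if_kappa_wedge_eq[of e]) (auto simp: \<beta>_def)
          then have "F v \<le> F ((kappa e v - \<beta> * kappa e a) *\<^sub>R e) + F (\<beta> *\<^sub>R a)"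
            using F_triangle[OF coef] by metis
          also have "\<dots> = 0" by (simp add: F_scale True \<open>F a = 0\<close>)
          finally show ?thesis using F_nonneg[of v] by simp
        qed
        then show False by (rule F_zero)
      qed
      then show ?thesis using F_nonneg[of a] F_nonneg[of b] True by (simp add: F_ab)
    qed
  qed
qed

text \<open>If \<open>B\<close> were strictly higher than \<open>L\<close>, then it would contain a triangle over the horizontal chord
  of \<open>B\<close> at the top level of \<open>L\<close>, and cutting it off would strictly decrease \<open>\<phi>\<close>.\<close>

lemma height_le_if_eq:
  assumes coef: "coef = 0" and e: "e \<noteq> 0"
    and strict: "\<And>a b. wedge e a \<noteq> 0 \<Longrightarrow> wedge e (a + b) = 0 \<Longrightarrow> F (a + b) < F a + F b"
    and L: "compact L" "convex L" "L \<noteq> {}" and B: "compact B" "convex B"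
    and "L \<subseteq> B" and eq: "\<phi> L = \<phi> B" and y: "y \<in> B"
  shows "\<exists>z\<in>L. wedge e y \<le> wedge e z"
proof (rule ccontr)
  assume "\<not> ?thesis"
  then have lower: "wedge e z < wedge e y" if "z \<in> L" for z using that by force
  have "continuous_on L (wedge e)" by (intro continuous_intros)
  then obtain z where z: "z \<in> L" "\<And>x. x \<in> L \<Longrightarrow> wedge e x \<le> wedge e z"
    using continuous_attains_sup[OF L(1,3)] by blast
  define h where "h = wedge e z"
  have closed: "closed {x. wedge e x \<le> h}" "closed {x. h \<le> wedge e x}"
    by (intro closed_Collect_le continuous_intros)+
  have lin: "linear (wedge e)" by (rule linearI) simp_all
  have convex: "convex {x. wedge e x \<le> h}" "convex {x. h \<le> wedge e x}"
    using convex_linear_vimage[OF lin convex_real_interval(2)[of h]] convex_linear_vimage[OF lin convex_real_interval(1)[of h]]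
    by (simp_all add: vimage_def)
  \<comment> \<open>Cut \<open>B\<close> at the top level \<open>h\<close> of \<open>L\<close>: the
    lower part still contains \<open>L\<close>, so the value of the upper part does not exceed that
    of the common chord \<open>C\<close>.\<close>
  define B1 B2 C where "B1 = B \<inter> {x. wedge e x \<le> h}" and "B2 = B \<inter> {x. h \<le> wedge e x}" and "C = B1 \<inter> B2"
  have B1: "compact B1" "convex B1" and B2: "compact B2" "convex B2"
    using B closed convex by (auto simp: B1_def B2_def compact_Int_closed convex_Int)
  have C: "compact C" "convex C" using B1 B2 by (auto simp: C_def compact_Int convex_Int)
  have "B1 \<union> B2 = B" by (auto simp: B1_def B2_def)
  then have "\<phi> B = \<phi> B1 + \<phi> B2 - \<phi> C" using union[OF B1 B2] B by (simp add: C_def)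
  moreover have "\<phi> B \<le> \<phi> B1"
    unfolding eq[symmetric] using L B1 \<open>L \<subseteq> B\<close> z by (intro mono) (auto simp: B1_def h_def)
  ultimately have B2_le: "\<phi> B2 \<le> \<phi> C" by simp
  have mem_C: "x \<in> C \<longleftrightarrow> x \<in> B \<and> wedge e x = h" for x by (auto simp: C_def B1_def B2_def)
  then have "C \<noteq> {}" using z \<open>L \<subseteq> B\<close> by (auto simp: h_def)
  have cont: "continuous_on C (kappa e)" by (intro continuous_intros)
  obtain c1 where c1: "c1 \<in> C" "\<And>x. x \<in> C \<Longrightarrow> kappa e c1 \<le> kappa e x"
    using continuous_attains_inf[OF C(1) \<open>C \<noteq> {}\<close> cont] by blast
  obtain c2 where c2: "c2 \<in> C" "\<And>x. x \<in> C \<Longrightarrow> kappa e x \<le> kappa e c2"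
    using continuous_attains_sup[OF C(1) \<open>C \<noteq> {}\<close> cont] by blast
  \<comment> \<open>\<open>c0\<close> is the midpoint and \<open>c\<close> the half-vector of the
    chord \<open>[c1, c2]\<close>; \<open>a\<close> and \<open>b\<close> are half the other sides of
    the triangle \<open>c1, y, c2\<close>.\<close>
  define c0 c a b where "c0 = (1/2) *\<^sub>R (c1 + c2)" and "c = (1/2) *\<^sub>R (c2 - c1)"
    and "a = (1/2) *\<^sub>R (y - c1)" and "b = (1/2) *\<^sub>R (c2 - y)"
  have ab: "a + b = c" by (simp add: a_def b_def c_def flip: scaleR_add_right)
  have wc: "wedge e c1 = h" "wedge e c2 = h" using c1 c2 by (simp_all add: mem_C)
  define w where "w = wedge e a"
  have w: "0 < w" "wedge e b = - w" "wedge e c = 0" "wedge e c0 = h"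
  proof -
    have "w = (1/2) * (wedge e y - h)" "wedge e b = (1/2) * (h - wedge e y)"
      "wedge e c = (1/2) * (h - h)" "wedge e c0 = (1/2) * (h + h)"
      using wc by (simp_all add: w_def a_def b_def c_def c0_def)
    then show "0 < w" "wedge e b = - w" "wedge e c = 0" "wedge e c0 = h"
      using lower[OF z(1)] by (simp_all add: h_def)
  qed
  have "C \<subseteq> (+) c0 ` seg c"
  proof
    fix x assume x: "x \<in> C"
    define \<tau> where "\<tau> = (kappa e x - kappa e c0) / kappa e c"
    have kappa_c: "kappa e c = (1/2) * (kappa e c2 - kappa e c1)" "kappa e c0 = (1/2) * (kappa e c1 + kappa e c2)"
      by (simp_all add: c_def c0_def)
    have "kappa e c1 \<le> kappa e x" "kappa e x \<le> kappa e c2" using c1 c2 x by auto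
    then have le: "\<bar>kappa e x - kappa e c0\<bar> \<le> kappa e c" unfolding kappa_c abs_le_iff by (simp add: field_simps)
    then have "\<bar>\<tau>\<bar> \<le> 1" "\<tau> * kappa e c = kappa e x - kappa e c0"
      by (cases "kappa e c = 0"; simp add: \<tau>_def abs_divide)+
    moreover from this have "x = c0 + \<tau> *\<^sub>R c"
      using e w x by (intro eq_if_kappa_wedge_eq[of e]) (auto simp: mem_C)
    moreover have "\<tau> *\<^sub>R c \<in> seg c" unfolding mem_seg using \<open>\<bar>\<tau>\<bar> \<le> 1\<close> by blast
    ultimately show "x \<in> (+) c0 ` seg c" by blast
  qed
  then have "\<phi> C \<le> \<phi> ((+) c0 ` seg c)" using C by (intro mono convex_translation compact_translation) auto
  then have "\<phi> C \<le> F c" by (simp add: translate F_def)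
  \<comment> \<open>The parallelogram has the diagonal \<open>[-c, c]\<close>, and its upper half
    \<open>T\<close> is the triangle translated by \<open>- c0\<close>; evenness expresses the value
    of \<open>P\<close> through \<open>T\<close>.\<close>
  define P T where "P = seg a + seg b" and "T = P \<inter> {x. 0 \<le> wedge e x}"
  have P: "compact P" "convex P" by (simp_all add: P_def convex_set_plus)
  have mem_P: "x \<in> P \<longleftrightarrow> (\<exists>\<alpha> \<beta>. \<bar>\<alpha>\<bar> \<le> 1 \<and> \<bar>\<beta>\<bar> \<le> 1 \<and> x = \<alpha> *\<^sub>R a + \<beta> *\<^sub>R b)" for x
  proof
    assume "x \<in> P"
    then obtain a' b' where "a' \<in> seg a" "b' \<in> seg b" "x = a' + b'" unfolding P_def by (rule set_plus_elim)
    then show "\<exists>\<alpha> \<beta>. \<bar>\<alpha>\<bar> \<le> 1 \<and> \<bar>\<beta>\<bar> \<le> 1 \<and> x = \<alpha> *\<^sub>R a + \<beta> *\<^sub>R b" unfolding mem_seg by auto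
  next
    assume "\<exists>\<alpha> \<beta>. \<bar>\<alpha>\<bar> \<le> 1 \<and> \<bar>\<beta>\<bar> \<le> 1 \<and> x = \<alpha> *\<^sub>R a + \<beta> *\<^sub>R b"
    then obtain \<alpha> \<beta> where x: "\<bar>\<alpha>\<bar> \<le> 1" "\<bar>\<beta>\<bar> \<le> 1" "x = \<alpha> *\<^sub>R a + \<beta> *\<^sub>R b" by blast
    have "\<alpha> *\<^sub>R a \<in> seg a" "\<beta> *\<^sub>R b \<in> seg b" unfolding mem_seg using x(1,2) by blast+
    then show "x \<in> P" unfolding P_def x(3) by (rule set_plus_intro)
  qed
  have P_minus: "- x \<in> P" if "x \<in> P" for x
  proof -
    obtain \<alpha> \<beta> where "\<bar>\<alpha>\<bar> \<le> 1" "\<bar>\<beta>\<bar> \<le> 1" "x = \<alpha> *\<^sub>R a + \<beta> *\<^sub>R b"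
      using \<open>x \<in> P\<close> unfolding mem_P by blast
    then have "\<bar>- \<alpha>\<bar> \<le> 1 \<and> \<bar>- \<beta>\<bar> \<le> 1 \<and> - x = (- \<alpha>) *\<^sub>R a + (- \<beta>) *\<^sub>R b" by simp
    then show ?thesis unfolding mem_P by blast
  qed
  have "closed {x. 0 \<le> wedge e x}" by (intro closed_Collect_le continuous_intros)
  moreover have "convex {x. 0 \<le> wedge e x}"
    using convex_linear_vimage[OF lin convex_real_interval(1)[of 0]] by (simp add: vimage_def)
  ultimately have T: "compact T" "convex T" using P by (auto simp: T_def compact_Int_closed convex_Int)
  have T_Un: "T \<union> uminus ` T = P"
  proof
    show "P \<subseteq> T \<union> uminus ` T"
    proof
      fix x assume x: "x \<in> P"
      show "x \<in> T \<union> uminus ` T"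
      proof (cases "0 \<le> wedge e x")
        case False
        then have "- x \<in> T" using P_minus[OF x] by (simp add: T_def)
        then show ?thesis by (intro UnI2 image_eqI[of _ _ "- x"]) auto
      qed (use x in \<open>simp add: T_def\<close>)
    qed
  qed (use P_minus in \<open>auto simp: T_def\<close>)
  have T_Int: "T \<inter> uminus ` T \<subseteq> seg c"
  proof
    fix x assume "x \<in> T \<inter> uminus ` T"
    then have "x \<in> P" "wedge e x = 0" by (auto simp: T_def)
    from this(1) obtain \<alpha> \<beta> where x: "\<bar>\<alpha>\<bar> \<le> 1" "x = \<alpha> *\<^sub>R a + \<beta> *\<^sub>R b" unfolding mem_P by blast
    then have "(\<alpha> - \<beta>) * w = 0" using \<open>wedge e x = 0\<close> w by (simp add: w_def[symmetric] algebra_simps)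
    then have "\<alpha> = \<beta>" using w by simp
    then have "x = \<alpha> *\<^sub>R c" using x by (simp add: ab flip: scaleR_add_right)
    then show "x \<in> seg c" unfolding mem_seg using x(1) by blast
  qed
  \<comment> \<open>With \<open>\<phi> T \<le> F c\<close> and the value \<open>F c\<close> of the
    common part this gives \<open>F a + F b \<le> F c\<close>, against strictness.\<close>
  have "\<phi> P = 2 * \<phi> T - \<phi> (T \<inter> uminus ` T)"
    using union[of T "uminus ` T"] T P by (simp add: T_Un compact_negations convex_negations even)
  moreover have "\<phi> (T \<inter> uminus ` T) \<le> F c"
    unfolding F_def using T T_Int by (intro mono) (auto simp: compact_Int convex_Int compact_negations convex_negations)
  moreover have "0 \<le> \<phi> (T \<inter> uminus ` T)"
    using T by (intro nonneg) (auto simp: compact_Int convex_Int compact_negations convex_negations)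
  moreover have "\<phi> P = F a + F b" by (simp add: P_def parallelogram coef)
  moreover have "\<phi> T \<le> F c"
  proof -
    have "(+) c0 ` T \<subseteq> B2"
    proof
      fix x assume "x \<in> (+) c0 ` T"
      then obtain x' where x': "x' \<in> T" "x = c0 + x'" by blast
      from x'(1) have "x' \<in> P" by (simp add: T_def)
      then obtain \<alpha> \<beta> where \<alpha>\<beta>: "\<bar>\<alpha>\<bar> \<le> 1" "\<bar>\<beta>\<bar> \<le> 1" "x' = \<alpha> *\<^sub>R a + \<beta> *\<^sub>R b"
        unfolding mem_P by blast
      have "0 \<le> (\<alpha> - \<beta>) * w" using x' \<alpha>\<beta> w by (simp add: T_def w_def[symmetric] algebra_simps)
      then have "\<beta> \<le> \<alpha>" using w by (simp add: zero_le_mult_iff)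
      define B' where "B' = (+) (- c0) ` B2"
      have "convex B'" unfolding B'_def using B2 by (intro convex_translation)
      moreover have "c \<in> B'" "- c \<in> B'" "a - b \<in> B'"
      proof -
        have "c0 + c = c2" "c0 - c = c1" "c0 + (a - b) = y"
          by (simp_all add: c0_def c_def a_def b_def vec_eq_iff field_simps)
        moreover have "c1 \<in> B2" "c2 \<in> B2" using c1 c2 by (auto simp: C_def)
        moreover have "y \<in> B2" using y lower[OF z(1)] by (simp add: B2_def h_def)
        ultimately show "c \<in> B'" "- c \<in> B'" "a - b \<in> B'"
          unfolding B'_def mem_translate by (simp_all add: add.commute[of _ c0])
      qed
      ultimately have "((\<alpha> - \<beta>) / 2) *\<^sub>R (a - b) + ((\<alpha> + \<beta>) / 2) *\<^sub>R c \<in> B'"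
        using \<alpha>\<beta> \<open>\<beta> \<le> \<alpha>\<close> by (intro convex_mem_chord) (auto simp: abs_le_iff field_simps)
      also have "((\<alpha> - \<beta>) / 2) *\<^sub>R (a - b) + ((\<alpha> + \<beta>) / 2) *\<^sub>R c = x'"
        unfolding ab[symmetric] \<alpha>\<beta>(3)
by (simp add: vec_eq_iff field_simps)
      finally show "x \<in> B2" unfolding B'_def mem_translate using x' by (simp add: add.commute)
    qed
    then have "\<phi> ((+) c0 ` T) \<le> \<phi> B2" using T B2 by (intro mono convex_translation compact_translation)
    then show ?thesis using B2_le \<open>\<phi> C \<le> F c\<close> T by (simp add: translate)
  qed
  moreover have "F c < F a + F b" using strict[of a b] w by (simp add: ab w_def[symmetric])
  moreover have "F c \<le> \<phi> (T \<inter> uminus ` T)"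
  proof -
    have "seg c \<subseteq> T \<inter> uminus ` T"
    proof
      fix x assume "x \<in> seg c"
      then obtain \<alpha> where x: "\<bar>\<alpha>\<bar> \<le> 1" "x = \<alpha> *\<^sub>R c" by (auto simp: mem_seg)
      have "x \<in> P" unfolding mem_P x(2) ab[symmetric] using x(1)
        by (intro exI[of _ \<alpha>]) (simp add: scaleR_add_right)
      then have "x \<in> T" "- x \<in> T" using P_minus[of x] w x by (simp_all add: T_def)
      then show "x \<in> T \<inter> uminus ` T" by (intro IntI image_eqI[of _ _ "- x"]) auto
    qed
    then show ?thesis unfolding F_def using T
      by (intro mono) (auto simp: compact_Int convex_Int compact_negations convex_negations)
  qed
  ultimately show False by simp
qed

end

section \<open>Comparison of a body with its central symmetrization\<close>

lemma AE_lborel_interval_witness: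
  fixes a b :: real
  assumes "AE x in lborel. P x" "a < b"
  shows "\<exists>x\<in>{a<..<b}. P x"
proof (rule ccontr)
  assume none: "\<not> ?thesis"
  obtain N where N: "{x \<in> space lborel. \<not> P x} \<subseteq> N" "emeasure lborel N = 0" "N \<in> sets lborel"
    using assms(1) by (rule AE_E)
  have "{a<..<b} \<subseteq> N" using N none by auto
  then have "emeasure lborel {a<..<b} \<le> emeasure lborel N" using N by (intro emeasure_mono)
  then show False using N assms by simp
qed

lemma mem_profile: "t \<in> profile X e s \<longleftrightarrow> (\<exists>y. y \<in> X \<and> y + s *\<^sub>R e \<in> X \<and> t = wedge e y)"
  by (auto simp: profile_def)

section \<open>Chord profiles of a body and of its symmetrization\<close>

context
  fixes H K :: "(real ^ 2) set"
  assumes H: "compact H" "convex H" and K: "compact K" "convex K" "uminus ` K = K"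
    and central: "central H = K"
begin

lemma minus_mem: "k \<in> K \<Longrightarrow> - k \<in> K"
  using K(3) by blast

lemma half_diff_mem: "a \<in> H \<Longrightarrow> b \<in> H \<Longrightarrow> (1 / 2) *\<^sub>R (a - b) \<in> K"
  unfolding central[symmetric] mem_central by blast

lemma profile_minus: "t \<in> profile K e s \<Longrightarrow> - t \<in> profile K e s"
proof -
  assume "t \<in> profile K e s"
  then obtain y where y: "y \<in> K" "y + s *\<^sub>R e \<in> K" "t = wedge e y" by (auto simp: mem_profile)
  then have "- (y + s *\<^sub>R e) \<in> K" "- (y + s *\<^sub>R e) + s *\<^sub>R e \<in> K" "- t = wedge e (- (y + s *\<^sub>R e))"
    using minus_mem[OF y(1)] minus_mem[OF y(2)] by simp_all
  then show ?thesis unfolding mem_profile by blast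
qed

lemma profile_half_diff:
  assumes "t \<in> profile H e s" "u \<in> profile H e s"
  shows "(t - u) / 2 \<in> profile K e s"
proof -
  obtain y z where y: "y \<in> H" "y + s *\<^sub>R e \<in> H" "t = wedge e y"
    and z: "z \<in> H" "z + s *\<^sub>R e \<in> H" "u = wedge e z" using assms by (auto simp: mem_profile)
  \<comment> \<open>Pairing the start of one chord with the end of the other makes both ends of the
    new chord half-differences of points of \<open>H\<close>.\<close>
  define k where "k = (1 / 2) *\<^sub>R (y - (z + s *\<^sub>R e))"
  have "k + s *\<^sub>R e = (1 / 2) *\<^sub>R ((y + s *\<^sub>R e) - z)"
    by (simp add: k_def vec_eq_iff field_simps)
  then have "k \<in> K" "k + s *\<^sub>R e \<in> K" using half_diff_mem y z by (simp_all add: k_def)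
  moreover have "wedge e k = (t - u) / 2" by (simp add: k_def y z)
  ultimately show ?thesis unfolding mem_profile by metis
qed

lemma profile_nonempty: "profile K e s \<noteq> {} \<Longrightarrow> profile H e s \<noteq> {}"
proof -
  assume "profile K e s \<noteq> {}"
  then obtain y where y: "y \<in> K" "y + s *\<^sub>R e \<in> K" by (auto simp: profile_def)
  then have "(1 / 2) *\<^sub>R (y + s *\<^sub>R e) + (1 / 2) *\<^sub>R (- y) \<in> K" using minus_mem K by (intro convexD) auto
  then have "(1 / 2) *\<^sub>R (s *\<^sub>R e) \<in> K" by (simp add: scaleR_add_right)
  then obtain a b where ab: "a \<in> H" "b \<in> H" "(1 / 2) *\<^sub>R (s *\<^sub>R e) = (1 / 2) *\<^sub>R (a - b)"
    unfolding central[symmetric] mem_central by blast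
  then have "b + s *\<^sub>R e = a" by (simp add: vec_eq_iff field_simps)
  then show ?thesis using ab by (auto simp: profile_def)
qed

lemma profile_K_interval:
  assumes e: "e \<noteq> 0" and ne: "profile K e s \<noteq> {}"
  obtains \<tau> where "0 \<le> \<tau>" "profile K e s = {- \<tau>..\<tau>}"
proof -
  note P = profile_interval[OF K(1,2) e, of s]
  obtain l r where lr: "profile K e s = {l..r}"
    using connected_compact_interval_1 P convex_connected by metis
  then have "l \<le> r" using ne by auto
  then have "- l \<in> {l..r}" "- r \<in> {l..r}" using profile_minus[of l e s] profile_minus[of r e s] by (simp_all add: lr)
  then have "l = - r" by simp
  then show ?thesis using that[of r] lr \<open>l \<le> r\<close> by simp
qed

text \<open>The half-difference of the two ends of the profile of \<open>H\<close> lies in the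
  profile of \<open>K\<close>, an interval symmetric about \<open>0\<close>.\<close>

lemma emeasure_profile_le:
  assumes e: "e \<noteq> 0"
  shows "emeasure lborel (profile H e s) \<le> emeasure lborel (profile K e s)"
proof (cases "profile H e s = {}")
  case False
  note P = profile_interval[OF H e, of s]
  obtain l r where lr: "profile H e s = {l..r}"
    using connected_compact_interval_1 P convex_connected by metis
  then have "l \<le> r" using False by auto
  then have mem: "(r - l) / 2 \<in> profile K e s" by (intro profile_half_diff) (auto simp: lr)
  then obtain \<tau> where \<tau>: "0 \<le> \<tau>" "profile K e s = {- \<tau>..\<tau>}" using profile_K_interval[OF e] by blast
  then have "r - l \<le> 2 * \<tau>" using mem by auto
  then show ?thesis using \<tau> \<open>l \<le> r\<close> by (simp add: lr)
qed simp

lemma emeasure_profile_ge: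
  assumes e: "e \<noteq> 0"
    and attained: "\<And>t. t \<in> profile K e s \<Longrightarrow> \<exists>u\<in>profile H e s. \<exists>v\<in>profile H e s. 2 * t \<le> u - v"
  shows "emeasure lborel (profile K e s) \<le> emeasure lborel (profile H e s)"
proof (cases "profile K e s = {}")
  case False
  then obtain \<tau> where \<tau>: "0 \<le> \<tau>" "profile K e s = {- \<tau>..\<tau>}" using profile_K_interval[OF e] by blast
  then obtain u v where uv: "u \<in> profile H e s" "v \<in> profile H e s" "2 * \<tau> \<le> u - v"
    using attained[of \<tau>] by auto
  have "closed_segment v u \<subseteq> profile H e s"
    using uv profile_interval[OF H e] by (intro closed_segment_subset)
  moreover have "closed_segment v u = {v..u}" using uv \<tau> by (simp add: closed_segment_eq_real_ivl)
  ultimately have "emeasure lborel {v..u} \<le> emeasure lborel (profile H e s)"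
    using profile_interval[OF H e, of s] by (intro emeasure_mono) (auto intro: borel_compact)
  moreover have "emeasure lborel (profile K e s) \<le> emeasure lborel {v..u}"
    using \<tau> uv by (simp add: ennreal_leI)
  ultimately show ?thesis by simp
qed simp

text \<open>Passes from almost every length to every positive one: equality holds at some
  \<open>s'\<close> just below \<open>s\<close>, where the profile of \<open>K\<close> still
  contains \<open>t\<close>, and the points of \<open>H\<close> found there converge along a
  subsequence.\<close>

lemma profile_attained:
  assumes e: "e \<noteq> 0"
    and AE: "AE s in lborel. 0 \<le> s \<longrightarrow> emeasure lborel (profile H e s) = emeasure lborel (profile K e s)"
    and s: "0 < s" and t: "t \<in> profile K e s"
  shows "\<exists>u\<in>profile H e s. \<exists>v\<in>profile H e s. 2 * t \<le> u - v"
proof -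
  have near: "\<exists>s'. s - s / real (Suc n) < s' \<and> s' < s \<and>
      (\<exists>y z. y \<in> H \<and> y + s' *\<^sub>R e \<in> H \<and> z \<in> H \<and> z + s' *\<^sub>R e \<in> H \<and> 2 * t \<le> wedge e y - wedge e z)" for n
  proof -
    have "s - s / real (Suc n) < s" using s by simp
    from AE_lborel_interval_witness[OF AE this] obtain s' where
      s': "s - s / real (Suc n) < s'" "s' < s"
      and eq: "0 \<le> s' \<longrightarrow> emeasure lborel (profile H e s') = emeasure lborel (profile K e s')" by auto
    have "s / real (Suc n) \<le> s" using s by (simp add: field_simps)
    then have "0 \<le> s'" using s' by simp
    obtain k where k: "k \<in> K" "k + s *\<^sub>R e \<in> K" "t = wedge e k" using t by (auto simp: mem_profile)
    have "(1 - s' / s) *\<^sub>R k + (s' / s) *\<^sub>R (k + s *\<^sub>R e) \<in> K"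
      using k K \<open>0 \<le> s'\<close> s' s by (intro convexD) auto
    moreover have "(1 - s' / s) *\<^sub>R k + (s' / s) *\<^sub>R (k + s *\<^sub>R e) = k + s' *\<^sub>R e"
      using s by (simp add: algebra_simps)
    ultimately have t': "t \<in> profile K e s'" using k by (auto simp: mem_profile)
    then obtain \<tau> where \<tau>: "0 \<le> \<tau>" "profile K e s' = {- \<tau>..\<tau>}" using profile_K_interval[OF e] by blast
    have ne: "profile H e s' \<noteq> {}" using t' by (intro profile_nonempty) auto
    note P = profile_interval[OF H e, of s']
    obtain l r where lr: "profile H e s' = {l..r}"
      using connected_compact_interval_1 P convex_connected by metis
    then have "l \<le> r" using ne by auto
    have "ennreal (r - l) = ennreal (2 * \<tau>)" using eq \<open>0 \<le> s'\<close> \<tau> lr \<open>l \<le> r\<close> by simp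
    then have "r - l = 2 * \<tau>" using \<open>l \<le> r\<close> \<tau> by simp
    then have "2 * t \<le> r - l" using t' \<tau> by auto
    moreover have "r \<in> profile H e s'" "l \<in> profile H e s'" using lr \<open>l \<le> r\<close> by auto
    ultimately show ?thesis using s' unfolding mem_profile by blast
  qed
  then obtain S y z where S: "\<And>n. s - s / real (Suc n) < S n" "\<And>n. S n < s"
    and yz: "\<And>n. y n \<in> H" "\<And>n. y n + S n *\<^sub>R e \<in> H" "\<And>n. z n \<in> H" "\<And>n. z n + S n *\<^sub>R e \<in> H"
      "\<And>n. 2 * t \<le> wedge e (y n) - wedge e (z n)"
    by metis
  have "S \<longlonglongrightarrow> s"
  proof (rule tendsto_sandwich)
    have "(\<lambda>n. s - s * (1 / real (Suc n))) \<longlonglongrightarrow> s - s * 0"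
      by (intro tendsto_intros LIMSEQ_Suc[OF lim_1_over_n])
    then show "(\<lambda>n. s - s / real (Suc n)) \<longlonglongrightarrow> s" by simp
  qed (use S in \<open>auto intro!: always_eventually less_imp_le\<close>)
  have "compact (H \<times> H)" using H by (intro compact_Times)
  moreover have "\<forall>n. (y n, z n) \<in> H \<times> H" using yz by simp
  ultimately obtain p r where "p \<in> H \<times> H" "strict_mono r" and lim: "((\<lambda>n. (y n, z n)) \<circ> r) \<longlonglongrightarrow> p"
    unfolding compact_def by meson
  obtain y0 z0 where p: "p = (y0, z0)" "y0 \<in> H" "z0 \<in> H" using \<open>p \<in> H \<times> H\<close> by auto
  have y_lim: "(\<lambda>n. y (r n)) \<longlonglongrightarrow> y0" and z_lim: "(\<lambda>n. z (r n)) \<longlonglongrightarrow> z0"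
    using tendsto_fst[OF lim] tendsto_snd[OF lim] by (simp_all add: p o_def)
  have S_lim: "(\<lambda>n. S (r n)) \<longlonglongrightarrow> s" using LIMSEQ_subseq_LIMSEQ[OF \<open>S \<longlonglongrightarrow> s\<close> \<open>strict_mono r\<close>] by (simp add: o_def)
  have H': "closed H" using H by (simp add: compact_imp_closed)
  have "y0 + s *\<^sub>R e \<in> H"
    by (rule closed_sequentially[OF H', of "\<lambda>n. y (r n) + S (r n) *\<^sub>R e"]) (use yz in \<open>auto intro!: tendsto_intros y_lim S_lim\<close>)
  moreover have "z0 + s *\<^sub>R e \<in> H"
    by (rule closed_sequentially[OF H', of "\<lambda>n. z (r n) + S (r n) *\<^sub>R e"]) (use yz in \<open>auto intro!: tendsto_intros z_lim S_lim\<close>)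
  moreover have "2 * t \<le> wedge e y0 - wedge e z0"
  proof (rule LIMSEQ_le_const)
    have "continuous_on UNIV (wedge e)" by (intro continuous_intros)
    then have "isCont (wedge e) x" for x by (simp add: continuous_on_eq_continuous_at)
    then show "(\<lambda>n. wedge e (y (r n)) - wedge e (z (r n))) \<longlonglongrightarrow> wedge e y0 - wedge e z0"
      using y_lim z_lim by (intro tendsto_diff isCont_tendsto_compose[of _ "wedge e"])
  qed (use yz in auto)
  moreover have "wedge e x \<in> profile H e s" if "x \<in> H" "x + s *\<^sub>R e \<in> H" for x
    unfolding mem_profile using that by blast
  ultimately show ?thesis using p by blast
qed

text \<open>For \<open>e = q - q'\<close> the highest point of \<open>K \<inter> (K - e)\<close> is \<open>q'\<close>, up to replacing \<open>(q, q')\<close> by \<open>(-q', -q)\<close>;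
  equality of the profiles at \<open>s = 1\<close> yields a parallelogram in \<open>H\<close> that is a translate of the one with vertices
  \<open>\<plusminus>q, \<plusminus>q'\<close>.\<close>

lemma common_center:
  assumes q: "q extreme_point_of K" "q' extreme_point_of K" "q \<noteq> q'"
    and AE: "\<And>e. e \<noteq> 0 \<Longrightarrow>
      AE s in lborel. 0 \<le> s \<longrightarrow> emeasure lborel (profile H e s) = emeasure lborel (profile K e s)"
  shows "\<exists>c. c + q \<in> H \<and> c - q \<in> H \<and> c + q' \<in> H \<and> c - q' \<in> H"
proof -
  define e where "e = q - q'"
  have e: "e \<noteq> 0" using q by (simp add: e_def)
  have qK: "q \<in> K" "q' \<in> K" using q by (auto simp: extreme_point_of_def)
  have t_mem: "wedge e q' \<in> profile K e 1" unfolding mem_profile using qK by (intro exI[of _ q']) (simp add: e_def)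
  then obtain \<tau> where \<tau>: "0 \<le> \<tau>" "profile K e 1 = {- \<tau>..\<tau>}" using profile_K_interval[OF e] by blast
  define t where "t = wedge e q'"
  have t: "- \<tau> \<le> t" "t \<le> \<tau>" using t_mem \<tau> by (auto simp: t_def)
  obtain u v where uv: "u \<in> profile H e 1" "v \<in> profile H e 1" "2 * \<tau> \<le> u - v"
    using profile_attained[OF e AE[OF e], of 1 \<tau>] \<tau> by auto
  obtain y z where y: "y \<in> H" "y + e \<in> H" "u = wedge e y" and z: "z \<in> H" "z + e \<in> H" "v = wedge e z"
    using uv by (auto simp: mem_profile)
  \<comment> \<open>The points \<open>k\<close> and \<open>- (k + e)\<close> will start chords of
    \<open>K\<close> with vector \<open>e\<close> at the extreme heights \<open>\<tau>\<close> and
    \<open>- \<tau>\<close>.\<close>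
  define k where "k = (1 / 2) *\<^sub>R (y - (z + e))"
  have ke: "k + e = (1 / 2) *\<^sub>R ((y + e) - z)" by (simp add: k_def vec_eq_iff field_simps)
  have k: "k \<in> K" "k + e \<in> K" unfolding ke using half_diff_mem y z by (simp_all add: k_def)
  have "wedge e k \<in> profile K e 1" unfolding mem_profile using k by (intro exI[of _ k]) simp
  moreover have "wedge e k = (u - v) / 2" by (simp add: k_def y z)
  ultimately have wk: "wedge e k = \<tau>" using uv \<tau> by auto
  \<comment> \<open>The weight that brings the combination of \<open>k\<close> and
    \<open>- (k + e)\<close> to the height of \<open>q'\<close>; for \<open>\<tau> = 0\<close> all
    heights are \<open>0\<close> and any weight serves.\<close>
  define \<theta> where "\<theta> = (if \<tau> = 0 then 1 else (\<tau> + t) / (2 * \<tau>))"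
  have \<theta>: "0 \<le> \<theta>" "\<theta> \<le> 1" "\<theta> * \<tau> - (1 - \<theta>) * \<tau> = t"
    using t \<tau>(1) by (auto simp: \<theta>_def field_simps)
  define m where "m = \<theta> *\<^sub>R k + (1 - \<theta>) *\<^sub>R (- (k + e))"
  have me: "m + e = \<theta> *\<^sub>R (k + e) + (1 - \<theta>) *\<^sub>R (- k)" by (simp add: m_def algebra_simps)
  have "m \<in> K" unfolding m_def by (rule convexD[OF K(2) k(1) minus_mem[OF k(2)]]) (use \<theta> in simp_all)
  moreover have "m + e \<in> K"
    unfolding me by (rule convexD[OF K(2) k(2) minus_mem[OF k(1)]]) (use \<theta> in simp_all)
  ultimately have mK: "m \<in> K" "m + e \<in> K" by simp_all
  have "wedge e m = \<theta> * wedge e k - (1 - \<theta>) * wedge e k" by (simp add: m_def)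
  also have "\<dots> = t" unfolding wk by (rule \<theta>(3))
  finally have "wedge e m = t" .
  then have "m - q' = kappa e (m - q') *\<^sub>R e"
    using e by (intro eq_if_kappa_wedge_eq[of e]) (simp_all add: t_def)
  moreover define r where "r = kappa e (m - q')"
  ultimately have r: "m = q' + r *\<^sub>R e" by (metis add.commute diff_add_cancel)
  have q_eq: "q = q' + e" by (simp add: e_def)
  \<comment> \<open>The chords with vector \<open>e\<close> from \<open>m\<close> and from
    \<open>q'\<close> lie on one line; if they differed, \<open>q\<close> or \<open>q'\<close> would
    be inside a longer chord, against extremality.\<close>
  have "r = 0"
  proof (rule ccontr)
    assume "r \<noteq> 0"
    then consider "0 < r" | "r < 0" by linarith
    then show False
    proof cases
      case 1
      define l where "l = 1 / (1 + r)"
      have "(1 - l) *\<^sub>R q' + l *\<^sub>R (m + e) = q' + (l * (1 + r)) *\<^sub>R e"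
        by (simp add: r algebra_simps)
      also have "l * (1 + r) = 1" using 1 by (simp add: l_def)
      finally have "q = (1 - l) *\<^sub>R q' + l *\<^sub>R (m + e)" by (simp add: q_eq)
      moreover have "q' \<noteq> m + e"
      proof
        assume "q' = m + e"
        then have "(1 + r) *\<^sub>R e = 0" by (simp add: r algebra_simps)
        then show False using 1 e by simp
      qed
      moreover have "0 < l" "l < 1" using 1 by (auto simp: l_def)
      ultimately have "q \<in> open_segment q' (m + e)" unfolding in_segment by blast
      then show False using q(1) qK mK by (auto simp: extreme_point_of_def)
    next
      case 2
      define l where "l = (- r) / (1 - r)"
      have "(1 - l) *\<^sub>R m + l *\<^sub>R q = q' + (r + l * (1 - r)) *\<^sub>R e"
        by (simp add: q_eq r algebra_simps)
      also have "l * (1 - r) = - r" using 2 by (simp add: l_def)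
      finally have "q' = (1 - l) *\<^sub>R m + l *\<^sub>R q" by simp
      moreover have "m \<noteq> q"
      proof
        assume "m = q"
        then have "(1 - r) *\<^sub>R e = 0" by (simp add: r q_eq algebra_simps)
        then show False using 2 e by simp
      qed
      moreover have "0 < l" "l < 1" using 2 by (auto simp: l_def field_simps)
      ultimately have "q' \<in> open_segment m q" unfolding in_segment by blast
      then show False using q(2) qK mK by (auto simp: extreme_point_of_def)
    qed
  qed
  then have "q' = m" "q = m + e" using r q_eq by simp_all
  have "(q = k + e \<and> q' = k) \<or> (q = - k \<and> q' = - (k + e))"
  proof (cases "\<theta> = 0 \<or> \<theta> = 1 \<or> - k = k + e")
    case True
    then show ?thesis
    proof (elim disjE)
      assume "- k = k + e"
      have "q = \<theta> *\<^sub>R (k + e) + (1 - \<theta>) *\<^sub>R (k + e)"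
        using \<open>q = m + e\<close> me unfolding \<open>- k = k + e\<close> by simp
      then have "q = k + e" by (simp only: scaleR_left_distrib[symmetric]) simp
      then show ?thesis using q_eq by simp
    qed (use \<open>q' = m\<close> \<open>q = m + e\<close> me in \<open>simp_all add: m_def\<close>)
  next
    case False
    then have "q = (1 - \<theta>) *\<^sub>R (- k) + \<theta> *\<^sub>R (k + e)" "0 < \<theta>" "\<theta> < 1"
      using \<open>q = m + e\<close> me \<theta> by simp_all
    then have "q \<in> open_segment (- k) (k + e)" unfolding in_segment using False by blast
    then show ?thesis using q(1) k minus_mem by (auto simp: extreme_point_of_def)
  qed
  \<comment> \<open>The center of the parallelogram with vertices \<open>y\<close>,
    \<open>y + e\<close>, \<open>z\<close>, \<open>z + e\<close>, whose half-diagonals are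
    \<open>k + e\<close> and \<open>k\<close>.\<close>
  moreover define c where "c = (1 / 2) *\<^sub>R (y + z + e)"
  have "c + (k + e) = y + e" "c - (k + e) = z" "c + k = y" "c - k = z + e"
    by (simp_all add: c_def k_def vec_eq_iff field_simps)
  then have "c + (k + e) \<in> H" "c - (k + e) \<in> H" "c + k \<in> H" "c - k \<in> H" using y z by metis+
  ultimately show ?thesis
    by (intro exI[of _ c], elim disjE) (simp_all only: add_uminus_conv_diff diff_minus_eq_add)
qed

section \<open>Recovery of the body from common centers\<close>

lemma extreme_if_max_norm:
  assumes "q \<in> K" "\<And>k. k \<in> K \<Longrightarrow> norm k \<le> norm q"
  shows "q extreme_point_of K"
  unfolding extreme_point_of_def
proof (intro conjI ballI notI)
  fix a b assume ab: "a \<in> K" "b \<in> K" "q \<in> open_segment a b"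
  then obtain u where u: "0 < u" "u < 1" "q = (1 - u) *\<^sub>R a + u *\<^sub>R b" "a \<noteq> b" by (auto simp: in_segment)
  have le: "x \<bullet> q \<le> q \<bullet> q" "x \<bullet> q = q \<bullet> q \<Longrightarrow> x = q" if "x \<in> K" for x
  proof -
    have "(norm x)\<^sup>2 \<le> (norm q)\<^sup>2" using assms(2)[OF that] by (intro power_mono) auto
    then have "x \<bullet> x \<le> q \<bullet> q" by (simp add: power2_norm_eq_inner)
    moreover have "(x - q) \<bullet> (x - q) = x \<bullet> x - 2 * (x \<bullet> q) + q \<bullet> q"
      by (simp add: inner_diff_left inner_diff_right inner_commute)
    ultimately have *: "(x - q) \<bullet> (x - q) \<le> 2 * (q \<bullet> q) - 2 * (x \<bullet> q)" by simp
    then show "x \<bullet> q \<le> q \<bullet> q" using inner_ge_zero[of "x - q"] by linarith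
    show "x = q" if "x \<bullet> q = q \<bullet> q"
    proof -
      have "(x - q) \<bullet> (x - q) = 0" using * that inner_ge_zero[of "x - q"] by linarith
      then have "x - q = 0" by (simp only: inner_eq_zero_iff)
      then show ?thesis by simp
    qed
  qed
  have "q \<bullet> q = (1 - u) * (a \<bullet> q) + u * (b \<bullet> q)" by (subst (1) u(3)) (simp add: inner_add_left)
  then have sum0: "(1 - u) * (q \<bullet> q - a \<bullet> q) + u * (q \<bullet> q - b \<bullet> q) = 0" by (simp add: algebra_simps)
  have nn: "0 \<le> (1 - u) * (q \<bullet> q - a \<bullet> q)" "0 \<le> u * (q \<bullet> q - b \<bullet> q)"
    using u le(1)[OF ab(1)] le(1)[OF ab(2)] by simp_all
  have "(1 - u) * (q \<bullet> q - a \<bullet> q) = 0" "u * (q \<bullet> q - b \<bullet> q) = 0"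
    using sum0 unfolding add_nonneg_eq_0_iff[OF nn] by simp_all
  then have "a \<bullet> q = q \<bullet> q" "b \<bullet> q = q \<bullet> q" using u(1,2) by simp_all
  then have "a = q" "b = q" using le(2)[OF ab(1)] le(2)[OF ab(2)] by auto
  then show False using u(4) by simp
qed fact

text \<open>A point \<open>q\<close> of maximal norm determines its center uniquely, since \<open>q \<plusminus> d \<in> K\<close> forces \<open>d = 0\<close>; this
  center then serves all other extreme points.\<close>

theorem translate_if_common_centers:
  assumes ne: "\<exists>k\<in>K. k \<noteq> 0"
    and centers: "\<And>q q'. q extreme_point_of K \<Longrightarrow> q' extreme_point_of K \<Longrightarrow> q \<noteq> q' \<Longrightarrow>
      \<exists>c. c + q \<in> H \<and> c - q \<in> H \<and> c + q' \<in> H \<and> c - q' \<in> H"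
  shows "\<exists>t. H = (+) t ` K"
proof -
  have "K \<noteq> {}" using ne by blast
  moreover have "continuous_on K norm" by (intro continuous_intros)
  ultimately obtain q where q: "q \<in> K" "\<And>k. k \<in> K \<Longrightarrow> norm k \<le> norm q"
    using continuous_attains_sup[OF K(1)] by blast
  have "q \<noteq> 0" using ne q by force
  have ext: "q extreme_point_of K" "- q extreme_point_of K"
    using q minus_mem by (auto intro!: extreme_if_max_norm)
  have "q \<noteq> - q"
  proof
    assume "q = - q"
    then have "2 *\<^sub>R q = 0" by (metis add.right_inverse scaleR_2)
    then show False using \<open>q \<noteq> 0\<close> by simp
  qed
  then obtain c where c: "c + q \<in> H" "c - q \<in> H" using centers[OF ext] by blast
  have unique: "c' = c" if "c' + q \<in> H" "c' - q \<in> H" for c'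
  proof -
    \<comment> \<open>Mixed half-differences put \<open>q + d\<close> and \<open>q - d\<close> in
      \<open>K\<close>; the parallelogram law and maximality of \<open>norm q\<close> then force
      \<open>d = 0\<close>.\<close>
    define d where "d = (1 / 2) *\<^sub>R (c - c')"
    have "(1 / 2) *\<^sub>R ((c + q) - (c' - q)) = q + d" "(1 / 2) *\<^sub>R ((c' + q) - (c - q)) = q - d"
      by (simp_all add: d_def vec_eq_iff field_simps)
    then have "q + d \<in> K" "q - d \<in> K" using half_diff_mem c that by metis+
    then have "(norm (q + d))\<^sup>2 \<le> (norm q)\<^sup>2" "(norm (q - d))\<^sup>2 \<le> (norm q)\<^sup>2"
      using q(2) by (auto intro!: power_mono)
    then have "d \<bullet> d \<le> 0"
      by (simp add: power2_norm_eq_inner inner_add_left inner_add_right inner_diff_left inner_diff_right inner_commute)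
    then have "d \<bullet> d = 0" using inner_ge_zero[of d] by linarith
    then have "d = 0" by (simp only: inner_eq_zero_iff)
    then show ?thesis by (simp add: d_def)
  qed
  have "k \<in> (+) (- c) ` H" if k: "k extreme_point_of K" for k
  proof (cases "k = q")
    case True then show ?thesis unfolding mem_translate using c by (simp add: add.commute)
  next
    case False
    then obtain c' where "c' + q \<in> H" "c' - q \<in> H" "c' + k \<in> H" using centers[OF ext(1) k] by blast
    moreover from this have "c' = c" by (intro unique)
    ultimately show ?thesis unfolding mem_translate by (simp add: add.commute)
  qed
  moreover have "convex ((+) (- c) ` H)" using H by (intro convex_translation)
  ultimately have "convex hull {k. k extreme_point_of K} \<subseteq> (+) (- c) ` H" by (intro hull_minimal) auto
  then have "K \<subseteq> (+) (- c) ` H" using Krein_Milman_Minkowski[OF K(1,2)] by simp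
  then have sub: "c + k \<in> H" if "k \<in> K" for k
    using that unfolding subset_iff mem_translate by (simp add: add.commute[of c])
  \<comment> \<open>If \<open>k\<close> maximizes the functional given by \<open>u\<close> on
    \<open>K\<close>, then \<open>c - k\<close> is in \<open>H\<close>, and the half-difference of
    \<open>a\<close> and \<open>c - k\<close> lies in \<open>K\<close>; this bounds
    \<open>u \<bullet> a\<close> by the value at \<open>c + k\<close>.\<close>
  have "H \<subseteq> (+) c ` K"
  proof (rule subset_if_support_le)
    fix u a assume a: "a \<in> H"
    have "continuous_on K (\<lambda>k. u \<bullet> k)" by (intro continuous_intros)
    then obtain k where k: "k \<in> K" "\<And>x. x \<in> K \<Longrightarrow> u \<bullet> x \<le> u \<bullet> k"
      using continuous_attains_sup[OF K(1) \<open>K \<noteq> {}\<close>] by blast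
    have "(1 / 2) *\<^sub>R (a - (c + - k)) \<in> K" using a sub[OF minus_mem[OF k(1)]] by (rule half_diff_mem)
    then have "u \<bullet> ((1 / 2) *\<^sub>R (a - (c + - k))) \<le> u \<bullet> k" by (rule k)
    then have "u \<bullet> a \<le> u \<bullet> (c + k)" by (simp add: inner_diff_right inner_add_right)
    then show "\<exists>b\<in>(+) c ` K. u \<bullet> a \<le> u \<bullet> b" using k by blast
  qed (intro compact_imp_closed compact_translation convex_translation K)+
  moreover have "(+) c ` K \<subseteq> H" using sub by blast
  ultimately show ?thesis by blast
qed

section \<open>Equality of the areas\<close>

theorem area_eq_if_covariogram_eq:
  assumes \<phi>: "Phi2_functional \<phi>" and nonzero: "\<not> zero_functional \<phi>"
    and eq: "covariogram \<phi> H = covariogram \<phi> K" and e: "e \<noteq> 0"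
  shows "area e H = area e K"
proof -
  interpret \<phi>: Phi2_functional \<phi> by fact
  have g: "\<phi> (H \<inter> (+) x ` H) = \<phi> (K \<inter> (+) x ` K)" for x
    using fun_cong[OF eq, of x] by (simp add: covariogram_def)
  have area: "Phi2_functional (area d)" if "d \<noteq> 0" for d
    by unfold_locales (rule Phi2_area[OF that])
  show ?thesis
  proof (cases "\<phi>.coef = 0")
    case False
    have "\<phi> H = \<phi> K" using g[of 0] by simp
    then show ?thesis
      using central_defect_proportional[OF \<phi> area[OF e] H] False by (simp add: central)
  next
    case True
    obtain d where d: "d \<noteq> 0"
      and strict: "\<And>a b. wedge d a \<noteq> 0 \<Longrightarrow> wedge d (a + b) = 0 \<Longrightarrow> \<phi>.F (a + b) < \<phi>.F a + \<phi>.F b"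
      using \<phi>.strict_direction[OF True nonzero] by blast
    have "emeasure lborel (profile K d s) \<le> emeasure lborel (profile H d s)" for s
    proof (rule emeasure_profile_ge[OF d])
      fix t assume t: "t \<in> profile K d s"
      define x where "x = s *\<^sub>R d"
      define A where "A = H \<inter> (+) x ` H"
      \<comment> \<open>\<open>K \<inter> (K + x)\<close> shifted so that it is symmetric about
        \<open>0\<close> and contains the symmetrization of \<open>A\<close>.\<close>
      define B where "B = (+) (- (1 / 2) *\<^sub>R x) ` (K \<inter> (+) x ` K)"
      have A: "compact A" "convex A"
        unfolding A_def using H by (auto intro: compact_Int convex_Int compact_translation convex_translation)
      have KK: "compact (K \<inter> (+) x ` K)" "convex (K \<inter> (+) x ` K)"
        using K by (auto intro: compact_Int convex_Int compact_translation convex_translation)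
      have B: "compact B" "convex B"
        unfolding B_def by (intro compact_translation convex_translation KK)+
      have mem_A: "a \<in> A \<longleftrightarrow> a \<in> H \<and> a - x \<in> H" for a unfolding A_def Int_iff mem_translate by simp
      have mem_B: "b \<in> B \<longleftrightarrow> b + (1 / 2) *\<^sub>R x \<in> K \<and> b - (1 / 2) *\<^sub>R x \<in> K" for b
      proof -
        have "b - - (1 / 2) *\<^sub>R x = b + (1 / 2) *\<^sub>R x"
          "b + (1 / 2) *\<^sub>R x - x = b - (1 / 2) *\<^sub>R x" by (simp_all add: vec_eq_iff field_simps)
        then show ?thesis unfolding B_def mem_translate Int_iff by (simp only:)
      qed
      \<comment> \<open>The coefficient of \<open>\<phi>\<close> is zero and that of the area is
        not, so symmetrization leaves \<open>\<phi> A\<close> unchanged.\<close>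
      have "Phi2_functional.coef (area d) * (\<phi> (central A) - \<phi> A) = 0"
        using central_defect_proportional[OF \<phi> area[OF d] A] True by simp
      then have "\<phi> (central A) = \<phi> A" using coef_area[OF d] by simp
      also have "\<dots> = \<phi> (K \<inter> (+) x ` K)" unfolding A_def by (rule g)
      also have "\<dots> = \<phi> B" unfolding B_def by (rule \<phi>.translate[OF KK, symmetric])
      finally have \<phi>_eq: "\<phi> (central A) = \<phi> B" .
      have sub: "central A \<subseteq> B"
      proof
        fix w assume "w \<in> central A"
        then obtain a b where ab: "a \<in> A" "b \<in> A" "w = (1 / 2) *\<^sub>R (a - b)" by (auto simp: mem_central)
        have "w + (1 / 2) *\<^sub>R x = (1 / 2) *\<^sub>R (a - (b - x))" "w - (1 / 2) *\<^sub>R x = (1 / 2) *\<^sub>R ((a - x) - b)"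
          by (simp_all add: ab(3) vec_eq_iff field_simps)
        then show "w \<in> B" unfolding mem_B using ab half_diff_mem by (simp only: mem_A)
      qed
      have "profile H d s \<noteq> {}" using t by (intro profile_nonempty) auto
      then obtain y where "y \<in> H" "y + x \<in> H" by (auto simp: profile_def x_def)
      then have "y + x \<in> A" by (simp add: mem_A)
      then have "central A \<noteq> {}" using mem_central by blast
      obtain k where k: "k \<in> K" "k + x \<in> K" "t = wedge d k" using t by (auto simp: mem_profile x_def)
      have "k + (1 / 2) *\<^sub>R x + (1 / 2) *\<^sub>R x = k + x" by (simp add: vec_eq_iff field_simps)
      then have "k + (1 / 2) *\<^sub>R x \<in> B"
        unfolding mem_B using k(1,2) by (simp only: add_diff_cancel_right' simp_thms)
      \<comment> \<open>As the values agree and \<open>d\<close> is a strict direction,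
        \<open>central A\<close> reaches the height of every point of \<open>B\<close>; this point
        has height \<open>t\<close> because \<open>x\<close> is parallel to
        \<open>d\<close>.\<close>
      then obtain w where w: "w \<in> central A" "wedge d (k + (1 / 2) *\<^sub>R x) \<le> wedge d w"
        using \<phi>.height_le_if_eq[OF True d strict compact_central[OF A(1)] convex_central[OF A(2)]
            \<open>central A \<noteq> {}\<close> B sub \<phi>_eq] by blast
      obtain a b where ab: "a \<in> A" "b \<in> A" "w = (1 / 2) *\<^sub>R (a - b)" using w by (auto simp: mem_central)
      have "wedge d (a - x) \<in> profile H d s" if "a \<in> A" for a
        using that unfolding mem_profile mem_A x_def by (intro exI[of _ "a - s *\<^sub>R d"]) simp
      then have "wedge d (a - x) \<in> profile H d s" "wedge d (b - x) \<in> profile H d s" using ab by blast+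
      moreover have "2 * t \<le> wedge d (a - x) - wedge d (b - x)"
        using w ab k by (simp add: x_def)
      ultimately show "\<exists>u\<in>profile H d s. \<exists>v\<in>profile H d s. 2 * t \<le> u - v" by blast
    qed
    then have "area d H = area d K"
      using emeasure_profile_le[OF d] by (intro profile_eq_imp_area_eq[OF H K(1,2) d]) (auto intro: antisym)
    \<comment> \<open>Proportionality between the functionals \<open>area e\<close> and
      \<open>area d\<close> transfers the equality from \<open>d\<close> to any direction.\<close>
    then have "Phi2_functional.coef (area d) * (area e K - area e H) = 0"
      using central_defect_proportional[OF area[OF e] area[OF d] H] by (simp add: central)
    then show ?thesis using coef_area[OF d] by simp
  qed
qed

end

section \<open>Determination by the covariogram\<close>

theorem theorem1p1:
  fixes \<phi> :: "(real ^ 2) set \<Rightarrow> real" and K H :: "(real ^ 2) set"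
  assumes "\<phi> \<in> Phi2" and "\<not> zero_functional \<phi>"
    and "planar_convex_body K" and "centrally_symmetric K"
    and "planar_convex_body H"
    and "covariogram \<phi> H = covariogram \<phi> K"
  shows "\<exists>t. H = (+) t ` K"
proof -
  interpret Phi2_functional \<phi> by unfold_locales fact
  have K: "compact K" "convex K" "interior K \<noteq> {}" and H: "compact H" "convex H" "interior H \<noteq> {}"
    using assms by (auto simp: planar_convex_body_def compact_convex_sets_def)
  obtain c where c: "(\<lambda>x. 2 *\<^sub>R c - x) ` K = K" using assms(4) by (auto simp: centrally_symmetric_def)
  define K' where "K' = (+) (- c) ` K"
  have K': "compact K'" "convex K'" "interior K' \<noteq> {}"
    unfolding K'_def interior_translation using K by (simp_all only: compact_translation convex_translation image_is_empty) auto
  have sym: "uminus ` K' = K'"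
  proof -
    have "uminus ` K' = (+) (- c) ` (\<lambda>x. 2 *\<^sub>R c - x) ` K"
      unfolding K'_def image_image by (simp add: scaleR_2 algebra_simps)
    then show ?thesis by (simp add: c K'_def)
  qed
  have "covariogram \<phi> K' x = covariogram \<phi> K x" for x
  proof -
    have "K' \<inter> (+) x ` K' = (+) (- c) ` (K \<inter> (+) x ` K)"
      unfolding K'_def set_eq_iff Int_iff mem_translate by (simp add: algebra_simps)
    moreover have "compact (K \<inter> (+) x ` K)" "convex (K \<inter> (+) x ` K)"
      using K by (auto intro: compact_Int convex_Int compact_translation convex_translation)
    ultimately show ?thesis by (simp only: covariogram_def translate)
  qed
  then have eq: "covariogram \<phi> H = covariogram \<phi> K'" using assms(6) by auto
  \<comment> \<open>The supports of the covariograms are compared in both directions;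
    \<open>K'\<close> is its own symmetrization.\<close>
  have "central H = central K'"
    using covariogram_eq_imp_central_subset[OF assms(2) K' H(1,2) eq]
      covariogram_eq_imp_central_subset[OF assms(2) H K'(1,2) eq[symmetric]] by blast
  then have central: "central H = K'" by (simp add: central_symmetric_eq[OF K'(2) sym])
  note HK = H(1,2) K'(1,2) sym central
  have "\<exists>k\<in>K'. k \<noteq> 0"
  proof (rule ccontr)
    assume "\<not> ?thesis"
    then have "K' \<subseteq> {0}" by blast
    then show False using K'(3) interior_mono[of K' "{0}"] by simp
  qed
  \<comment> \<open>The profiles of \<open>H\<close> never exceed those of \<open>K'\<close> in
    length, so equal areas force equality for almost every \<open>s\<close>.\<close>
  moreover have "AE s in lborel. 0 \<le> s \<longrightarrow> emeasure lborel (profile H e s) = emeasure lborel (profile K' e s)"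
    if "e \<noteq> 0" for e
    using emeasure_profile_le[OF HK that]
      area_eq_if_covariogram_eq[OF HK Phi2_functional_axioms assms(2) eq that]
    by (intro area_eq_imp_profile_eq[OF H(1,2) K'(1,2) that])
  ultimately obtain t where "H = (+) t ` K'"
    using translate_if_common_centers[OF HK] common_center[OF HK] by blast
  then have "H = (+) (t - c) ` K" by (simp add: K'_def image_image algebra_simps)
  then show ?thesis by blast
qed

end
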